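(* Let $(X(t);t\geqslant 0)$ be the continuized random adding process with initial conditions $X(t)=x(t)$, $0\leqslant t\leqslant\tau$, where $\tau\geqslant 0$. Let $c(s,t)=E\{X(s)X(t)\}$, $q(t)=E(X^2(t))$ and $Q(t)=\int_0^t\int_0^tc(u,v)\,du\,dv$. For $\tau\leqslant s<t$, $$c(s,t)=(1+t)\left\{\frac{q(s)}{1+s}+e^s\left[(1+s)Q'(s)-(2+s)s\,q(s)\right]\int_s^t\frac{e^{-y}}{y(1+y)^2}\,dy\right\},$$ and if $s,t\to\infty$ with $s\leqslant t$, then $$t^{-2}c(s,t)\to\begin{cases}\frac23\theta K&\text{if } s/t\to\theta\in(0,1),\\ K&\text{if } s=t,\end{cases}$$ where $K$ is the constant, depending on the initial conditions, for which $q(t)\sim Kt^2$ as $t\to\infty$.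
   Context: Continuized random adding process: let $\tau\geqslant 0$ and let $(N(t),t>\tau)$, with $N(\tau)=0$, be a Poisson process of intensity $1$ with successive jump times $(T_r;r\geqslant 1)$; put $T_0=\tau$. Let $(U_r;r\geqslant 1)$ and $(V_r;r\geqslant 1)$ be independent sequences of independent random variables such that $U_r$ and $V_r$ are uniformly distributed on $[0,T_r]$. With fixed initial conditions $X(t)=x(t)$ for $0\leqslant t\leqslant\tau$, the process is defined, for $r\geqslant 1$, by $$X(t)=X(T_{r-1})\ \text{ for } T_{r-1}\leqslant t<T_r,\qquad X(T_r)=X(U_r)+X(V_r).$$ $Q'$ denotes the first derivative of $Q$, $Q'(t)=\int_0^tc(u,t)\,du+\int_0^tc(t,v)\,dv$. It is known that $q(t)$ grows quadratically, so that the constant $K$ exists. *)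

theory Defs
  imports "HOL-Probability.Probability"
begin

text \<open>
  Jump times of a Poisson process of intensity 1 on \<open>(\<tau>, \<infinity>)\<close>, given by independent
  standard exponential gaps: the process itself is \<open>N t = card {r. 1 \<le> r \<and> T r \<le> t}\<close>.
\<close>

definition poisson_jump_times :: "'a measure \<Rightarrow> real \<Rightarrow> (nat \<Rightarrow> 'a \<Rightarrow> real) \<Rightarrow> bool" where
  "poisson_jump_times M \<tau> T \<longleftrightarrow>
     (\<forall>\<omega>\<in>space M. T 0 \<omega> = \<tau>) \<and>
     prob_space.indep_vars M (\<lambda>_. borel) (\<lambda>r \<omega>. T (Suc r) \<omega> - T r \<omega>) UNIV \<and>
     (\<forall>r. distributed M lborel (\<lambda>\<omega>. T (Suc r) \<omega> - T r \<omega>) (exponential_density 1))"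

text \<open>
  Since \<open>T r\<close> is random, ``\<open>U r\<close> and \<open>V r\<close> (\<open>r \<ge> 1\<close>) are independent and uniform on
  \<open>[0, T r]\<close>'' refers to the conditional law given the jump times. It is
  expressed by the joint law of \<open>(T r, U r, V r)\<close>, \<open>1 \<le> r \<le> n\<close>, on measurable boxes, for all \<open>n\<close>.
\<close>

definition cond_indep_uniform ::
    "'a measure \<Rightarrow> (nat \<Rightarrow> 'a \<Rightarrow> real) \<Rightarrow> (nat \<Rightarrow> 'a \<Rightarrow> real) \<Rightarrow> (nat \<Rightarrow> 'a \<Rightarrow> real) \<Rightarrow> bool" where
  "cond_indep_uniform M T U V \<longleftrightarrow>
     (\<forall>r\<ge>1. U r \<in> borel_measurable M \<and> V r \<in> borel_measurable M) \<and>
     (\<forall>n A B C. (\<forall>r. A r \<in> sets borel \<and> B r \<in> sets borel \<and> C r \<in> sets borel) \<longrightarrow>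
        measure M {\<omega> \<in> space M. \<forall>r\<in>{1..n}. T r \<omega> \<in> C r \<and> U r \<omega> \<in> A r \<and> V r \<omega> \<in> B r} =
        (\<integral>\<omega>. (\<Prod>r=1..n. indicator (C r) (T r \<omega>) *
                 measure (uniform_measure lborel {0..T r \<omega>}) (A r) *
                 measure (uniform_measure lborel {0..T r \<omega>}) (B r)) \<partial>M))"

definition adding_path ::
    "real \<Rightarrow> (real \<Rightarrow> real) \<Rightarrow> (nat \<Rightarrow> real) \<Rightarrow> (nat \<Rightarrow> real) \<Rightarrow> (nat \<Rightarrow> real) \<Rightarrow> (real \<Rightarrow> real) \<Rightarrow> bool" where
  "adding_path \<tau> x T U V X \<longleftrightarrow>
     (\<forall>t\<in>{0..\<tau>}. X t = x t) \<and>
     (\<forall>r\<ge>1. (\<forall>t. T (r - 1) \<le> t \<and> t < T r \<longrightarrow> X t = X (T (r - 1))) \<and>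
             X (T r) = X (U r) + X (V r))"

text \<open>
  The initial function is only required to be Borel and square-integrable on \<open>[0, \<tau>]\<close>; this is
  what the second moments of \<open>X\<close> need in order to exist.
  The path equations are imposed almost surely: on the null event where, for instance,
  \<open>U r = T r\<close> they do not determine a path.
\<close>

locale continuized_adding_process = prob_space M
  for M :: "'a measure" +
  fixes \<tau> :: real and x :: "real \<Rightarrow> real"
    and T U V :: "nat \<Rightarrow> 'a \<Rightarrow> real" and X :: "real \<Rightarrow> 'a \<Rightarrow> real"
  assumes \<tau>_nonneg: "0 \<le> \<tau>"
    and x_measurable: "set_borel_measurable lborel {0..\<tau>} x"
    and x_square_integrable: "set_integrable lborel {0..\<tau>} (\<lambda>t. (x t)\<^sup>2)"
    and jump_times: "poisson_jump_times M \<tau> T"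
    and uniforms: "cond_indep_uniform M T U V"
    and X_measurable: "\<And>t. 0 \<le> t \<Longrightarrow> X t \<in> borel_measurable M"
    and path: "AE \<omega> in M. adding_path \<tau> x (\<lambda>r. T r \<omega>) (\<lambda>r. U r \<omega>) (\<lambda>r. V r \<omega>) (\<lambda>t. X t \<omega>)"

definition cmom :: "'a measure \<Rightarrow> (real \<Rightarrow> 'a \<Rightarrow> real) \<Rightarrow> real \<Rightarrow> real \<Rightarrow> real" where
  "cmom M X s t = (\<integral>\<omega>. X s \<omega> * X t \<omega> \<partial>M)"

definition qmom :: "'a measure \<Rightarrow> (real \<Rightarrow> 'a \<Rightarrow> real) \<Rightarrow> real \<Rightarrow> real" where
  "qmom M X t = (\<integral>\<omega>. (X t \<omega>)\<^sup>2 \<partial>M)"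

definition Qint :: "'a measure \<Rightarrow> (real \<Rightarrow> 'a \<Rightarrow> real) \<Rightarrow> real \<Rightarrow> real" where
  "Qint M X t = (LBINT v:{0..t}. (LBINT u:{0..t}. cmom M X u v))"

text \<open>
  First derivative of \<open>Qint M X\<close> at \<open>t \<ge> \<tau>\<close>. For \<open>t > \<tau>\<close> this is the ordinary two-sided
  derivative. At \<open>t = \<tau>\<close> it is the derivative from the right, which is still
  \<open>\<integral>\<^sub>0\<^sup>t c(u,t) du + \<integral>\<^sub>0\<^sup>t c(t,v) dv\<close>, whereas the left derivative need not be (or exist),
  \<open>x\<close> being arbitrary before \<open>\<tau>\<close>.
\<close>

definition Qderiv :: "'a measure \<Rightarrow> real \<Rightarrow> (real \<Rightarrow> 'a \<Rightarrow> real) \<Rightarrow> real \<Rightarrow> real" where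
  "Qderiv M \<tau> X t = vector_derivative (Qint M X) (at t within {\<tau>..})"

end

theory Submission
  imports Defs "HOL-Real_Asymp.Real_Asymp"
begin

text \<open>
  Between jumps the process is frozen, and at rate one its value is replaced by the sum of two
  values picked uniformly from its own past. Let \<open>\<tau> \<le> \<sigma> \<le> t\<close> and \<open>0 \<le> s \<le> \<sigma>\<close>. Either no jump falls
  in \<open>(\<sigma>, t]\<close>, or there is a last one, at \<open>y\<close> say; with \<open>A\<close>, \<open>B\<close> independent and uniform on
  \<open>[0, 1]\<close> this gives, for every Borel \<open>h \<ge> 0\<close>,

  \<open>E h(X s, X t) = e\<^sup>-\<^sup>(\<^sup>t\<^sup>-\<^sup>\<sigma>\<^sup>) E h(X s, X \<sigma>) + \<integral>\<^sub>\<sigma>\<^sup>t e\<^sup>-\<^sup>(\<^sup>t\<^sup>-\<^sup>y\<^sup>) E h(X s, X (y A) + X (y B)) dy\<close>.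

  This last-jump formula (\<open>last_jump_formula\<close>) carries all the probability. It is proved by
  computing the law of the next jump time and its two marks given the first \<open>n\<close> of them
  (\<open>history_Suc_law\<close>), writing the path up to the next jump as a function of these data, and
  summing over \<open>n\<close>.

  A Gronwall argument for truncated squares bounds the second moment at \<open>t \<ge> \<tau>\<close> by \<open>C e\<^sup>7\<^sup>t\<close> (\<open>qn_bound\<close>), so
  the covariances exist. Write \<open>G s y\<close> for the integral of \<open>c(s, u)\<close> over \<open>0 \<le> u \<le> y\<close>, \<open>R y\<close> for
  that of \<open>q(u)\<close>, and \<open>H t = G t t\<close>, which is half of \<open>Q'(t)\<close>. Taking \<open>h(a, b) = a b\<close> and
  \<open>h(a, b) = b\<^sup>2\<close>, and integrating the first case over \<open>s\<close>, shows that \<open>c(s, \<cdot>)\<close>, \<open>q\<close> and \<open>H\<close> solve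
  \<open>\<phi>' = f - \<phi>\<close> with \<open>f\<close> equal to \<open>2 G s y / y\<close>, to \<open>2 R y / y + 2 Q y / y\<^sup>2\<close> and to \<open>q y + 2 Q y / y\<close>
  (\<open>c_relax\<close>, \<open>q_relax\<close>, \<open>H_relax\<close>).

  For fixed \<open>s\<close> the function \<open>g = G s\<close> therefore satisfies \<open>g'' + g' = 2 g / t\<close>. The polynomial
  \<open>t (2 + t)\<close> is a solution, its Wronskian \<open>W\<close> with \<open>g\<close> satisfies \<open>W' = - W\<close>, and the derivative of
  \<open>c(s, t) / (1 + t)\<close> is \<open>- W t / (t (1 + t)\<^sup>2)\<close>; integrating from \<open>s\<close> to \<open>t\<close> gives the formula
  (\<open>solution_formula\<close>).

  For the limits, normalise the moments to \<open>A = R / t\<^sup>3\<close>, \<open>B = Q / t\<^sup>4\<close>, \<open>C = q / t\<^sup>2\<close>, \<open>D = H / t\<^sup>3\<close>.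
  The deviations \<open>P = C - 2 A - 2 B\<close> and \<open>S = D - 2 B\<close> are damped at unit rate, \<open>E = A - 2 B\<close> at
  rate \<open>1 / t\<close>, and \<open>B\<close> only moves through \<open>S\<close>. So \<open>B\<^sup>2 + E\<^sup>2 + P\<^sup>2 + S\<^sup>2\<close> is a Lyapunov function up
  to a factor integrable in time: it converges while \<open>E\<close>, \<open>P\<close>, \<open>S\<close> vanish, hence \<open>B\<close> converges,
  \<open>q / t\<^sup>2\<close> tends to \<open>K = 6 lim B\<close> and \<open>H / t\<^sup>3\<close> to \<open>K / 3\<close> (\<open>moment_system_limits\<close>). In the formula
  the bracket divided by \<open>s\<^sup>4\<close> then tends to \<open>- K / 3\<close>, and \<open>s\<^sup>3 e\<^sup>s\<close> times the integral tends to \<open>1\<close> as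
  \<open>t - s\<close> grows, so that the two summands in the braces contribute \<open>\<theta> K\<close> and \<open>- \<theta> K / 3\<close>.
\<close>

section \<open>Exponential waiting times and uniform marks\<close>

abbreviation std_exponential :: "real measure" where
  "std_exponential \<equiv> density lborel (exponential_density 1)"

abbreviation std_uniform :: "real measure" where
  "std_uniform \<equiv> uniform_measure lborel {0..1}"

lemma prob_space_std_exponential: "prob_space std_exponential"
  by (rule prob_space_exponential_density) simp

lemma prob_space_std_uniform: "prob_space std_uniform"
  by (rule prob_space_uniform_measure) auto

lemma nn_integral_std_exponential:
  assumes [measurable]: "f \<in> borel_measurable borel"
  shows "(\<integral>\<^sup>+g. f g \<partial>std_exponential) = (\<integral>\<^sup>+g. ennreal (exp (- g)) * f g * indicator {0..} g \<partial>lborel)"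
  by (subst nn_integral_density)
     (auto simp: exponential_density_def intro!: nn_integral_cong split: split_indicator)

lemma nn_integral_std_uniform:
  assumes [measurable]: "f \<in> borel_measurable borel"
  shows "(\<integral>\<^sup>+a. f a \<partial>std_uniform) = (\<integral>\<^sup>+a. f a * indicator {0..1} a \<partial>lborel)"
  by (subst nn_integral_uniform_measure) (auto simp: divide_ennreal_def)

text \<open>
  Dilation by \<open>y\<close> carries the uniform law on \<open>[0, 1]\<close> to the one on \<open>[0, y]\<close>. A mark on \<open>[0, T r]\<close>
  can thus be drawn as \<open>T r\<close> times a uniform variable that knows nothing about \<open>T r\<close>.
\<close>

lemma std_uniform_scale:
  assumes "0 < y" and [measurable]: "f \<in> borel_measurable borel"
  shows "(\<integral>\<^sup>+a. f (y * a) \<partial>std_uniform) = (\<integral>\<^sup>+u. f u \<partial>uniform_measure lborel {0..y})"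
proof -
  have "(\<integral>\<^sup>+u. f u \<partial>uniform_measure lborel {0..y}) = (\<integral>\<^sup>+u. f u * indicator {0..y} u \<partial>lborel) / ennreal y"
    using assms by (subst nn_integral_uniform_measure) auto
  also have "(\<integral>\<^sup>+u. f u * indicator {0..y} u \<partial>lborel)
      = ennreal y * (\<integral>\<^sup>+a. f (y * a) * indicator {0..y} (y * a) \<partial>lborel)"
    using assms by (subst nn_integral_real_affine[where c = y and t = 0]) auto
  also have "(\<integral>\<^sup>+a. f (y * a) * indicator {0..y} (y * a) \<partial>lborel) = (\<integral>\<^sup>+a. f (y * a) \<partial>std_uniform)"
    using \<open>0 < y\<close> by (subst nn_integral_std_uniform)
      (auto intro!: nn_integral_cong split: split_indicator simp: zero_le_mult_iff mult_le_cancel_left1)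
  also have "ennreal y * \<dots> / ennreal y = \<dots>"
    using \<open>0 < y\<close> by (subst mult.commute, subst ennreal_mult_divide_eq) auto
  finally show ?thesis by simp
qed

text \<open>
  For \<open>y \<le> 0\<close> the interval is null and the normalisation collapses to the zero measure. Measurability
  of the mark law in \<open>y\<close> has to cover this range.
\<close>

lemma uniform_measure_degenerate:
  assumes "\<not> 0 < (y::real)"
  shows "uniform_measure lborel {0..y} = density lborel (\<lambda>_. 0)"
proof -
  have "{0..y} = {} \<or> {0..y} = {0}" using assms by auto
  then show ?thesis
    unfolding uniform_measure_def
    by (intro density_cong) (auto intro!: AE_I[where N = "{0}"] split: split_indicator)
qed

definition uniform_mass :: "real set \<Rightarrow> real \<Rightarrow> ennreal" where
  "uniform_mass A y = ennreal (measure (uniform_measure lborel {0..y}) A)"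

lemma uniform_mass_eq:
  assumes "0 < y" and [measurable]: "A \<in> sets borel"
  shows "uniform_mass A y = (\<integral>\<^sup>+a. indicator A (y * a) \<partial>std_uniform)"
proof -
  interpret prob_space "uniform_measure lborel {0..y}"
    using assms by (intro prob_space_uniform_measure) auto
  show ?thesis
    unfolding uniform_mass_def emeasure_eq_measure[symmetric]
    using assms by (subst std_uniform_scale) auto
qed

lemma uniform_mass_measurable [measurable]:
  assumes [measurable]: "A \<in> sets borel"
  shows "uniform_mass A \<in> borel_measurable borel"
proof -
  have "uniform_mass A y = (if 0 < y then \<integral>\<^sup>+a. indicator A (y * a) \<partial>std_uniform else 0)" for y
  proof (cases "0 < y")
    case False
    then show ?thesis
      using assms by (simp add: uniform_mass_def uniform_measure_degenerate measure_def emeasure_density)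
  qed (use assms in \<open>auto simp: uniform_mass_eq\<close>)
  moreover interpret prob_space std_uniform by (rule prob_space_std_uniform)
  have "(\<lambda>y. if 0 < y then \<integral>\<^sup>+a. indicator A (y * a) \<partial>std_uniform else 0) \<in> borel_measurable borel"
    by measurable
  ultimately show ?thesis
    by (subst measurable_cong) auto
qed

abbreviation uniform_pair :: "(real \<times> real) measure" where
  "uniform_pair \<equiv> std_uniform \<Otimes>\<^sub>M std_uniform"

lemma prob_space_uniform_pair: "prob_space uniform_pair"
  by (intro prob_space_pair prob_space_std_uniform)

lemma AE_uniform_pairI:
  assumes P: "AE a in std_uniform. P a" and [measurable]: "Measurable.pred borel P"
  shows "AE c in uniform_pair. P (fst c) \<and> P (snd c)"
proof (rule pair_sigma_finite.AE_pair_measure)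
  show "pair_sigma_finite std_uniform std_uniform"
    by (intro pair_sigma_finite.intro prob_space_imp_sigma_finite prob_space_std_uniform)
  show "{c \<in> space uniform_pair. P (fst c) \<and> P (snd c)} \<in> sets uniform_pair" by measurable
  show "AE a in std_uniform. AE b in std_uniform. P (fst (a, b)) \<and> P (snd (a, b))"
    using P by eventually_elim (use P in eventually_elim, simp)
qed

lemma AE_uniform_pair: "AE c in uniform_pair. (0 \<le> fst c \<and> fst c \<le> 1) \<and> (0 \<le> snd c \<and> snd c \<le> 1)"
  by (rule AE_uniform_pairI) (auto intro: AE_uniform_measureI)

lemma std_exponential_tail:
  assumes "0 \<le> c"
  shows "(\<integral>\<^sup>+g. indicator {c<..} g \<partial>std_exponential) = ennreal (exp (- c))"
proof -
  interpret E: prob_space std_exponential by (rule prob_space_std_exponential)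
  have "emeasure std_exponential {..c} = ennreal (1 - exp (- c))"
    using assms by (subst emeasure_erlang_density) (auto simp: erlang_CDF_0)
  then have "measure std_exponential {..c} = 1 - exp (- c)"
    using assms by (simp add: measure_def)
  moreover have "measure std_exponential (space std_exponential - {..c}) = 1 - measure std_exponential {..c}"
    by (rule E.prob_compl) auto
  moreover have "space std_exponential - {..c} = {c<..}" by auto
  ultimately have "measure std_exponential {c<..} = exp (- c)" by simp
  then show ?thesis by (simp add: E.emeasure_eq_measure)
qed

lemma std_exponential_shift:
  assumes [measurable]: "f \<in> borel_measurable borel"
  shows "(\<integral>\<^sup>+g. f (c + g) \<partial>std_exponential)
      = (\<integral>\<^sup>+y. ennreal (exp (- (y - c))) * indicator {0..} (y - c) * f y \<partial>lborel)"
proof -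
  have "(\<integral>\<^sup>+y. ennreal (exp (- (y - c))) * indicator {0..} (y - c) * f y \<partial>lborel)
      = (\<integral>\<^sup>+g. ennreal (exp (- g)) * indicator {0..} (c + g - c) * f (c + g) \<partial>lborel)"
    by (subst nn_integral_real_affine[where c = 1 and t = c]) (auto simp: algebra_simps)
  also have "\<dots> = (\<integral>\<^sup>+g. f (c + g) \<partial>std_exponential)"
    by (subst nn_integral_std_exponential) (auto intro!: nn_integral_cong split: split_indicator)
  finally show ?thesis by simp
qed

lemma std_uniform_density: "std_uniform = density lborel (\<lambda>a. ennreal (indicator {0..1} a))"
  unfolding uniform_measure_def by (simp add: divide_ennreal_def ennreal_indicator)

lemma uniform_pair_marginals:
  assumes [measurable]: "f \<in> borel_measurable borel"
  shows "(\<integral>\<^sup>+c. f (fst c) \<partial>uniform_pair) = (\<integral>\<^sup>+a. f a \<partial>std_uniform)"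
    and "(\<integral>\<^sup>+c. f (snd c) \<partial>uniform_pair) = (\<integral>\<^sup>+a. f a \<partial>std_uniform)"
proof -
  interpret B: prob_space std_uniform by (rule prob_space_std_uniform)
  show "(\<integral>\<^sup>+c. f (fst c) \<partial>uniform_pair) = (\<integral>\<^sup>+a. f a \<partial>std_uniform)"
    by (subst B.nn_integral_fst[symmetric]) (auto simp: B.emeasure_space_1[simplified])
  show "(\<integral>\<^sup>+c. f (snd c) \<partial>uniform_pair) = (\<integral>\<^sup>+a. f a \<partial>std_uniform)"
    by (subst B.nn_integral_fst[symmetric]) (auto simp: B.emeasure_space_1[simplified])
qed

text \<open>
  The rate \<open>7\<close> is chosen for the factor \<open>1 / 8\<close>: the second moment feeds back with weight \<open>4\<close>, so one
  pass through the last-jump formula halves a bound of the form \<open>m e\<^sup>7\<^sup>t\<close>.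
\<close>

lemma exp_growth_integral:
  assumes "\<tau> \<le> (t::real)"
  shows "(\<integral>\<^sup>+y. (indicator {\<tau><..t} y * ennreal (exp (- (t - y)))) * ennreal (exp (7 * y)) \<partial>lborel) \<le> ennreal (exp (7 * t) / 8)"
proof -
  have "(\<integral>\<^sup>+y. (indicator {\<tau><..t} y * ennreal (exp (- (t - y)))) * ennreal (exp (7 * y)) \<partial>lborel)
      \<le> (\<integral>\<^sup>+y. ennreal (exp (8 * y - t)) * indicator {\<tau>..t} y \<partial>lborel)"
    by (intro nn_integral_mono) (auto simp: ennreal_mult[symmetric] mult_exp_exp algebra_simps split: split_indicator)
  also have "\<dots> = ennreal (exp (8 * t - t) / 8 - exp (8 * \<tau> - t) / 8)"
    by (rule nn_integral_FTC_Icc) (auto intro!: derivative_eq_intros assms)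
  also have "\<dots> \<le> ennreal (exp (7 * t) / 8)"
    by (rule ennreal_leI) simp
  finally show ?thesis .
qed

lemma exp_kernel_integral:
  assumes "\<tau> \<le> (t::real)"
  shows "(\<integral>\<^sup>+y. (indicator {\<tau><..t} y * ennreal (exp (- (t - y)))) \<partial>lborel) \<le> 1"
proof -
  have "(\<integral>\<^sup>+y. (indicator {\<tau><..t} y * ennreal (exp (- (t - y)))) \<partial>lborel)
      \<le> (\<integral>\<^sup>+y. ennreal (exp (- (t - y))) * indicator {\<tau>..t} y \<partial>lborel)"
    by (intro nn_integral_mono) (auto split: split_indicator)
  also have "\<dots> = ennreal (exp (- (t - t)) - exp (- (t - \<tau>)))"
    by (rule nn_integral_FTC_Icc) (auto intro!: derivative_eq_intros assms)
  also have "\<dots> \<le> ennreal 1"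
    by (rule ennreal_leI) simp
  finally show ?thesis by simp
qed

lemma min_le_twice:
  fixes l :: real
  shows "s \<le> 2 * p + 2 * q \<Longrightarrow> 0 \<le> p \<Longrightarrow> 0 \<le> q \<Longrightarrow> 0 \<le> l \<Longrightarrow> min s l \<le> 2 * min p l + 2 * min q l"
  by (simp add: min_def)

lemma integral_std_uniform_scale:
  fixes f :: "real \<Rightarrow> real"
  assumes "0 < y" and [measurable]: "f \<in> borel_measurable borel"
  shows "(\<integral>a. f (y * a) \<partial>std_uniform) = (LBINT u:{0..y}. f u) / y"
proof -
  have "(LBINT u:{0..y}. f u) = \<bar>y\<bar> * (\<integral>a. indicator {0..y} (0 + y * a) * f (0 + y * a) \<partial>lborel)"
    using \<open>0 < y\<close> unfolding set_lebesgue_integral_def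
    by (subst lborel_integral_real_affine[where c = y and t = 0]) auto
  also have "(\<integral>a. indicator {0..y} (0 + y * a) * f (0 + y * a) \<partial>lborel) = (\<integral>a. indicator {0..1} a * f (y * a) \<partial>lborel)"
    using \<open>0 < y\<close>
    by (intro Bochner_Integration.integral_cong) (auto split: split_indicator simp: zero_le_mult_iff mult_le_cancel_left1)
  also have "\<dots> = (\<integral>a. f (y * a) \<partial>std_uniform)"
    unfolding std_uniform_density by (subst integral_density) auto
  finally show ?thesis using \<open>0 < y\<close> by simp
qed

lemma sigma_finite_std_uniform: "sigma_finite_measure std_uniform"
  by (intro prob_space_imp_sigma_finite prob_space_std_uniform)

lemma pair_sigma_finite_std_uniform: "pair_sigma_finite std_uniform std_uniform"
  by (intro pair_sigma_finite.intro sigma_finite_std_uniform)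

lemma integral_uniform_pair_marginals:
  fixes f :: "real \<Rightarrow> real"
  assumes f: "integrable std_uniform f"
  shows integrable_uniform_pair_fst: "integrable uniform_pair (\<lambda>c. f (fst c))"
    and integrable_uniform_pair_snd: "integrable uniform_pair (\<lambda>c. f (snd c))"
    and integral_uniform_pair_fst: "(\<integral>c. f (fst c) \<partial>uniform_pair) = (\<integral>a. f a \<partial>std_uniform)"
    and integral_uniform_pair_snd: "(\<integral>c. f (snd c) \<partial>uniform_pair) = (\<integral>a. f a \<partial>std_uniform)"
proof -
  interpret B: prob_space std_uniform by (rule prob_space_std_uniform)
  have [measurable]: "f \<in> borel_measurable borel" using borel_measurable_integrable[OF f] by simp
  have fin: "(\<integral>\<^sup>+a. ennreal (norm (f a)) \<partial>std_uniform) < \<infinity>"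
    using f by (simp add: integrable_iff_bounded)
  show i1: "integrable uniform_pair (\<lambda>c. f (fst c))" and i2: "integrable uniform_pair (\<lambda>c. f (snd c))"
    using fin uniform_pair_marginals[of "\<lambda>a. ennreal (norm (f a))"] by (auto simp: integrable_iff_bounded)
  have one: "(\<integral>b. 1 \<partial>std_uniform) = (1::real)" by (simp add: B.prob_space[simplified])
  have "(\<integral>c. f (fst c) \<partial>uniform_pair) = (\<integral>a. \<integral>b. f (fst (a, b)) \<partial>std_uniform \<partial>std_uniform)"
    by (rule pair_sigma_finite.integral_fst'[OF pair_sigma_finite_std_uniform i1, symmetric])
  then show "(\<integral>c. f (fst c) \<partial>uniform_pair) = (\<integral>a. f a \<partial>std_uniform)"
    using B.prob_space by simp
  have "(\<integral>c. f (snd c) \<partial>uniform_pair) = (\<integral>a. \<integral>b. f (snd (a, b)) \<partial>std_uniform \<partial>std_uniform)"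
    by (rule pair_sigma_finite.integral_fst'[OF pair_sigma_finite_std_uniform i2, symmetric])
  then show "(\<integral>c. f (snd c) \<partial>uniform_pair) = (\<integral>a. f a \<partial>std_uniform)"
    using B.prob_space by simp
qed

lemma abs_mult_le_sum_squares: "\<bar>a * b\<bar> \<le> (a\<^sup>2 + b\<^sup>2) / (2::real)"
  using sum_squares_bound[of "\<bar>a\<bar>" "\<bar>b\<bar>"] by (simp add: abs_mult)

lemma abs_mult_le_sum: "\<bar>a * b\<bar> \<le> \<bar>a\<^sup>2 + b\<^sup>2\<bar>" for a b :: real
proof -
  have "(a\<^sup>2 + b\<^sup>2) / 2 \<le> \<bar>a\<^sup>2 + b\<^sup>2\<bar>" by simp
  then show ?thesis using abs_mult_le_sum_squares[of a b] by (rule order_trans[rotated])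
qed

section \<open>The law of the next jump given the history\<close>

context continuized_adding_process
begin

lemma T0 [simp]: "\<omega> \<in> space M \<Longrightarrow> T 0 \<omega> = \<tau>"
  using jump_times by (auto simp: poisson_jump_times_def)

lemma gap_distr: "distr M lborel (\<lambda>\<omega>. T (Suc r) \<omega> - T r \<omega>) = std_exponential"
  using jump_times by (auto simp: poisson_jump_times_def dest: distributed_distr_eq_density)

lemma gap_measurable [measurable]: "(\<lambda>\<omega>. T (Suc r) \<omega> - T r \<omega>) \<in> borel_measurable M"
proof -
  have "distributed M lborel (\<lambda>\<omega>. T (Suc r) \<omega> - T r \<omega>) (exponential_density 1)"
    using jump_times by (simp add: poisson_jump_times_def)
  from distributed_measurable[OF this] show ?thesis by simp
qed

lemma T_measurable [measurable]: "T r \<in> borel_measurable M"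
proof (induction r)
  case 0
  then show ?case by (subst measurable_cong[where g = "\<lambda>_. \<tau>"]) auto
next
  case (Suc r)
  then have "(\<lambda>\<omega>. T r \<omega> + (T (Suc r) \<omega> - T r \<omega>)) \<in> borel_measurable M" by measurable
  then show ?case by simp
qed

lemma U_measurable: "1 \<le> r \<Longrightarrow> U r \<in> borel_measurable M"
  and V_measurable: "1 \<le> r \<Longrightarrow> V r \<in> borel_measurable M"
  using uniforms by (auto simp: cond_indep_uniform_def)

text \<open>
  The jump times form a random walk: \<open>T 1, \<dots>, T n\<close> are functions of the first \<open>n\<close> gaps, which are
  jointly independent of the gap that follows. Only integrands of product form are needed, because
  the marks enter through boxes.
\<close>

lemma T_Suc_law:
  fixes F :: "nat \<Rightarrow> real \<Rightarrow> ennreal" and \<psi> :: "real \<Rightarrow> ennreal"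
  assumes [measurable]: "\<And>r. F r \<in> borel_measurable borel" "\<psi> \<in> borel_measurable borel"
  shows "(\<integral>\<^sup>+\<omega>. (\<Prod>r=1..n. F r (T r \<omega>)) * \<psi> (T (Suc n) \<omega>) \<partial>M)
       = (\<integral>\<^sup>+\<omega>. (\<Prod>r=1..n. F r (T r \<omega>)) * (\<integral>\<^sup>+g. \<psi> (T n \<omega> + g) \<partial>std_exponential) \<partial>M)"
proof -
  let ?D = "\<lambda>r \<omega>. T (Suc r) \<omega> - T r \<omega>"
  let ?W = "\<lambda>\<omega>. restrict (\<lambda>i. ?D i \<omega>) {..<n}"
  let ?P = "PiM {..<n} (\<lambda>_. borel :: real measure)"
  let ?W' = "\<lambda>\<omega>. restrict (\<lambda>i. ?D i \<omega>) {n}"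
  let ?P' = "PiM {n} (\<lambda>_. borel :: real measure)"
  let ?K = "case_bool {..<n} {n}"
  define S where "S r w = \<tau> + (\<Sum>i<r. w i)" for r and w :: "nat \<Rightarrow> real"
  have S_measurable [measurable]: "S r \<in> borel_measurable ?P" if "r \<le> n" for r
    unfolding S_def using that by (intro borel_measurable_add borel_measurable_sum) auto
  have T_eq: "T r \<omega> = S r (?W \<omega>)" if "r \<le> n" "\<omega> \<in> space M" for r \<omega>
  proof -
    have "(\<Sum>i<r. ?W \<omega> i) = (\<Sum>i<r. ?D i \<omega>)" using that by (intro sum.cong) auto
    also have "\<dots> = T r \<omega> - T 0 \<omega>" by (rule sum_lessThan_telescope)
    finally show ?thesis using that by (simp add: S_def)
  qed
  \<comment> \<open>Both groups of gaps are random vectors: \<open>indep_var\<close> relates random variables of one type.\<close>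
  have ind: "indep_vars (\<lambda>_. borel) ?D UNIV"
    using jump_times by (auto simp: poisson_jump_times_def)
  have "indep_vars (\<lambda>j. PiM (?K j) (\<lambda>_. borel)) (\<lambda>j \<omega>. restrict (\<lambda>i. ?D i \<omega>) (?K j)) UNIV"
    by (rule indep_vars_restrict[OF ind]) (auto simp: disjoint_family_on_def split: bool.splits)
  then have "indep_var ?P ?W ?P' ?W'"
    unfolding indep_var_def
    by (rule iffD1[OF indep_vars_cong, rotated -1]) (auto split: bool.splits)
  then have joint: "distr M ?P ?W \<Otimes>\<^sub>M distr M ?P' ?W' = distr M (?P \<Otimes>\<^sub>M ?P') (\<lambda>\<omega>. (?W \<omega>, ?W' \<omega>))"
    and W_measurable [measurable]: "?W \<in> measurable M ?P" "?W' \<in> measurable M ?P'"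
    by (auto simp: indep_var_distribution_eq)
  have D_law: "distr M borel (?D n) = std_exponential"
    using gap_distr[of n] by (metis distr_cong sets_lborel)
  have W'_law: "(\<integral>\<^sup>+w. f (w n) \<partial>distr M ?P' ?W') = (\<integral>\<^sup>+g. f g \<partial>std_exponential)"
    if [measurable]: "f \<in> borel_measurable borel" for f :: "real \<Rightarrow> ennreal"
    unfolding D_law[symmetric] by (simp add: nn_integral_distr)
  interpret E: prob_space std_exponential by (rule prob_space_std_exponential)
  interpret W': prob_space "distr M ?P' ?W'" by (rule prob_space_distr) measurable
  interpret W: prob_space "distr M ?P ?W" by (rule prob_space_distr) measurable
  define G where "G w = (\<Prod>r=1..n. F r (S r w))" for w
  have G_measurable [measurable]: "G \<in> borel_measurable ?P"
    unfolding G_def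
    by (intro borel_measurable_prod_ennreal measurable_compose[OF S_measurable assms(1)]) auto
  have G_eq: "G (?W \<omega>) = (\<Prod>r=1..n. F r (T r \<omega>))" if "\<omega> \<in> space M" for \<omega>
    unfolding G_def using that by (intro prod.cong refl) (simp add: T_eq)
  have "(\<integral>\<^sup>+\<omega>. (\<Prod>r=1..n. F r (T r \<omega>)) * \<psi> (T (Suc n) \<omega>) \<partial>M)
     = (\<integral>\<^sup>+\<omega>. G (?W \<omega>) * \<psi> (S n (?W \<omega>) + ?D n \<omega>) \<partial>M)"
    by (intro nn_integral_cong) (simp add: T_eq[symmetric] G_eq)
  also have "\<dots> = (\<integral>\<^sup>+z. G (fst z) * \<psi> (S n (fst z) + snd z n)
      \<partial>distr M (?P \<Otimes>\<^sub>M ?P') (\<lambda>\<omega>. (?W \<omega>, ?W' \<omega>)))"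
    by (subst nn_integral_distr) auto
  also have "\<dots> = (\<integral>\<^sup>+w. \<integral>\<^sup>+w'. G w * \<psi> (S n w + w' n) \<partial>distr M ?P' ?W' \<partial>distr M ?P ?W)"
    unfolding joint[symmetric] by (subst W'.nn_integral_fst[symmetric]) auto
  also have "\<dots> = (\<integral>\<^sup>+w. G w * (\<integral>\<^sup>+g. \<psi> (S n w + g) \<partial>std_exponential) \<partial>distr M ?P ?W)"
    by (subst W'_law) (auto simp: nn_integral_cmult)
  also have "\<dots> = (\<integral>\<^sup>+\<omega>. G (?W \<omega>) * (\<integral>\<^sup>+g. \<psi> (S n (?W \<omega>) + g) \<partial>std_exponential) \<partial>M)"
    by (subst nn_integral_distr) (auto simp: nn_integral_cmult)
  also have "\<dots> = (\<integral>\<^sup>+\<omega>. (\<Prod>r=1..n. F r (T r \<omega>)) * (\<integral>\<^sup>+g. \<psi> (T n \<omega> + g) \<partial>std_exponential) \<partial>M)"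
    by (intro nn_integral_cong) (simp add: T_eq[symmetric] G_eq)
  finally show ?thesis .
qed

text \<open>
  Coordinates \<open>(r, 0)\<close>, \<open>(r, 1)\<close>, \<open>(r, 2)\<close> hold \<open>T r\<close>, \<open>U r\<close>, \<open>V r\<close>. Flattening the triples into one
  real product space makes boxes with a separate side for each of the \<open>3 n\<close> coordinates a
  determining class for the law of the history.
\<close>

definition obs :: "nat \<times> nat \<Rightarrow> 'a \<Rightarrow> real" where
  "obs i \<omega> = (if snd i = 0 then T (fst i) \<omega> else if snd i = 1 then U (fst i) \<omega> else V (fst i) \<omega>)"

lemma lessThan_3: "{..<3::nat} = {0, 1, 2}" by auto

definition slots :: "nat \<Rightarrow> (nat \<times> nat) set" where
  "slots n = {1..n} \<times> {..<3}"

lemma finite_slots [simp]: "finite (slots n)" by (simp add: slots_def)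

lemma slots_Suc: "slots (Suc n) = slots n \<union> {(Suc n, 0)} \<union> {(Suc n, 1)} \<union> {(Suc n, 2)}"
  by (auto simp: slots_def lessThan_3 le_Suc_eq)

lemma Suc_notin_slots [simp]: "(Suc n, c) \<notin> slots n"
  by (simp add: slots_def)

definition history :: "nat \<Rightarrow> 'a \<Rightarrow> nat \<times> nat \<Rightarrow> real" where
  "history n \<omega> = restrict (\<lambda>i. obs i \<omega>) (slots n)"

abbreviation Hist :: "nat \<Rightarrow> (nat \<times> nat \<Rightarrow> real) measure" where
  "Hist n \<equiv> PiM (slots n) (\<lambda>_. borel)"

definition extend :: "nat \<Rightarrow> (nat \<times> nat \<Rightarrow> real) \<Rightarrow> real \<Rightarrow> real \<Rightarrow> real \<Rightarrow> nat \<times> nat \<Rightarrow> real" where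
  "extend n z y u v = z((Suc n, 0) := y, (Suc n, 1) := u, (Suc n, 2) := v)"

lemma history_measurable [measurable]: "history n \<in> measurable M (Hist n)"
  unfolding history_def
proof (rule measurable_restrict)
  fix i :: "nat \<times> nat" assume "i \<in> slots n"
  then show "obs i \<in> borel_measurable M"
    using U_measurable[of "fst i"] V_measurable[of "fst i"]
    unfolding obs_def slots_def by (cases "snd i = 0"; cases "snd i = 1") auto
qed

lemma extend_measurable [measurable (raw)]:
  assumes [measurable]: "z \<in> measurable N (Hist n)" "y \<in> borel_measurable N"
    "u \<in> borel_measurable N" "v \<in> borel_measurable N"
  shows "(\<lambda>x. extend n (z x) (y x) (u x) (v x)) \<in> measurable N (Hist (Suc n))"
proof -
  show ?thesis
    unfolding extend_def slots_Suc
    by (intro measurable_fun_upd[OF refl] assms)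
qed

text \<open>
  Conditional probability that jump \<open>r\<close> stays inside the box \<open>A\<close>, given that it happens at time \<open>y\<close>.
\<close>

definition mark_mass :: "(nat \<times> nat \<Rightarrow> real set) \<Rightarrow> nat \<Rightarrow> real \<Rightarrow> ennreal" where
  "mark_mass A r y = indicator (A (r, 0)) y * uniform_mass (A (r, 1)) y * uniform_mass (A (r, 2)) y"

lemma mark_mass_measurable [measurable]:
  assumes [measurable]: "\<And>i. A i \<in> sets borel"
  shows "mark_mass A r \<in> borel_measurable borel"
  unfolding mark_mass_def by measurable

lemma emeasure_history_box:
  assumes A [measurable]: "\<And>i. A i \<in> sets borel"
  shows "emeasure M {\<omega> \<in> space M. history n \<omega> \<in> PiE (slots n) A}
       = (\<integral>\<^sup>+\<omega>. (\<Prod>r=1..n. mark_mass A r (T r \<omega>)) \<partial>M)"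
proof -
  let ?p = "\<lambda>\<omega>. \<Prod>r=1..n. indicator (A (r, 0)) (T r \<omega>) *
      measure (uniform_measure lborel {0..T r \<omega>}) (A (r, 1)) *
      measure (uniform_measure lborel {0..T r \<omega>}) (A (r, 2))"
  have "{\<omega> \<in> space M. history n \<omega> \<in> PiE (slots n) A} =
      {\<omega> \<in> space M. \<forall>r\<in>{1..n}. T r \<omega> \<in> A (r, 0) \<and> U r \<omega> \<in> A (r, 1) \<and> V r \<omega> \<in> A (r, 2)}"
    by (auto simp: history_def obs_def slots_def lessThan_3 PiE_iff)
  then have "emeasure M {\<omega> \<in> space M. history n \<omega> \<in> PiE (slots n) A} =
      ennreal (measure M {\<omega> \<in> space M. \<forall>r\<in>{1..n}. T r \<omega> \<in> A (r, 0) \<and> U r \<omega> \<in> A (r, 1) \<and> V r \<omega> \<in> A (r, 2)})"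
    by (simp add: emeasure_eq_measure)
  also have "\<dots> = ennreal (\<integral>\<omega>. ?p \<omega> \<partial>M)"
    using uniforms assms unfolding cond_indep_uniform_def
    by (auto dest!: spec[of _ n] spec[of _ "\<lambda>r. A (r, 1)"] spec[of _ "\<lambda>r. A (r, 2)"] spec[of _ "\<lambda>r. A (r, 0)"])
  also have "\<dots> = (\<integral>\<^sup>+\<omega>. ennreal (?p \<omega>) \<partial>M)"
  proof (rule nn_integral_eq_integral[symmetric])
    have mass_real [measurable]: "(\<lambda>y::real. measure (uniform_measure lborel {0..y}) B) \<in> borel_measurable borel"
      if [measurable]: "B \<in> sets borel" for B
    proof -
      have "(\<lambda>y. enn2real (uniform_mass B y)) \<in> borel_measurable borel" by measurable
      then show ?thesis by (simp add: uniform_mass_def)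
    qed
    have le1: "measure (uniform_measure lborel {0..y}) B \<le> 1" if "B \<in> sets borel" for y :: real and B
    proof (cases "0 < y")
      case True
      then show ?thesis
        by (intro prob_space.prob_le_1 prob_space_uniform_measure) auto
    next
      case False
      then show ?thesis
        using that by (simp add: uniform_measure_degenerate measure_def emeasure_density)
    qed
    show "AE \<omega> in M. 0 \<le> ?p \<omega>"
      by (auto intro!: prod_nonneg)
    show "integrable M ?p"
    proof (rule integrable_const_bound[where B = 1])
      show "AE \<omega> in M. norm (?p \<omega>) \<le> (1::real)"
        using le1[OF A] by (auto simp: abs_prod abs_mult intro!: prod_le_1 mult_le_one split: split_indicator)
    qed measurable
  qed
  also have "\<dots> = (\<integral>\<^sup>+\<omega>. (\<Prod>r=1..n. mark_mass A r (T r \<omega>)) \<partial>M)"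
    by (intro nn_integral_cong)
       (simp add: mark_mass_def uniform_mass_def prod_ennreal[symmetric] ennreal_mult'' ennreal_indicator)
  finally show ?thesis .
qed

text \<open>
  For \<open>\<psi>\<close> the indicator of a set this is the box law with the side of \<open>T n\<close> cut down to that set, so
  the two weighted laws of \<open>T n\<close> agree as measures on the line.
\<close>

lemma history_box_weighted:
  assumes A [measurable]: "\<And>i. A i \<in> sets borel" and [measurable]: "\<psi> \<in> borel_measurable borel"
  shows "(\<integral>\<^sup>+\<omega>. indicator (PiE (slots n) A) (history n \<omega>) * \<psi> (T n \<omega>) \<partial>M)
       = (\<integral>\<^sup>+\<omega>. (\<Prod>r=1..n. mark_mass A r (T r \<omega>)) * \<psi> (T n \<omega>) \<partial>M)"
proof (cases "n = 0")
  case True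
  then show ?thesis by (simp add: history_def restrict_def slots_def)
next
  case False
  let ?b = "\<lambda>\<omega>. indicator (PiE (slots n) A) (history n \<omega>) :: ennreal"
  let ?m = "\<lambda>\<omega>. \<Prod>r=1..n. mark_mass A r (T r \<omega>)"
  have [measurable]: "PiE (slots n) A \<in> sets (Hist n)"
    by (rule sets_PiM_I_finite) auto
  have "distr (density M ?b) borel (T n) = distr (density M ?m) borel (T n)"
  proof (rule measure_eqI)
    fix S assume "S \<in> sets (distr (density M ?b) borel (T n))"
    then have [measurable]: "S \<in> sets borel" by simp
    define A' where "A' = A((n, 0) := A (n, 0) \<inter> S)"
    have A': "A' i \<in> sets borel" for i by (auto simp: A'_def)
    have b': "indicator (PiE (slots n) A') (history n \<omega>) = ?b \<omega> * indicator S (T n \<omega>)" for \<omega>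
      using False by (auto simp: A'_def PiE_iff history_def obs_def slots_def lessThan_3 split: split_indicator)
    have m': "(\<Prod>r=1..n. mark_mass A' r (T r \<omega>)) = ?m \<omega> * indicator S (T n \<omega>)" for \<omega>
    proof -
      have n: "{1..n} = insert n {1..n-1}" using False by auto
      have "(\<Prod>r=1..n-1. mark_mass A' r (T r \<omega>)) = (\<Prod>r=1..n-1. mark_mass A r (T r \<omega>))"
        using False by (intro prod.cong) (auto simp: A'_def mark_mass_def)
      moreover have "mark_mass A' n (T n \<omega>) = mark_mass A n (T n \<omega>) * indicator S (T n \<omega>)"
        by (auto simp: A'_def mark_mass_def split: split_indicator)
      ultimately show ?thesis unfolding n using False by (simp add: mult_ac)
    qed
    have [measurable]: "PiE (slots n) A' \<in> sets (Hist n)"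
      by (rule sets_PiM_I_finite) (auto simp: A')
    have "emeasure (distr (density M ?b) borel (T n)) S = (\<integral>\<^sup>+\<omega>. ?b \<omega> * indicator S (T n \<omega>) \<partial>M)"
      by (subst emeasure_distr) (auto simp: emeasure_density intro!: nn_integral_cong split: split_indicator)
    also have "\<dots> = (\<integral>\<^sup>+\<omega>. indicator {\<omega> \<in> space M. history n \<omega> \<in> PiE (slots n) A'} \<omega> \<partial>M)"
      unfolding b'[symmetric] by (intro nn_integral_cong) (auto split: split_indicator)
    also have "\<dots> = (\<integral>\<^sup>+\<omega>. ?m \<omega> * indicator S (T n \<omega>) \<partial>M)"
      using emeasure_history_box[of A' n, unfolded m'] A' by simp
    also have "\<dots> = emeasure (distr (density M ?m) borel (T n)) S"
      by (subst emeasure_distr) (auto simp: emeasure_density intro!: nn_integral_cong split: split_indicator)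
    finally show "emeasure (distr (density M ?b) borel (T n)) S = emeasure (distr (density M ?m) borel (T n)) S" .
  qed simp
  then have "(\<integral>\<^sup>+y. \<psi> y \<partial>distr (density M ?b) borel (T n)) = (\<integral>\<^sup>+y. \<psi> y \<partial>distr (density M ?m) borel (T n))"
    by simp
  then show ?thesis
    by (simp add: nn_integral_distr nn_integral_density)
qed

lemma T_strictly_increasing: "AE \<omega> in M. \<forall>n. T n \<omega> < T (Suc n) \<omega>"
proof (subst AE_all_countable, safe)
  fix n
  have "AE g in std_exponential. 0 < g"
    by (subst AE_density)
       (auto simp: exponential_density_def intro!: AE_I[where N = "{0}"] )
  then have "AE g in distr M lborel (\<lambda>\<omega>. T (Suc n) \<omega> - T n \<omega>). 0 < g"
    unfolding gap_distr .
  then show "AE \<omega> in M. T n \<omega> < T (Suc n) \<omega>"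
    by (subst (asm) AE_distr_iff) auto
qed

lemma T_ge_tau: "AE \<omega> in M. \<forall>n. \<tau> \<le> T n \<omega>"
  using T_strictly_increasing AE_space[of M]
proof eventually_elim
  case (elim \<omega>)
  show ?case
  proof
    fix n
    have "T 0 \<omega> \<le> T n \<omega>"
      using lift_Suc_mono_le[of "\<lambda>n. T n \<omega>" 0 n] elim by (simp add: less_imp_le)
    with elim show "\<tau> \<le> T n \<omega>" by simp
  qed
qed

lemma AE_std_exponential_pos: "AE g in std_exponential. 0 < g"
  by (subst AE_density) (auto simp: exponential_density_def intro!: AE_I[where N = "{0}"])

lemma nn_integral_innovation:
  assumes [measurable]: "f \<in> borel_measurable (M \<Otimes>\<^sub>M (std_exponential \<Otimes>\<^sub>M (std_uniform \<Otimes>\<^sub>M std_uniform)))"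
  shows "(\<integral>\<^sup>+z. f z \<partial>(M \<Otimes>\<^sub>M (std_exponential \<Otimes>\<^sub>M (std_uniform \<Otimes>\<^sub>M std_uniform)))) =
    (\<integral>\<^sup>+\<omega>. \<integral>\<^sup>+g. \<integral>\<^sup>+a. \<integral>\<^sup>+b. f (\<omega>, g, a, b) \<partial>std_uniform \<partial>std_uniform \<partial>std_exponential \<partial>M)"
proof -
  interpret E: prob_space std_exponential by (rule prob_space_std_exponential)
  interpret B: prob_space std_uniform by (rule prob_space_std_uniform)
  interpret BB: prob_space "std_uniform \<Otimes>\<^sub>M std_uniform"
    by (intro prob_space_pair prob_space_std_uniform)
  interpret EBB: prob_space "std_exponential \<Otimes>\<^sub>M (std_uniform \<Otimes>\<^sub>M std_uniform)"
    by (intro prob_space_pair prob_space_std_uniform prob_space_std_exponential)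
  have "(\<integral>\<^sup>+z. f z \<partial>(M \<Otimes>\<^sub>M (std_exponential \<Otimes>\<^sub>M (std_uniform \<Otimes>\<^sub>M std_uniform)))) =
    (\<integral>\<^sup>+\<omega>. \<integral>\<^sup>+x. f (\<omega>, x) \<partial>(std_exponential \<Otimes>\<^sub>M (std_uniform \<Otimes>\<^sub>M std_uniform)) \<partial>M)"
    by (rule EBB.nn_integral_fst[symmetric]) fact
  also have "\<dots> = (\<integral>\<^sup>+\<omega>. \<integral>\<^sup>+g. \<integral>\<^sup>+y. f (\<omega>, g, y) \<partial>(std_uniform \<Otimes>\<^sub>M std_uniform) \<partial>std_exponential \<partial>M)"
    by (intro nn_integral_cong BB.nn_integral_fst[symmetric]) measurable
  also have "\<dots> = (\<integral>\<^sup>+\<omega>. \<integral>\<^sup>+g. \<integral>\<^sup>+a. \<integral>\<^sup>+b. f (\<omega>, g, a, b) \<partial>std_uniform \<partial>std_uniform \<partial>std_exponential \<partial>M)"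
    by (intro nn_integral_cong B.nn_integral_fst[symmetric]) measurable
  finally show ?thesis .
qed

text \<open>
  The history after \<open>n + 1\<close> jumps arises from that after \<open>n\<close> by adding an independent exponential
  gap to \<open>T n\<close> and placing two independent uniform marks below the new time. Both laws give the same
  mass to a box: on the left the marks are integrated out by the box condition and the last gap is
  split off by \<open>T_Suc_law\<close>, after which \<open>history_box_weighted\<close> restores the first \<open>n\<close> pairs of marks.
\<close>

lemma history_Suc_law:
  "distr M (Hist (Suc n)) (history (Suc n)) =
   distr (M \<Otimes>\<^sub>M (std_exponential \<Otimes>\<^sub>M (std_uniform \<Otimes>\<^sub>M std_uniform))) (Hist (Suc n))
     (\<lambda>(\<omega>, g, a, b). extend n (history n \<omega>) (T n \<omega> + g) ((T n \<omega> + g) * a) ((T n \<omega> + g) * b))"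
  (is "?L = distr ?N _ ?f")
proof (rule measure_eqI_PiM_finite)
  interpret E: prob_space std_exponential by (rule prob_space_std_exponential)
  interpret B: prob_space std_uniform by (rule prob_space_std_uniform)
  interpret BB: pair_prob_space std_uniform std_uniform ..
  interpret EBB: pair_prob_space std_exponential "std_uniform \<Otimes>\<^sub>M std_uniform" ..
  interpret N: pair_prob_space M "std_exponential \<Otimes>\<^sub>M (std_uniform \<Otimes>\<^sub>M std_uniform)" ..
  have f_measurable [measurable]: "?f \<in> measurable ?N (Hist (Suc n))"
    by measurable
  show "finite (slots (Suc n))" by simp
  show "sets ?L = Hist (Suc n)" "sets (distr ?N (Hist (Suc n)) ?f) = Hist (Suc n)" by simp_all
  show "range (\<lambda>_::nat. space (Hist (Suc n))) \<subseteq> prod_algebra (slots (Suc n)) (\<lambda>_. borel)"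
    by (auto simp: space_PiM intro!: prod_algebraI_finite)
  show "(\<Union>i::nat. space (Hist (Suc n))) = space (Hist (Suc n))" by simp
  show "emeasure ?L (space (Hist (Suc n))) \<noteq> \<infinity>" for i :: nat
    by (subst emeasure_distr) auto
  fix A0 :: "nat \<times> nat \<Rightarrow> real set" assume A0: "\<And>i. i \<in> slots (Suc n) \<Longrightarrow> A0 i \<in> sets borel"
  define A where "A i = (if i \<in> slots (Suc n) then A0 i else UNIV)" for i
  have A [measurable]: "A i \<in> sets borel" for i using A0 by (auto simp: A_def)
  have box: "PiE (slots (Suc n)) A0 = PiE (slots (Suc n)) A"
    by (rule PiE_cong) (auto simp: A_def)
  define \<kappa> where "\<kappa> y = (\<integral>\<^sup>+g. mark_mass A (Suc n) (y + g) \<partial>std_exponential)" for y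
  have [measurable]: "\<kappa> \<in> borel_measurable borel" unfolding \<kappa>_def by measurable
  have [measurable]: "PiE (slots m) A \<in> sets (Hist m)" for m
    by (rule sets_PiM_I_finite) auto
  have fbox: "indicator (PiE (slots (Suc n)) A) (extend n (history n \<omega>) y u v)
      = indicator (PiE (slots n) A) (history n \<omega>) *
        (indicator (A (Suc n, 0)) y * indicator (A (Suc n, 1)) u * indicator (A (Suc n, 2)) v :: ennreal)"
    for \<omega> y u v
  proof -
    have "extend n (history n \<omega>) y u v \<in> PiE (slots (Suc n)) A \<longleftrightarrow>
        history n \<omega> \<in> PiE (slots n) A \<and> y \<in> A (Suc n, 0) \<and> u \<in> A (Suc n, 1) \<and> v \<in> A (Suc n, 2)"
    proof -
      have "extend n (history n \<omega>) y u v i = history n \<omega> i" if "i \<in> slots n" for i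
        using that by (auto simp: extend_def)
      then have "(\<forall>i\<in>slots n. extend n (history n \<omega>) y u v i \<in> A i) \<longleftrightarrow> (\<forall>i\<in>slots n. history n \<omega> i \<in> A i)"
        by simp
      moreover have "extend n (history n \<omega>) y u v \<in> extensional (slots (Suc n))"
        by (auto simp: extensional_def extend_def history_def slots_Suc)
      moreover have "history n \<omega> \<in> extensional (slots n)"
        by (simp add: history_def)
      moreover have "extend n (history n \<omega>) y u v (Suc n, 0) = y"
        "extend n (history n \<omega>) y u v (Suc n, 1) = u" "extend n (history n \<omega>) y u v (Suc n, 2) = v"
        by (auto simp: extend_def)
      ultimately show ?thesis
        unfolding PiE_iff slots_Suc by (simp; blast)
    qed
    then show ?thesis by (auto split: split_indicator)
  qed
  have "emeasure ?L (PiE (slots (Suc n)) A) =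
      (\<integral>\<^sup>+\<omega>. (\<Prod>r=1..n. mark_mass A r (T r \<omega>)) * mark_mass A (Suc n) (T (Suc n) \<omega>) \<partial>M)"
    using emeasure_history_box[of A "Suc n"]
    by (subst emeasure_distr) (auto simp: vimage_def Int_def conj_commute)
  also have "\<dots> = (\<integral>\<^sup>+\<omega>. (\<Prod>r=1..n. mark_mass A r (T r \<omega>)) * \<kappa> (T n \<omega>) \<partial>M)"
    unfolding \<kappa>_def by (rule T_Suc_law) measurable
  also have "\<dots> = (\<integral>\<^sup>+\<omega>. indicator (PiE (slots n) A) (history n \<omega>) * \<kappa> (T n \<omega>) \<partial>M)"
    by (rule history_box_weighted[symmetric]) measurable
  also have "\<dots> = (\<integral>\<^sup>+\<omega>. \<integral>\<^sup>+g. \<integral>\<^sup>+a. \<integral>\<^sup>+b. indicator (PiE (slots (Suc n)) A)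
      (extend n (history n \<omega>) (T n \<omega> + g) ((T n \<omega> + g) * a) ((T n \<omega> + g) * b))
      \<partial>std_uniform \<partial>std_uniform \<partial>std_exponential \<partial>M)"
    using T_ge_tau
  proof (intro nn_integral_cong_AE, eventually_elim)
    fix \<omega> assume "\<forall>n. \<tau> \<le> T n \<omega>"
    then have "0 \<le> T n \<omega>" using \<tau>_nonneg by (meson order_trans)
    let ?i = "\<lambda>c y. indicator (A (Suc n, c)) y :: ennreal"
    have "AE g in std_exponential. mark_mass A (Suc n) (T n \<omega> + g) =
       (\<integral>\<^sup>+a. \<integral>\<^sup>+b. ?i 0 (T n \<omega> + g) * ?i 1 ((T n \<omega> + g) * a) * ?i 2 ((T n \<omega> + g) * b) \<partial>std_uniform \<partial>std_uniform)"
      using AE_std_exponential_pos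
    proof eventually_elim
      case (elim g)
      then have "0 < T n \<omega> + g" using \<open>0 \<le> T n \<omega>\<close> by simp
      then show ?case
        by (simp add: mark_mass_def uniform_mass_eq nn_integral_cmult nn_integral_multc mult_ac)
    qed
    then have "\<kappa> (T n \<omega>) = (\<integral>\<^sup>+g. \<integral>\<^sup>+a. \<integral>\<^sup>+b. ?i 0 (T n \<omega> + g) * ?i 1 ((T n \<omega> + g) * a)
        * ?i 2 ((T n \<omega> + g) * b) \<partial>std_uniform \<partial>std_uniform \<partial>std_exponential)"
      unfolding \<kappa>_def by (rule nn_integral_cong_AE)
    then show "indicator (PiE (slots n) A) (history n \<omega>) * \<kappa> (T n \<omega>) =
      (\<integral>\<^sup>+g. \<integral>\<^sup>+a. \<integral>\<^sup>+b. indicator (PiE (slots (Suc n)) A)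
      (extend n (history n \<omega>) (T n \<omega> + g) ((T n \<omega> + g) * a) ((T n \<omega> + g) * b))
      \<partial>std_uniform \<partial>std_uniform \<partial>std_exponential)"
      by (simp add: fbox nn_integral_cmult)
  qed
  also have "\<dots> = (\<integral>\<^sup>+z. indicator (PiE (slots (Suc n)) A) (?f z) \<partial>?N)"
    by (subst nn_integral_innovation) (auto simp del: One_nat_def)
  also have "\<dots> = emeasure (distr ?N (Hist (Suc n)) ?f) (PiE (slots (Suc n)) A)"
    using nn_integral_distr[OF f_measurable, of "indicator (PiE (slots (Suc n)) A)"] by simp
  finally show "emeasure ?L (PiE (slots (Suc n)) A0) =
      emeasure (distr ?N (Hist (Suc n)) ?f) (PiE (slots (Suc n)) A0)"
    unfolding box .
qed

lemma nn_integral_history_Suc: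
  assumes [measurable]: "f \<in> borel_measurable (Hist (Suc n))"
  shows "(\<integral>\<^sup>+\<omega>. f (history (Suc n) \<omega>) \<partial>M) =
    (\<integral>\<^sup>+\<omega>. \<integral>\<^sup>+g. \<integral>\<^sup>+a. \<integral>\<^sup>+b. f (extend n (history n \<omega>) (T n \<omega> + g) ((T n \<omega> + g) * a) ((T n \<omega> + g) * b))
      \<partial>std_uniform \<partial>std_uniform \<partial>std_exponential \<partial>M)"
proof -
  let ?N = "M \<Otimes>\<^sub>M (std_exponential \<Otimes>\<^sub>M (std_uniform \<Otimes>\<^sub>M std_uniform))"
  let ?f = "\<lambda>(\<omega>, g, a, b). extend n (history n \<omega>) (T n \<omega> + g) ((T n \<omega> + g) * a) ((T n \<omega> + g) * b)"
  have "(\<integral>\<^sup>+\<omega>. f (history (Suc n) \<omega>) \<partial>M) = (\<integral>\<^sup>+z. f z \<partial>distr M (Hist (Suc n)) (history (Suc n)))"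
    by (subst nn_integral_distr) auto
  also have "\<dots> = (\<integral>\<^sup>+z. f (?f z) \<partial>?N)"
    unfolding history_Suc_law by (subst nn_integral_distr) measurable
  also have "\<dots> = (\<integral>\<^sup>+\<omega>. \<integral>\<^sup>+g. \<integral>\<^sup>+a. \<integral>\<^sup>+b. f (extend n (history n \<omega>) (T n \<omega> + g) ((T n \<omega> + g) * a) ((T n \<omega> + g) * b))
      \<partial>std_uniform \<partial>std_uniform \<partial>std_exponential \<partial>M)"
    by (subst nn_integral_innovation) auto
  finally show ?thesis .
qed

lemma restrict_history [simp]: "restrict (history (Suc n) \<omega>) (slots n) = history n \<omega>"
  by (auto simp: history_def slots_def restrict_def fun_eq_iff)

lemma restrict_history_same [simp]: "restrict (history n \<omega>) (slots n) = history n \<omega>"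
  by (simp add: history_def)

lemma restrict_extend [simp]: "restrict (extend n (history n \<omega>) y u v) (slots n) = history n \<omega>"
  by (auto simp: history_def extend_def slots_def restrict_def fun_eq_iff)

text \<open>
  The one-step law in the form used below: the new time and its marks are arguments of their own, and
  the two marks are drawn together.
\<close>

lemma nn_integral_next_jump:
  assumes [measurable]: "f \<in> borel_measurable (Hist n \<Otimes>\<^sub>M (borel \<Otimes>\<^sub>M (borel \<Otimes>\<^sub>M borel)))"
  shows "(\<integral>\<^sup>+\<omega>. f (history n \<omega>, T (Suc n) \<omega>, U (Suc n) \<omega>, V (Suc n) \<omega>) \<partial>M) =
    (\<integral>\<^sup>+\<omega>. \<integral>\<^sup>+g. \<integral>\<^sup>+c. f (history n \<omega>, T n \<omega> + g, (T n \<omega> + g) * fst c, (T n \<omega> + g) * snd c)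
      \<partial>uniform_pair \<partial>std_exponential \<partial>M)"
proof -
  interpret B: prob_space std_uniform by (rule prob_space_std_uniform)
  let ?f = "\<lambda>z. f (restrict z (slots n), z (Suc n, 0), z (Suc n, 1), z (Suc n, 2))"
  have comp [measurable]: "(\<lambda>z. z (Suc n, c)) \<in> borel_measurable (Hist (Suc n))" if "c < 3" for c
    using that by (intro measurable_component_singleton) (simp add: slots_def)
  have [measurable]: "(\<lambda>z. restrict z (slots n)) \<in> measurable (Hist (Suc n)) (Hist n)"
    by (intro measurable_restrict_subset) (auto simp: slots_def)
  have [measurable]: "?f \<in> borel_measurable (Hist (Suc n))"
    by (intro measurable_compose[OF _ assms(1)] measurable_Pair comp) auto
  have "(\<integral>\<^sup>+\<omega>. f (history n \<omega>, T (Suc n) \<omega>, U (Suc n) \<omega>, V (Suc n) \<omega>) \<partial>M) = (\<integral>\<^sup>+\<omega>. ?f (history (Suc n) \<omega>) \<partial>M)"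
    by (intro nn_integral_cong) (simp, simp add: history_def slots_def obs_def)
  also have "\<dots> = (\<integral>\<^sup>+\<omega>. \<integral>\<^sup>+g. \<integral>\<^sup>+a. \<integral>\<^sup>+b. f (history n \<omega>, T n \<omega> + g, (T n \<omega> + g) * a, (T n \<omega> + g) * b)
      \<partial>std_uniform \<partial>std_uniform \<partial>std_exponential \<partial>M)"
    by (subst nn_integral_history_Suc) (auto simp: extend_def[of n _ _ _ _] simp del: One_nat_def)
  also have "\<dots> = (\<integral>\<^sup>+\<omega>. \<integral>\<^sup>+g. \<integral>\<^sup>+c. f (history n \<omega>, T n \<omega> + g, (T n \<omega> + g) * fst c, (T n \<omega> + g) * snd c)
      \<partial>uniform_pair \<partial>std_exponential \<partial>M)"
    by (intro nn_integral_cong, subst B.nn_integral_fst[symmetric]) auto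
  finally show ?thesis .
qed

section \<open>Paths with finitely many jumps\<close>

text \<open>
  The path before the first jump. It continues with \<open>x \<tau>\<close> beyond \<open>\<tau>\<close>; the indicator makes it Borel on
  the whole line although \<open>x\<close> is only measurable on \<open>[0, \<tau>]\<close>.
\<close>

definition start :: "real \<Rightarrow> real" where
  "start t = (if t \<le> \<tau> then indicator {0..\<tau>} t * x t else x \<tau>)"

lemma start_measurable [measurable]: "start \<in> borel_measurable borel"
proof -
  have [measurable]: "(\<lambda>t. indicator {0..\<tau>} t * x t) \<in> borel_measurable borel"
    using x_measurable by (simp add: set_borel_measurable_def)
  show ?thesis unfolding start_def by measurable
qed

text \<open>
  The path that follows the first \<open>n\<close> jumps and is frozen afterwards, as a function of the history.
  At jump \<open>n + 1\<close> the marks are evaluated on the path with \<open>n\<close> jumps, which is legitimate because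
  they almost surely lie strictly below the jump time.
\<close>

primrec path_after :: "nat \<Rightarrow> (nat \<times> nat \<Rightarrow> real) \<Rightarrow> real \<Rightarrow> real" where
  "path_after 0 z t = start t"
| "path_after (Suc n) z t = (if t < z (Suc n, 0) then path_after n z t
     else path_after n z (z (Suc n, 1)) + path_after n z (z (Suc n, 2)))"

lemma path_after_measurable:
  "n \<le> m \<Longrightarrow> (\<lambda>p. path_after n (fst p) (snd p)) \<in> borel_measurable (Hist m \<Otimes>\<^sub>M borel)"
proof (induction n)
  case 0
  then show ?case by simp
next
  case (Suc n)
  then have IH: "(\<lambda>p. path_after n (fst p) (snd p)) \<in> borel_measurable (Hist m \<Otimes>\<^sub>M borel)" by simp
  have IH' [measurable]: "(\<lambda>p. path_after n (fst p) (f p)) \<in> borel_measurable (Hist m \<Otimes>\<^sub>M borel)"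
    if [measurable]: "f \<in> borel_measurable (Hist m \<Otimes>\<^sub>M borel)" for f
    using measurable_compose[OF _ IH, of "\<lambda>p. (fst p, f p)"] by simp
  have [measurable]: "(\<lambda>p. fst p (Suc n, c)) \<in> borel_measurable (Hist m \<Otimes>\<^sub>M borel)" if "c < 3" for c
    using that Suc.prems
    by (intro measurable_compose[OF measurable_fst] measurable_component_singleton) (simp add: slots_def)
  show ?case by simp
qed

lemma path_after_cong:
  "(\<And>i. i \<in> slots n \<Longrightarrow> z i = z' i) \<Longrightarrow> path_after n z t = path_after n z' t"
  by (induction n arbitrary: t) (auto simp: slots_Suc)

definition stopped :: "nat \<Rightarrow> 'a \<Rightarrow> real \<Rightarrow> real" where
  "stopped n \<omega> t = path_after n (history n \<omega>) t"

lemma stopped_0: "stopped 0 \<omega> t = start t"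
  by (simp add: stopped_def)

lemma stopped_Suc: "stopped (Suc n) \<omega> t = (if t < T (Suc n) \<omega> then stopped n \<omega> t
    else stopped n \<omega> (U (Suc n) \<omega>) + stopped n \<omega> (V (Suc n) \<omega>))"
proof -
  have "path_after n (history (Suc n) \<omega>) t = path_after n (history n \<omega>) t" for t
    by (rule path_after_cong) (auto simp: history_def slots_def)
  then show ?thesis
    by (simp add: stopped_def) (simp add: history_def slots_def obs_def)
qed

lemma stopped_measurable [measurable (raw)]:
  assumes [measurable]: "f \<in> measurable N M" "g \<in> borel_measurable N"
  shows "(\<lambda>p. stopped n (f p) (g p)) \<in> borel_measurable N"
  unfolding stopped_def
  using measurable_compose[OF _ path_after_measurable[OF order_refl], of "\<lambda>p. (history n (f p), g p)" N n]
  by simp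

lemma nn_integral_T_Suc:
  assumes [measurable]: "\<psi> \<in> borel_measurable borel"
  shows "(\<integral>\<^sup>+\<omega>. \<psi> (T (Suc n) \<omega>) \<partial>M) = (\<integral>\<^sup>+\<omega>. \<integral>\<^sup>+g. \<psi> (T n \<omega> + g) \<partial>std_exponential \<partial>M)"
  using T_Suc_law[of "\<lambda>_ _. 1" \<psi> n] by simp

text \<open>
  Each gap contributes the factor \<open>E e\<^sup>-\<^sup>g = 1 / 2\<close>. The decay in \<open>n\<close> rules out an explosion.
\<close>

lemma nn_integral_exp_T: "(\<integral>\<^sup>+\<omega>. ennreal (exp (- T n \<omega>)) \<partial>M) \<le> ennreal ((1 / 2) ^ n)"
proof (induction n)
  case 0
  have "(\<integral>\<^sup>+\<omega>. ennreal (exp (- T 0 \<omega>)) \<partial>M) \<le> (\<integral>\<^sup>+\<omega>. 1 \<partial>M)"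
    using \<tau>_nonneg by (intro nn_integral_mono) (simp add: ennreal_le_1)
  then show ?case by (simp add: emeasure_space_1)
next
  case (Suc n)
  interpret E: prob_space "density lborel (exponential_density 2)"
    by (rule prob_space_exponential_density) simp
  have "(\<integral>\<^sup>+g. ennreal (exp (- g)) \<partial>std_exponential) = (\<integral>\<^sup>+g. ennreal (1/2) * ennreal (exponential_density 2 g) \<partial>lborel)"
  proof -
    have "ennreal (exponential_density 1 g) * ennreal (exp (- g)) = ennreal (1/2) * ennreal (exponential_density 2 g)" for g
      by (subst (1 2) ennreal_mult[symmetric])
         (auto simp: exponential_density_def exp_add[symmetric] mult_exp_exp)
    then show ?thesis by (subst nn_integral_density) auto
  qed
  also have "\<dots> = ennreal (1/2) * (\<integral>\<^sup>+g. 1 \<partial>density lborel (exponential_density 2))"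
    by (subst nn_integral_cmult, simp, subst nn_integral_density) auto
  also have "\<dots> = ennreal (1/2)" using E.emeasure_space_1 by simp
  finally have half: "(\<integral>\<^sup>+g. ennreal (exp (- g)) \<partial>std_exponential) = ennreal (1/2)" .
  have "(\<integral>\<^sup>+\<omega>. ennreal (exp (- T (Suc n) \<omega>)) \<partial>M)
      = (\<integral>\<^sup>+\<omega>. \<integral>\<^sup>+g. ennreal (exp (- T n \<omega>)) * ennreal (exp (- g)) \<partial>std_exponential \<partial>M)"
    by (subst nn_integral_T_Suc) (auto simp: exp_add[symmetric] ennreal_mult[symmetric] mult_exp_exp)
  also have "\<dots> = (\<integral>\<^sup>+\<omega>. ennreal (exp (- T n \<omega>)) * ennreal (1/2) \<partial>M)"
    by (subst nn_integral_cmult) (auto simp: half)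
  also have "\<dots> = (\<integral>\<^sup>+\<omega>. ennreal (exp (- T n \<omega>)) \<partial>M) * ennreal (1/2)"
    by (rule nn_integral_multc) measurable
  also have "\<dots> \<le> ennreal ((1/2) ^ n) * ennreal (1/2)"
    by (intro mult_right_mono Suc.IH) simp
  also have "\<dots> = ennreal ((1/2) ^ Suc n)"
    by (subst ennreal_mult[symmetric]) (auto simp: mult.commute)
  finally show ?case .
qed

lemma T_unbounded: "AE \<omega> in M. \<forall>t. \<exists>n. t < T n \<omega>"
proof -
  have "AE \<omega> in M. \<exists>n. real m < T n \<omega>" for m
  proof -
    define A where "A = {\<omega> \<in> space M. \<forall>n. T n \<omega> \<le> real m}"
    have A [measurable]: "A \<in> sets M" unfolding A_def by measurable
    have "measure M A * exp (- real m) \<le> (1/2) ^ n" for n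
    proof -
      have "ennreal (exp (- real m) * measure M A) = (\<integral>\<^sup>+\<omega>. ennreal (exp (- real m)) * indicator A \<omega> \<partial>M)"
        by (simp add: nn_integral_cmult emeasure_eq_measure ennreal_mult)
      also have "\<dots> \<le> (\<integral>\<^sup>+\<omega>. ennreal (exp (- T n \<omega>)) \<partial>M)"
        by (intro nn_integral_mono) (auto simp: A_def split: split_indicator intro!: ennreal_leI)
      also have "\<dots> \<le> ennreal ((1/2) ^ n)" by (rule nn_integral_exp_T)
      finally show ?thesis by (subst (asm) ennreal_le_iff) (auto simp: mult.commute)
    qed
    then have "measure M A * exp (- real m) \<le> 0"
      by (intro LIMSEQ_le_const[OF LIMSEQ_realpow_zero[of "1/2"]]) auto
    then have "measure M A = 0" by (simp add: mult_le_0_iff measure_le_0_iff)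
    then have "emeasure M A = 0" by (simp add: emeasure_eq_measure)
    then show ?thesis
      by (intro AE_I[where N = A]) (auto simp: A_def not_less)
  qed
  then have "AE \<omega> in M. \<forall>m::nat. \<exists>n. real m < T n \<omega>" by (simp add: AE_all_countable)
  then show ?thesis
    by eventually_elim (meson less_trans reals_Archimedean2)
qed

text \<open>
  Strictly below: the value \<open>1\<close> has mass zero for the standard uniform law. Without it the equation
  \<open>X (T r) = X (U r) + X (V r)\<close> could be circular.
\<close>

lemma marks_in_range:
  "AE \<omega> in M. \<forall>n. 0 \<le> U (Suc n) \<omega> \<and> U (Suc n) \<omega> < T (Suc n) \<omega> \<and> 0 \<le> V (Suc n) \<omega> \<and> V (Suc n) \<omega> < T (Suc n) \<omega>"
proof (subst AE_all_countable, rule allI)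
  fix n
  let ?bad = "\<lambda>y u v. indicator {q. \<not> (0 \<le> fst (snd q) \<and> fst (snd q) < fst q \<and> 0 \<le> snd (snd q) \<and> snd (snd q) < fst q)} (y, u, v) :: ennreal"
  have [measurable]: "U (Suc n) \<in> borel_measurable M" "V (Suc n) \<in> borel_measurable M"
    using U_measurable V_measurable by auto
  have in01: "AE a in std_uniform. 0 \<le> a \<and> a < 1"
    by (rule AE_uniform_measureI) (auto intro!: AE_I[where N = "{1}"])
  then have in01': "AE c in uniform_pair. (0 \<le> fst c \<and> fst c < 1) \<and> (0 \<le> snd c \<and> snd c < 1)"
    by (rule AE_uniform_pairI) measurable
  have "(\<integral>\<^sup>+\<omega>. ?bad (T (Suc n) \<omega>) (U (Suc n) \<omega>) (V (Suc n) \<omega>) \<partial>M) =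
     (\<integral>\<^sup>+\<omega>. \<integral>\<^sup>+g. \<integral>\<^sup>+c. ?bad (T n \<omega> + g) ((T n \<omega> + g) * fst c) ((T n \<omega> + g) * snd c)
        \<partial>uniform_pair \<partial>std_exponential \<partial>M)"
    using nn_integral_next_jump[of "\<lambda>p. ?bad (fst (snd p)) (fst (snd (snd p))) (snd (snd (snd p)))" n] by simp
  also have "\<dots> = (\<integral>\<^sup>+\<omega>. 0 \<partial>M)"
    using T_ge_tau
  proof (intro nn_integral_cong_AE, eventually_elim)
    case (elim \<omega>)
    then have "0 \<le> T n \<omega>" using \<tau>_nonneg by (meson order_trans)
    have "(\<integral>\<^sup>+g. \<integral>\<^sup>+c. ?bad (T n \<omega> + g) ((T n \<omega> + g) * fst c) ((T n \<omega> + g) * snd c)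
        \<partial>uniform_pair \<partial>std_exponential) = (\<integral>\<^sup>+g. 0 \<partial>std_exponential)"
      using AE_std_exponential_pos
    proof (intro nn_integral_cong_AE, eventually_elim)
      case (elim g)
      then have pos: "0 < T n \<omega> + g" using \<open>0 \<le> T n \<omega>\<close> by simp
      have "(\<integral>\<^sup>+c. ?bad (T n \<omega> + g) ((T n \<omega> + g) * fst c) ((T n \<omega> + g) * snd c) \<partial>uniform_pair)
          = (\<integral>\<^sup>+c. 0 \<partial>uniform_pair)"
        using in01' by (intro nn_integral_cong_AE, eventually_elim) (use pos in \<open>auto split: split_indicator simp: zero_le_mult_iff\<close>)
      then show ?case by simp
    qed
    then show ?case by simp
  qed
  finally have "(\<integral>\<^sup>+\<omega>. ?bad (T (Suc n) \<omega>) (U (Suc n) \<omega>) (V (Suc n) \<omega>) \<partial>M) = 0" by simp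
  then have "AE \<omega> in M. ?bad (T (Suc n) \<omega>) (U (Suc n) \<omega>) (V (Suc n) \<omega>) = 0"
    by (subst (asm) nn_integral_0_iff_AE) auto
  then show "AE \<omega> in M. 0 \<le> U (Suc n) \<omega> \<and> U (Suc n) \<omega> < T (Suc n) \<omega> \<and> 0 \<le> V (Suc n) \<omega> \<and> V (Suc n) \<omega> < T (Suc n) \<omega>"
    by eventually_elim (auto split: split_indicator_asm)
qed

text \<open>
  The almost sure event on which the path equations determine the path at all times.
\<close>

definition regular :: "'a \<Rightarrow> bool" where
  "regular \<omega> \<longleftrightarrow> T 0 \<omega> = \<tau> \<and> (\<forall>n. T n \<omega> < T (Suc n) \<omega>) \<and> (\<forall>t. \<exists>n. t < T n \<omega>) \<and>
     (\<forall>n. 0 \<le> U (Suc n) \<omega> \<and> U (Suc n) \<omega> < T (Suc n) \<omega> \<and> 0 \<le> V (Suc n) \<omega> \<and> V (Suc n) \<omega> < T (Suc n) \<omega>) \<and>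
     adding_path \<tau> x (\<lambda>r. T r \<omega>) (\<lambda>r. U r \<omega>) (\<lambda>r. V r \<omega>) (\<lambda>t. X t \<omega>)"

lemma AE_regular: "AE \<omega> in M. regular \<omega>"
  using AE_space[of M] T_strictly_increasing T_unbounded marks_in_range path
  by eventually_elim (unfold regular_def, intro conjI, erule T0, assumption+)

lemma regular_T_mono: "regular \<omega> \<Longrightarrow> m \<le> n \<Longrightarrow> T m \<omega> \<le> T n \<omega>"
proof -
  assume "regular \<omega>" "m \<le> n"
  then have "\<And>k. T k \<omega> \<le> T (Suc k) \<omega>" unfolding regular_def by (meson less_imp_le)
  then show ?thesis using \<open>m \<le> n\<close> by (rule lift_Suc_mono_le)
qed

lemma regular_interval:
  assumes "regular \<omega>" "\<tau> \<le> t"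
  obtains n where "T n \<omega> \<le> t" "t < T (Suc n) \<omega>"
proof -
  define m where "m = (LEAST n. t < T n \<omega>)"
  have "\<exists>n. t < T n \<omega>" using assms(1) unfolding regular_def by blast
  then have m: "t < T m \<omega>" unfolding m_def by (rule LeastI_ex)
  have "T 0 \<omega> = \<tau>" using assms(1) unfolding regular_def by blast
  then have "m \<noteq> 0" using m assms(2) by (cases "m = 0") auto
  then obtain n where n: "m = Suc n" by (cases m) auto
  then have "\<not> t < T n \<omega>" using not_less_Least[of n "\<lambda>n. t < T n \<omega>"] by (simp add: m_def)
  then show thesis using that[of n] m n by simp
qed

lemma regular_path:
  assumes "regular \<omega>"
  shows "\<And>t. 0 \<le> t \<Longrightarrow> t \<le> \<tau> \<Longrightarrow> X t \<omega> = x t"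
    and "\<And>r t. T r \<omega> \<le> t \<Longrightarrow> t < T (Suc r) \<omega> \<Longrightarrow> X t \<omega> = X (T r \<omega>) \<omega>"
    and "\<And>r. X (T (Suc r) \<omega>) \<omega> = X (U (Suc r) \<omega>) \<omega> + X (V (Suc r) \<omega>) \<omega>"
proof -
  have path: "adding_path \<tau> x (\<lambda>r. T r \<omega>) (\<lambda>r. U r \<omega>) (\<lambda>r. V r \<omega>) (\<lambda>t. X t \<omega>)"
    using assms unfolding regular_def by blast
  then show "0 \<le> t \<Longrightarrow> t \<le> \<tau> \<Longrightarrow> X t \<omega> = x t" for t
    unfolding adding_path_def by simp
  have "(\<forall>t. T (Suc r - 1) \<omega> \<le> t \<and> t < T (Suc r) \<omega> \<longrightarrow> X t \<omega> = X (T (Suc r - 1) \<omega>) \<omega>) \<and>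
      X (T (Suc r) \<omega>) \<omega> = X (U (Suc r) \<omega>) \<omega> + X (V (Suc r) \<omega>) \<omega>" for r
    using path unfolding adding_path_def by (elim conjE allE[of _ "Suc r"]) (rule mp, assumption, simp)
  then show "T r \<omega> \<le> t \<Longrightarrow> t < T (Suc r) \<omega> \<Longrightarrow> X t \<omega> = X (T r \<omega>) \<omega>"
    "X (T (Suc r) \<omega>) \<omega> = X (U (Suc r) \<omega>) \<omega> + X (V (Suc r) \<omega>) \<omega>" for r t
    by simp_all
qed

lemma X_eq_stopped:
  assumes "regular \<omega>" "0 \<le> t" "t < T (Suc n) \<omega>"
  shows "X t \<omega> = stopped n \<omega> t"
  using assms(2-3)
proof (induction n arbitrary: t)
  case 0
  have T0: "T 0 \<omega> = \<tau>" using assms(1) unfolding regular_def by blast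
  show ?case
  proof (cases "t \<le> \<tau>")
    case True
    then show ?thesis using 0 by (simp add: regular_path[OF assms(1)] stopped_0 start_def)
  next
    case False
    then have "X t \<omega> = X (T 0 \<omega>) \<omega>"
      using 0 T0 by (intro regular_path(2)[OF assms(1)]) auto
    also have "\<dots> = x \<tau>" using T0 \<tau>_nonneg by (simp add: regular_path(1)[OF assms(1)])
    finally show ?thesis using False by (simp add: stopped_0 start_def)
  qed
next
  case (Suc n)
  have marks: "0 \<le> U (Suc n) \<omega>" "U (Suc n) \<omega> < T (Suc n) \<omega>" "0 \<le> V (Suc n) \<omega>" "V (Suc n) \<omega> < T (Suc n) \<omega>"
    using assms(1) unfolding regular_def by blast+
  show ?case
  proof (cases "t < T (Suc n) \<omega>")
    case True
    then show ?thesis using Suc by (simp add: stopped_Suc)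
  next
    case False
    then have "X t \<omega> = X (T (Suc n) \<omega>) \<omega>"
      using Suc.prems by (intro regular_path(2)[OF assms(1)]) auto
    also have "\<dots> = X (U (Suc n) \<omega>) \<omega> + X (V (Suc n) \<omega>) \<omega>"
      by (rule regular_path(3)[OF assms(1)])
    also have "\<dots> = stopped n \<omega> (U (Suc n) \<omega>) + stopped n \<omega> (V (Suc n) \<omega>)"
      using marks by (simp add: Suc.IH)
    finally show ?thesis using False by (simp add: stopped_Suc)
  qed
qed

text \<open>
  A version of the process that is jointly measurable in \<open>\<omega>\<close> and time, as Tonelli and Fubini require;
  \<open>X\<close> itself is a random variable only for each fixed time. On regular paths the chosen index is the
  number of jumps up to time \<open>t\<close>.
\<close>

definition Xt :: "'a \<Rightarrow> real \<Rightarrow> real" where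
  "Xt \<omega> t = stopped (LEAST n. t < T (Suc n) \<omega>) \<omega> t"

lemma Xt_eq_X:
  assumes "regular \<omega>" "0 \<le> t"
  shows "Xt \<omega> t = X t \<omega>"
proof -
  obtain n where "t < T n \<omega>" using assms(1) unfolding regular_def by blast
  then have "t < T (Suc n) \<omega>" using regular_T_mono[OF assms(1), of n "Suc n"] by simp
  then have "t < T (Suc (LEAST n. t < T (Suc n) \<omega>)) \<omega>" by (rule LeastI)
  then show ?thesis using assms by (simp add: Xt_def X_eq_stopped)
qed

lemma Xt_eq_stopped: "regular \<omega> \<Longrightarrow> 0 \<le> t \<Longrightarrow> t < T (Suc n) \<omega> \<Longrightarrow> Xt \<omega> t = stopped n \<omega> t"
  by (simp add: Xt_eq_X X_eq_stopped)

lemma Xt_measurable [measurable (raw)]: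
  assumes [measurable]: "f \<in> measurable N M" "g \<in> borel_measurable N"
  shows "(\<lambda>p. Xt (f p) (g p)) \<in> borel_measurable N"
  unfolding Xt_def
  by (rule measurable_compose_countable[where f = "\<lambda>n p. stopped n (f p) (g p)"]) measurable

text \<open>
  Indicator of the event that exactly \<open>n\<close> jumps have occurred by time \<open>t\<close>.
\<close>

definition in_gap :: "nat \<Rightarrow> real \<Rightarrow> 'a \<Rightarrow> ennreal" where
  "in_gap n t \<omega> = (if T n \<omega> \<le> t \<and> t < T (Suc n) \<omega> then 1 else 0)"

lemma in_gap_measurable [measurable (raw)]:
  assumes [measurable]: "f \<in> measurable N M" "g \<in> borel_measurable N"
  shows "(\<lambda>p. in_gap n (g p) (f p)) \<in> borel_measurable N"
  unfolding in_gap_def by measurable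

lemma suminf_in_gap:
  assumes "regular \<omega>" "\<tau> \<le> t"
  shows "(\<Sum>n. in_gap n t \<omega>) = 1"
proof -
  obtain m where m: "T m \<omega> \<le> t" "t < T (Suc m) \<omega>" using regular_interval[OF assms] .
  have "in_gap n t \<omega> = (if n = m then 1 else 0)" for n
  proof (cases n m rule: linorder_cases)
    case less
    then have "T (Suc n) \<omega> \<le> T m \<omega>" using regular_T_mono[OF assms(1)] by simp
    then show ?thesis using less m by (auto simp: in_gap_def)
  next
    case greater
    then have "T (Suc m) \<omega> \<le> T n \<omega>" using regular_T_mono[OF assms(1)] by simp
    then show ?thesis using greater m by (auto simp: in_gap_def)
  qed (use m in \<open>auto simp: in_gap_def\<close>)
  then show ?thesis using sums_single[of m "\<lambda>_. 1::ennreal"] by (auto intro: sums_unique[symmetric])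
qed

lemma nn_integral_split_gaps:
  assumes [measurable]: "Y \<in> borel_measurable M" and "\<tau> \<le> t"
  shows "(\<integral>\<^sup>+\<omega>. Y \<omega> \<partial>M) = (\<Sum>n. \<integral>\<^sup>+\<omega>. in_gap n t \<omega> * Y \<omega> \<partial>M)"
proof -
  have "(\<integral>\<^sup>+\<omega>. Y \<omega> \<partial>M) = (\<integral>\<^sup>+\<omega>. (\<Sum>n. in_gap n t \<omega> * Y \<omega>) \<partial>M)"
    using AE_regular by (intro nn_integral_cong_AE, eventually_elim) (simp add: suminf_in_gap \<open>\<tau> \<le> t\<close>)
  also have "\<dots> = (\<Sum>n. \<integral>\<^sup>+\<omega>. in_gap n t \<omega> * Y \<omega> \<partial>M)"
    by (rule nn_integral_suminf) measurable
  finally show ?thesis .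
qed

text \<open>
  For \<open>n = 0\<close> the history is empty and \<open>T 0 = \<tau>\<close> is a constant instead of a coordinate.
\<close>

lemma T_from_history:
  "\<exists>L. L \<in> borel_measurable (Hist n) \<and> (\<forall>\<omega>\<in>space M. T n \<omega> = L (history n \<omega>))"
proof (cases n)
  case 0
  then show ?thesis by (intro exI[of _ "\<lambda>_. \<tau>"]) auto
next
  case (Suc m)
  then show ?thesis
    by (intro exI[of _ "\<lambda>z. z (n, 0)"] conjI measurable_component_singleton)
       (auto simp: slots_def history_def obs_def)
qed

text \<open>
  Given a history with \<open>T n \<le> t\<close>, no further jump occurs up to \<open>t\<close> with probability
  \<open>e\<^sup>-\<^sup>(\<^sup>t\<^sup>-\<^sup>T\<^sup>n\<^sup>)\<close>.
\<close>

lemma nn_integral_in_gap: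
  assumes [measurable]: "f \<in> borel_measurable (Hist n)"
  shows "(\<integral>\<^sup>+\<omega>. in_gap n t \<omega> * f (history n \<omega>) \<partial>M) =
    (\<integral>\<^sup>+\<omega>. (ennreal (exp (- (t - T n \<omega>))) * indicator {0..} (t - T n \<omega>)) * f (history n \<omega>) \<partial>M)"
proof -
  interpret UP: prob_space uniform_pair by (rule prob_space_uniform_pair)
  obtain L where [measurable]: "L \<in> borel_measurable (Hist n)" and L: "\<And>\<omega>. \<omega> \<in> space M \<Longrightarrow> T n \<omega> = L (history n \<omega>)"
    using T_from_history by metis
  let ?f = "\<lambda>p. f (fst p) * indicator {q. fst q \<le> t \<and> t < snd q} (L (fst p), fst (snd p))"
  have "(\<integral>\<^sup>+\<omega>. in_gap n t \<omega> * f (history n \<omega>) \<partial>M) =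
      (\<integral>\<^sup>+\<omega>. ?f (history n \<omega>, T (Suc n) \<omega>, U (Suc n) \<omega>, V (Suc n) \<omega>) \<partial>M)"
    by (intro nn_integral_cong) (simp add: L in_gap_def split: split_indicator)
  also have "\<dots> = (\<integral>\<^sup>+\<omega>. \<integral>\<^sup>+g. \<integral>\<^sup>+c. ?f (history n \<omega>, T n \<omega> + g, (T n \<omega> + g) * fst c, (T n \<omega> + g) * snd c)
      \<partial>uniform_pair \<partial>std_exponential \<partial>M)"
    by (rule nn_integral_next_jump) measurable
  also have "\<dots> = (\<integral>\<^sup>+\<omega>. (ennreal (exp (- (t - T n \<omega>))) * indicator {0..} (t - T n \<omega>)) * f (history n \<omega>) \<partial>M)"
  proof (rule nn_integral_cong)
    fix \<omega> assume "\<omega> \<in> space M"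
    have "(\<integral>\<^sup>+g. \<integral>\<^sup>+c. ?f (history n \<omega>, T n \<omega> + g, (T n \<omega> + g) * fst c, (T n \<omega> + g) * snd c)
      \<partial>uniform_pair \<partial>std_exponential) =
      (\<integral>\<^sup>+g. (f (history n \<omega>) * indicator {0..} (t - T n \<omega>)) * indicator {t - T n \<omega><..} g \<partial>std_exponential)"
      using \<open>\<omega> \<in> space M\<close>
      by (intro nn_integral_cong) (auto simp: L UP.emeasure_space_1 split: split_indicator)
    also have "\<dots> = (f (history n \<omega>) * indicator {0..} (t - T n \<omega>)) * (\<integral>\<^sup>+g. indicator {t - T n \<omega><..} g \<partial>std_exponential)"
      by (rule nn_integral_cmult) measurable
    also have "\<dots> = (ennreal (exp (- (t - T n \<omega>))) * indicator {0..} (t - T n \<omega>)) * f (history n \<omega>)"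
    proof (cases "T n \<omega> \<le> t")
      case True
      then show ?thesis using std_exponential_tail[of "t - T n \<omega>"] by (simp add: mult_ac)
    qed simp
    finally show "(\<integral>\<^sup>+g. \<integral>\<^sup>+c. ?f (history n \<omega>, T n \<omega> + g, (T n \<omega> + g) * fst c, (T n \<omega> + g) * snd c)
      \<partial>uniform_pair \<partial>std_exponential) =
      (ennreal (exp (- (t - T n \<omega>))) * indicator {0..} (t - T n \<omega>)) * f (history n \<omega>)" .
  qed
  finally show ?thesis .
qed

section \<open>The last-jump formula\<close>

lemma path_after_measurable' [measurable (raw)]:
  assumes [measurable]: "f \<in> measurable N (Hist n)" "g \<in> borel_measurable N"
  shows "(\<lambda>p. path_after n (f p) (g p)) \<in> borel_measurable N"
  using measurable_compose[OF _ path_after_measurable[OF order_refl], of "\<lambda>p. (f p, g p)"] by simp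

lemma stopped_constant:
  assumes "regular \<omega>" "T n \<omega> \<le> \<sigma>" "\<sigma> \<le> t"
  shows "stopped n \<omega> t = stopped n \<omega> \<sigma>"
proof (cases n)
  case 0
  have "T 0 \<omega> = \<tau>" using assms(1) unfolding regular_def by blast
  then have "\<tau> \<le> \<sigma>" using 0 assms by simp
  moreover have "start u = x \<tau>" if "\<tau> \<le> u" for u
    using that \<tau>_nonneg by (cases "u = \<tau>") (auto simp: start_def)
  ultimately show ?thesis using 0 assms by (simp add: stopped_0)
qed (use assms in \<open>simp add: stopped_Suc\<close>)

text \<open>
  If the \<open>n\<close> jumps up to time \<open>t\<close> have all occurred by \<open>\<sigma>\<close>, the path is frozen on \<open>[\<sigma>, t]\<close>. The survival
  factors at \<open>t\<close> and at \<open>\<sigma>\<close> differ by \<open>e\<^sup>-\<^sup>(\<^sup>t\<^sup>-\<^sup>\<sigma>\<^sup>)\<close>, uniformly in \<open>n\<close>.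
\<close>

lemma no_jump_term:
  assumes [measurable]: "h \<in> borel_measurable (borel \<Otimes>\<^sub>M borel)"
    and order: "0 \<le> s" "s \<le> \<sigma>" "\<sigma> \<le> t"
  shows "(\<integral>\<^sup>+\<omega>. in_gap n t \<omega> * (h (Xt \<omega> s, Xt \<omega> t) * indicator {..\<sigma>} (T n \<omega>)) \<partial>M) =
    ennreal (exp (- (t - \<sigma>))) * (\<integral>\<^sup>+\<omega>. in_gap n \<sigma> \<omega> * h (Xt \<omega> s, Xt \<omega> \<sigma>) \<partial>M)"
proof -
  obtain L where [measurable]: "L \<in> borel_measurable (Hist n)" and L: "\<And>\<omega>. \<omega> \<in> space M \<Longrightarrow> T n \<omega> = L (history n \<omega>)"
    using T_from_history by metis
  have "(\<integral>\<^sup>+\<omega>. in_gap n t \<omega> * (h (Xt \<omega> s, Xt \<omega> t) * indicator {..\<sigma>} (T n \<omega>)) \<partial>M) =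
    (\<integral>\<^sup>+\<omega>. in_gap n t \<omega> * (h (stopped n \<omega> s, stopped n \<omega> \<sigma>) * indicator {..\<sigma>} (L (history n \<omega>))) \<partial>M)"
    using AE_regular AE_space[of M]
  proof (intro nn_integral_cong_AE, eventually_elim)
    case (elim \<omega>)
    then show ?case
      using order stopped_constant[of \<omega> n \<sigma> t]
      by (auto simp: in_gap_def Xt_eq_stopped[where n = n] L split: split_indicator)
  qed
  also have "\<dots> = (\<integral>\<^sup>+\<omega>. (ennreal (exp (- (t - T n \<omega>))) * indicator {0..} (t - T n \<omega>)) *
      (h (stopped n \<omega> s, stopped n \<omega> \<sigma>) * indicator {..\<sigma>} (L (history n \<omega>))) \<partial>M)"
    unfolding stopped_def by (rule nn_integral_in_gap) measurable
  also have "\<dots> = (\<integral>\<^sup>+\<omega>. ennreal (exp (- (t - \<sigma>))) * ((ennreal (exp (- (\<sigma> - T n \<omega>))) * indicator {0..} (\<sigma> - T n \<omega>)) *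
      h (stopped n \<omega> s, stopped n \<omega> \<sigma>)) \<partial>M)"
    using order
    by (intro nn_integral_cong)
       (auto simp: L[symmetric] mult.assoc[symmetric] ennreal_mult[symmetric] mult_exp_exp split: split_indicator)
  also have "\<dots> = ennreal (exp (- (t - \<sigma>))) * (\<integral>\<^sup>+\<omega>. (ennreal (exp (- (\<sigma> - T n \<omega>))) * indicator {0..} (\<sigma> - T n \<omega>)) *
      h (stopped n \<omega> s, stopped n \<omega> \<sigma>) \<partial>M)"
    by (rule nn_integral_cmult) measurable
  also have "(\<integral>\<^sup>+\<omega>. (ennreal (exp (- (\<sigma> - T n \<omega>))) * indicator {0..} (\<sigma> - T n \<omega>)) *
      h (stopped n \<omega> s, stopped n \<omega> \<sigma>) \<partial>M) = (\<integral>\<^sup>+\<omega>. in_gap n \<sigma> \<omega> * h (stopped n \<omega> s, stopped n \<omega> \<sigma>) \<partial>M)"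
    unfolding stopped_def by (rule nn_integral_in_gap[symmetric]) measurable
  also have "\<dots> = (\<integral>\<^sup>+\<omega>. in_gap n \<sigma> \<omega> * h (Xt \<omega> s, Xt \<omega> \<sigma>) \<partial>M)"
    using AE_regular
    by (intro nn_integral_cong_AE, eventually_elim) (use order in \<open>auto simp: in_gap_def Xt_eq_stopped[where n = n]\<close>)
  finally show ?thesis .
qed

text \<open>
  Jump \<open>n + 1\<close> is the last one before \<open>t\<close> and happens at \<open>y > \<sigma>\<close>. Its time has density
  \<open>e\<^sup>-\<^sup>(\<^sup>y\<^sup>-\<^sup>T\<^sup>n\<^sup>)\<close> given the history and is followed by no jump up to \<open>t\<close> with probability
  \<open>e\<^sup>-\<^sup>(\<^sup>t\<^sup>-\<^sup>y\<^sup>)\<close>. The density is itself the survival factor that turns a functional of the first \<open>n\<close>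
  jumps into an expectation over paths with exactly \<open>n\<close> jumps at time \<open>y\<close>.
\<close>

lemma jump_term:
  assumes [measurable]: "h \<in> borel_measurable (borel \<Otimes>\<^sub>M borel)"
    and order: "0 \<le> s" "s \<le> \<sigma>" "\<sigma> \<le> t"
  shows "(\<integral>\<^sup>+\<omega>. in_gap (Suc n) t \<omega> * (h (Xt \<omega> s, Xt \<omega> t) * indicator {\<sigma><..} (T (Suc n) \<omega>)) \<partial>M) =
    (\<integral>\<^sup>+y. (indicator {\<sigma><..t} y * ennreal (exp (- (t - y)))) *
      (\<integral>\<^sup>+c. \<integral>\<^sup>+\<omega>. in_gap n y \<omega> * h (Xt \<omega> s, Xt \<omega> (y * fst c) + Xt \<omega> (y * snd c)) \<partial>M \<partial>uniform_pair) \<partial>lborel)"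
proof -
  interpret UP: prob_space uniform_pair by (rule prob_space_uniform_pair)
  interpret MU: pair_sigma_finite M uniform_pair
    by (intro pair_sigma_finite.intro sigma_finite_measure_axioms UP.sigma_finite_measure_axioms)
  interpret MLeb: pair_sigma_finite M lborel
    by (intro pair_sigma_finite.intro sigma_finite_measure_axioms lborel.sigma_finite_measure_axioms)
  have [measurable]: "(\<lambda>z. z (Suc n, 0)) \<in> borel_measurable (Hist (Suc n))"
    by (intro measurable_component_singleton) (simp add: slots_def)
  define w where "w y = (indicator {\<sigma><..t} y * ennreal (exp (- (t - y))))" for y
  have [measurable]: "w \<in> borel_measurable borel" unfolding w_def by measurable
  define F where "F p = w (fst (snd p)) * h (path_after n (fst p) s,
     path_after n (fst p) (fst (snd (snd p))) + path_after n (fst p) (snd (snd (snd p))))" for p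
  have [measurable]: "F \<in> borel_measurable (Hist n \<Otimes>\<^sub>M (borel \<Otimes>\<^sub>M (borel \<Otimes>\<^sub>M borel)))"
    unfolding F_def by measurable
  have T_hist: "T (Suc n) \<omega> = history (Suc n) \<omega> (Suc n, 0)" for \<omega>
    by (simp add: history_def slots_def obs_def)
  let ?E = "\<lambda>y \<omega>. ennreal (exp (- (y - T n \<omega>))) * indicator {0..} (y - T n \<omega>)"
  let ?h = "\<lambda>\<omega> y c. h (stopped n \<omega> s, stopped n \<omega> (y * fst c) + stopped n \<omega> (y * snd c))"
  have "(\<integral>\<^sup>+\<omega>. in_gap (Suc n) t \<omega> * (h (Xt \<omega> s, Xt \<omega> t) * indicator {\<sigma><..} (T (Suc n) \<omega>)) \<partial>M) =
    (\<integral>\<^sup>+\<omega>. in_gap (Suc n) t \<omega> * (h (stopped (Suc n) \<omega> s, stopped (Suc n) \<omega> t) *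
        indicator {\<sigma><..} (history (Suc n) \<omega> (Suc n, 0))) \<partial>M)"
    using AE_regular unfolding T_hist
    by (intro nn_integral_cong_AE, eventually_elim) (use order in \<open>auto simp: in_gap_def Xt_eq_stopped[where n = "Suc n"]\<close>)
  also have "\<dots> = (\<integral>\<^sup>+\<omega>. (ennreal (exp (- (t - T (Suc n) \<omega>))) * indicator {0..} (t - T (Suc n) \<omega>)) *
      (h (stopped (Suc n) \<omega> s, stopped (Suc n) \<omega> t) * indicator {\<sigma><..} (history (Suc n) \<omega> (Suc n, 0))) \<partial>M)"
    unfolding stopped_def by (rule nn_integral_in_gap) measurable
  also have "\<dots> = (\<integral>\<^sup>+\<omega>. F (history n \<omega>, T (Suc n) \<omega>, U (Suc n) \<omega>, V (Suc n) \<omega>) \<partial>M)"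
    using order unfolding T_hist[symmetric] F_def w_def
    by (intro nn_integral_cong) (auto simp: stopped_Suc stopped_def[symmetric] split: split_indicator)
  also have "\<dots> = (\<integral>\<^sup>+\<omega>. \<integral>\<^sup>+g. \<integral>\<^sup>+c. F (history n \<omega>, T n \<omega> + g, (T n \<omega> + g) * fst c, (T n \<omega> + g) * snd c)
      \<partial>uniform_pair \<partial>std_exponential \<partial>M)"
    by (rule nn_integral_next_jump) measurable
  also have "\<dots> = (\<integral>\<^sup>+\<omega>. \<integral>\<^sup>+y. ?E y \<omega> * (\<integral>\<^sup>+c. F (history n \<omega>, y, y * fst c, y * snd c) \<partial>uniform_pair) \<partial>lborel \<partial>M)"
  proof (rule nn_integral_cong)
    fix \<omega> assume [simp]: "\<omega> \<in> space M"
    have [measurable]: "(\<lambda>y. \<integral>\<^sup>+c. F (history n \<omega>, y, y * fst c, y * snd c) \<partial>uniform_pair) \<in> borel_measurable borel"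
      by measurable
    show "(\<integral>\<^sup>+g. \<integral>\<^sup>+c. F (history n \<omega>, T n \<omega> + g, (T n \<omega> + g) * fst c, (T n \<omega> + g) * snd c)
      \<partial>uniform_pair \<partial>std_exponential) = (\<integral>\<^sup>+y. ?E y \<omega> * (\<integral>\<^sup>+c. F (history n \<omega>, y, y * fst c, y * snd c) \<partial>uniform_pair) \<partial>lborel)"
      by (rule std_exponential_shift) measurable
  qed
  also have "\<dots> = (\<integral>\<^sup>+\<omega>. \<integral>\<^sup>+y. \<integral>\<^sup>+c. w y * (?E y \<omega> * ?h \<omega> y c) \<partial>uniform_pair \<partial>lborel \<partial>M)"
    unfolding F_def
    by (intro nn_integral_cong) (simp add: stopped_def nn_integral_cmult mult_ac)
  also have "\<dots> = (\<integral>\<^sup>+y. \<integral>\<^sup>+\<omega>. \<integral>\<^sup>+c. w y * (?E y \<omega> * ?h \<omega> y c) \<partial>uniform_pair \<partial>M \<partial>lborel)"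
    by (rule MLeb.Fubini'[symmetric]) measurable
  also have "\<dots> = (\<integral>\<^sup>+y. \<integral>\<^sup>+c. \<integral>\<^sup>+\<omega>. w y * (?E y \<omega> * ?h \<omega> y c) \<partial>M \<partial>uniform_pair \<partial>lborel)"
    by (intro nn_integral_cong MU.Fubini'[symmetric]) measurable
  also have "\<dots> = (\<integral>\<^sup>+y. w y * (\<integral>\<^sup>+c. \<integral>\<^sup>+\<omega>. ?E y \<omega> * ?h \<omega> y c \<partial>M \<partial>uniform_pair) \<partial>lborel)"
    by (intro nn_integral_cong) (simp add: nn_integral_cmult)
  also have "\<dots> = (\<integral>\<^sup>+y. w y *
      (\<integral>\<^sup>+c. \<integral>\<^sup>+\<omega>. in_gap n y \<omega> * h (Xt \<omega> s, Xt \<omega> (y * fst c) + Xt \<omega> (y * snd c)) \<partial>M \<partial>uniform_pair) \<partial>lborel)"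
  proof (rule nn_integral_cong)
    fix y :: real
    show "w y * (\<integral>\<^sup>+c. \<integral>\<^sup>+\<omega>. ?E y \<omega> * ?h \<omega> y c \<partial>M \<partial>uniform_pair) =
      w y * (\<integral>\<^sup>+c. \<integral>\<^sup>+\<omega>. in_gap n y \<omega> * h (Xt \<omega> s, Xt \<omega> (y * fst c) + Xt \<omega> (y * snd c)) \<partial>M \<partial>uniform_pair)"
    proof (cases "\<sigma> < y")
      case True
      have "(\<integral>\<^sup>+\<omega>. ?E y \<omega> * ?h \<omega> y c \<partial>M) = (\<integral>\<^sup>+\<omega>. in_gap n y \<omega> * ?h \<omega> y c \<partial>M)" for c
        unfolding stopped_def by (rule nn_integral_in_gap[symmetric]) measurable
      then have "(\<integral>\<^sup>+c. \<integral>\<^sup>+\<omega>. ?E y \<omega> * ?h \<omega> y c \<partial>M \<partial>uniform_pair) = (\<integral>\<^sup>+c. \<integral>\<^sup>+\<omega>. in_gap n y \<omega> * ?h \<omega> y c \<partial>M \<partial>uniform_pair)"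
        by simp
      also have "\<dots> = (\<integral>\<^sup>+c. \<integral>\<^sup>+\<omega>. in_gap n y \<omega> * h (Xt \<omega> s, Xt \<omega> (y * fst c) + Xt \<omega> (y * snd c)) \<partial>M \<partial>uniform_pair)"
        using AE_uniform_pair
      proof (intro nn_integral_cong_AE, eventually_elim)
        fix c :: "real \<times> real" assume c: "(0 \<le> fst c \<and> fst c \<le> 1) \<and> (0 \<le> snd c \<and> snd c \<le> 1)"
        \<comment> \<open>Named, so that the bounds on the two sampling times are linear facts.\<close>
        define u v where "u = y * fst c" and "v = y * snd c"
        have "0 \<le> u" "u \<le> y" "0 \<le> v" "v \<le> y"
          using c True order by (auto simp: u_def v_def mult_left_le)
        then show "(\<integral>\<^sup>+\<omega>. in_gap n y \<omega> * ?h \<omega> y c \<partial>M) =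
            (\<integral>\<^sup>+\<omega>. in_gap n y \<omega> * h (Xt \<omega> s, Xt \<omega> (y * fst c) + Xt \<omega> (y * snd c)) \<partial>M)"
          using AE_regular True order unfolding u_def[symmetric] v_def[symmetric]
          by (intro nn_integral_cong_AE) (auto elim!: eventually_mono simp: in_gap_def Xt_eq_stopped[where n = n])
      qed
      finally show ?thesis by simp
    qed (simp add: w_def)
  qed
  finally show ?thesis unfolding w_def .
qed

text \<open>
  The number of jumps up to \<open>t\<close> is almost surely finite, so the expectation splits over its values.
  Paths without a jump in \<open>(\<sigma>, t]\<close> reassemble to the first term and the others, sorted by the time
  \<open>y\<close> of their last jump, to the integral.
\<close>

theorem last_jump_formula:
  assumes [measurable]: "h \<in> borel_measurable (borel \<Otimes>\<^sub>M borel)"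
    and order: "0 \<le> s" "s \<le> \<sigma>" "\<tau> \<le> \<sigma>" "\<sigma> \<le> t"
  shows "(\<integral>\<^sup>+\<omega>. h (Xt \<omega> s, Xt \<omega> t) \<partial>M) =
    ennreal (exp (- (t - \<sigma>))) * (\<integral>\<^sup>+\<omega>. h (Xt \<omega> s, Xt \<omega> \<sigma>) \<partial>M) +
    (\<integral>\<^sup>+y. (indicator {\<sigma><..t} y * ennreal (exp (- (t - y)))) *
      (\<integral>\<^sup>+c. \<integral>\<^sup>+\<omega>. h (Xt \<omega> s, Xt \<omega> (y * fst c) + Xt \<omega> (y * snd c)) \<partial>M \<partial>uniform_pair) \<partial>lborel)"
proof -
  interpret UP: prob_space uniform_pair by (rule prob_space_uniform_pair)
  define b where "b n = (\<integral>\<^sup>+\<omega>. in_gap n t \<omega> * (h (Xt \<omega> s, Xt \<omega> t) * indicator {\<sigma><..} (T n \<omega>)) \<partial>M)" for n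
  define a where "a n = (\<integral>\<^sup>+\<omega>. in_gap n t \<omega> * (h (Xt \<omega> s, Xt \<omega> t) * indicator {..\<sigma>} (T n \<omega>)) \<partial>M)" for n
  let ?H = "\<lambda>y c \<omega>. h (Xt \<omega> s, Xt \<omega> (y * fst c) + Xt \<omega> (y * snd c))"
  let ?w = "\<lambda>y. indicator {\<sigma><..t} y * ennreal (exp (- (t - y)))"
  have "(\<integral>\<^sup>+\<omega>. h (Xt \<omega> s, Xt \<omega> t) \<partial>M) = (\<Sum>n. \<integral>\<^sup>+\<omega>. in_gap n t \<omega> * h (Xt \<omega> s, Xt \<omega> t) \<partial>M)"
    using order by (intro nn_integral_split_gaps) auto
  also have "\<dots> = (\<Sum>n. a n + b n)"
    unfolding a_def b_def
    by (subst nn_integral_add[symmetric]) (auto intro!: suminf_cong nn_integral_cong split: split_indicator)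
  also have "\<dots> = (\<Sum>n. a n) + (\<Sum>n. b n)"
    by (rule suminf_add[symmetric]) auto
  also have "(\<Sum>n. a n) = ennreal (exp (- (t - \<sigma>))) * (\<integral>\<^sup>+\<omega>. h (Xt \<omega> s, Xt \<omega> \<sigma>) \<partial>M)"
    unfolding a_def using order
    by (simp add: no_jump_term nn_integral_split_gaps[where t = \<sigma> and Y = "\<lambda>\<omega>. h (Xt \<omega> s, Xt \<omega> \<sigma>)"])
  also have "(\<Sum>n. b n) = (\<Sum>n. b (Suc n))"
  proof -
    \<comment> \<open>For \<open>n = 0\<close> the last jump time is \<open>T 0 = \<tau> \<le> \<sigma>\<close>.\<close>
    have "b 0 = (\<integral>\<^sup>+\<omega>. 0 \<partial>M)"
      unfolding b_def using order by (intro nn_integral_cong) auto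
    moreover have "b sums ((\<Sum>n. b (Suc n)) + b 0)"
      by (intro sums_Suc summable_sums) auto
    ultimately show ?thesis by (simp add: sums_unique[symmetric])
  qed
  also have "(\<Sum>n. b (Suc n)) = (\<Sum>n. \<integral>\<^sup>+y. ?w y * (\<integral>\<^sup>+c. \<integral>\<^sup>+\<omega>. in_gap n y \<omega> * ?H y c \<omega> \<partial>M \<partial>uniform_pair) \<partial>lborel)"
    unfolding b_def using order by (intro suminf_cong jump_term) auto
  also have "\<dots> = (\<integral>\<^sup>+y. (\<Sum>n. ?w y * (\<integral>\<^sup>+c. \<integral>\<^sup>+\<omega>. in_gap n y \<omega> * ?H y c \<omega> \<partial>M \<partial>uniform_pair)) \<partial>lborel)"
    by (rule nn_integral_suminf[symmetric]) measurable
  also have "\<dots> = (\<integral>\<^sup>+y. ?w y * (\<integral>\<^sup>+c. (\<Sum>n. \<integral>\<^sup>+\<omega>. in_gap n y \<omega> * ?H y c \<omega> \<partial>M) \<partial>uniform_pair) \<partial>lborel)"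
    by (intro nn_integral_cong) (simp add: ennreal_suminf_cmult nn_integral_suminf)
  also have "\<dots> = (\<integral>\<^sup>+y. ?w y * (\<integral>\<^sup>+c. \<integral>\<^sup>+\<omega>. ?H y c \<omega> \<partial>M \<partial>uniform_pair) \<partial>lborel)"
  proof (rule nn_integral_cong)
    fix y :: real
    show "?w y * (\<integral>\<^sup>+c. (\<Sum>n. \<integral>\<^sup>+\<omega>. in_gap n y \<omega> * ?H y c \<omega> \<partial>M) \<partial>uniform_pair) =
        ?w y * (\<integral>\<^sup>+c. \<integral>\<^sup>+\<omega>. ?H y c \<omega> \<partial>M \<partial>uniform_pair)"
    proof (cases "\<sigma> < y")
      case True
      have "(\<Sum>n. \<integral>\<^sup>+\<omega>. in_gap n y \<omega> * ?H y c \<omega> \<partial>M) = (\<integral>\<^sup>+\<omega>. ?H y c \<omega> \<partial>M)" for c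
        using True order by (intro nn_integral_split_gaps[symmetric]) auto
      then show ?thesis by simp
    qed simp
  qed
  finally show ?thesis .
qed

section \<open>Exponential bound for the second moment\<close>

text \<open>
  The second moment with values in the extended half-line, before it is known to be finite.
\<close>

definition qn :: "real \<Rightarrow> ennreal" where
  "qn t = (\<integral>\<^sup>+\<omega>. ennreal ((Xt \<omega> t)\<^sup>2) \<partial>M)"

lemma qn_measurable [measurable]: "qn \<in> borel_measurable borel"
  unfolding qn_def by measurable

lemma AE_Xt_initial:
  assumes "0 \<le> t" "t \<le> \<tau>"
  shows "AE \<omega> in M. Xt \<omega> t = x t"
  using AE_regular by eventually_elim (use assms in \<open>simp add: Xt_eq_X regular_path(1)\<close>)

lemma qn_initial: "0 \<le> t \<Longrightarrow> t \<le> \<tau> \<Longrightarrow> qn t = ennreal ((x t)\<^sup>2)"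
proof -
  assume t: "0 \<le> t" "t \<le> \<tau>"
  have "qn t = (\<integral>\<^sup>+\<omega>. ennreal ((x t)\<^sup>2) \<partial>M)"
    unfolding qn_def using AE_Xt_initial[OF t] by (intro nn_integral_cong_AE) (auto elim: eventually_mono)
  then show ?thesis by (simp add: emeasure_space_1)
qed

text \<open>
  The clause for \<open>\<tau> = 0\<close> is what keeps \<open>R0 / y\<close> bounded for \<open>y > \<tau>\<close>, in that case as well.
\<close>

lemma qn_initial_mass:
  "\<exists>R0\<ge>0. (\<integral>\<^sup>+u. qn u * indicator {0..\<tau>} u \<partial>lborel) = ennreal R0 \<and> (\<tau> = 0 \<longrightarrow> R0 = 0)"
proof -
  have "(\<integral>\<^sup>+u. qn u * indicator {0..\<tau>} u \<partial>lborel) = (\<integral>\<^sup>+u. ennreal (indicator {0..\<tau>} u * (x u)\<^sup>2) \<partial>lborel)"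
    by (intro nn_integral_cong) (auto simp: qn_initial split: split_indicator)
  also have "\<dots> = ennreal (LBINT u:{0..\<tau>}. (x u)\<^sup>2)"
    using x_square_integrable unfolding set_integrable_def set_lebesgue_integral_def
    by (subst nn_integral_eq_integral) auto
  finally have *: "(\<integral>\<^sup>+u. qn u * indicator {0..\<tau>} u \<partial>lborel) = ennreal (LBINT u:{0..\<tau>}. (x u)\<^sup>2)" .
  have nonneg: "0 \<le> (LBINT u:{0..\<tau>}. (x u)\<^sup>2)"
    unfolding set_lebesgue_integral_def by (rule integral_nonneg_AE) auto
  have zero: "(LBINT u:{0..\<tau>}. (x u)\<^sup>2) = 0" if "\<tau> = 0"
    unfolding set_lebesgue_integral_def using that
    by (intro integral_eq_zero_AE AE_I[where N = "{0}"]) (auto split: split_indicator_asm)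
  show ?thesis using * nonneg zero by blast
qed

text \<open>
  The average of \<open>f\<close> over \<open>[0, y]\<close> splits at \<open>\<tau>\<close>: the initial piece has mass at most \<open>R0\<close>, the rest
  is controlled by its largest value.
\<close>

lemma uniform_mean_bound:
  fixes f :: "real \<Rightarrow> ennreal"
  assumes [measurable]: "f \<in> borel_measurable borel"
    and le: "\<And>u. 0 \<le> u \<Longrightarrow> f u \<le> qn u" "\<And>u. \<tau> \<le> u \<Longrightarrow> f u \<le> ennreal (m * exp (7 * u))"
    and "0 \<le> m" and "\<tau> < y"
    and R0: "(\<integral>\<^sup>+u. qn u * indicator {0..\<tau>} u \<partial>lborel) = ennreal R0" "0 \<le> R0"
  shows "(\<integral>\<^sup>+a. f (y * a) \<partial>std_uniform) \<le> ennreal (R0 / y + m * exp (7 * y))"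
proof -
  have "0 < y" using \<open>\<tau> < y\<close> \<tau>_nonneg by simp
  have "(\<integral>\<^sup>+u. f u * indicator {0..y} u \<partial>lborel) \<le>
      (\<integral>\<^sup>+u. qn u * indicator {0..\<tau>} u + ennreal (m * exp (7 * y)) * indicator {\<tau>..y} u \<partial>lborel)"
  proof (rule nn_integral_mono)
    fix u
    have "f u \<le> ennreal (m * exp (7 * y))" if "\<tau> \<le> u" "u \<le> y"
      using le(2)[OF that(1)] that \<open>0 \<le> m\<close> by (rule_tac order_trans) (auto intro!: ennreal_leI mult_left_mono)
    then show "f u * indicator {0..y} u \<le>
        qn u * indicator {0..\<tau>} u + ennreal (m * exp (7 * y)) * indicator {\<tau>..y} u"
      using le(1)[of u] by (cases "u \<le> \<tau>") (auto split: split_indicator intro: add_increasing2)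
  qed
  also have "\<dots> = ennreal R0 + ennreal (m * exp (7 * y)) * ennreal (y - \<tau>)"
    using \<open>\<tau> < y\<close> by (subst nn_integral_add) (auto simp: R0 nn_integral_cmult)
  also have "\<dots> \<le> ennreal (R0 + m * exp (7 * y) * y)"
    using \<open>\<tau> < y\<close> \<open>0 \<le> m\<close> R0 \<tau>_nonneg
    by (subst ennreal_mult[symmetric]; (subst ennreal_plus[symmetric])?) (auto intro!: ennreal_leI mult_left_mono)
  finally have "(\<integral>\<^sup>+u. f u * indicator {0..y} u \<partial>lborel) / ennreal y \<le> ennreal (R0 + m * exp (7 * y) * y) / ennreal y"
    by (rule divide_right_mono_ennreal)
  also have "\<dots> = ennreal (R0 / y + m * exp (7 * y))"
    using \<open>0 < y\<close> R0 \<open>0 \<le> m\<close> by (subst divide_ennreal) (auto simp: field_simps)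
  finally show ?thesis
    using \<open>0 < y\<close> by (subst std_uniform_scale) (auto simp: nn_integral_uniform_measure)
qed

text \<open>
  Inserting \<open>(a + b)\<^sup>2 \<le> 2 a\<^sup>2 + 2 b\<^sup>2\<close> into the last-jump formula bounds the second moment at \<open>t\<close> by
  its averages over earlier intervals, and one such pass halves \<open>m\<close> in a bound \<open>m e\<^sup>7\<^sup>t\<close>. Iteration
  needs a finite bound to start from; the squares are therefore cut off at a level \<open>L\<close>, where \<open>m = L\<close>
  will do, and the cut-off is removed at the end.
\<close>

lemma qn_bound: "\<exists>C\<ge>0. \<forall>t\<ge>\<tau>. qn t \<le> ennreal (C * exp (7 * t))"
proof -
  obtain R0 where R0: "(\<integral>\<^sup>+u. qn u * indicator {0..\<tau>} u \<partial>lborel) = ennreal R0" "0 \<le> R0" "\<tau> = 0 \<longrightarrow> R0 = 0"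
    using qn_initial_mass by blast
  define K0 where "K0 = R0 / \<tau>"
  have K0: "0 \<le> K0" using R0 \<tau>_nonneg by (simp add: K0_def)
  have R0_y: "R0 / y \<le> K0" if "\<tau> < y" for y
    using that R0 \<tau>_nonneg unfolding K0_def by (cases "\<tau> = 0") (auto intro!: divide_left_mono)
  define B where "B = (x \<tau>)\<^sup>2 + 4 * K0"
  have B: "0 \<le> B" using K0 by (simp add: B_def)
  define qL :: "nat \<Rightarrow> real \<Rightarrow> ennreal"
    where "qL L t = (\<integral>\<^sup>+\<omega>. min (ennreal ((Xt \<omega> t)\<^sup>2)) (of_nat L) \<partial>M)" for L t
  have qL_measurable [measurable]: "qL L \<in> borel_measurable borel" for L
    unfolding qL_def by measurable
  have qL_le_qn: "qL L t \<le> qn t" for L t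
    unfolding qL_def qn_def by (intro nn_integral_mono) auto
  have qL_le_L: "qL L t \<le> of_nat L" for L t
  proof -
    have "qL L t \<le> (\<integral>\<^sup>+\<omega>. of_nat L \<partial>M)" unfolding qL_def by (intro nn_integral_mono) auto
    then show ?thesis by (simp add: emeasure_space_1)
  qed
  have improve: "qL L t \<le> ennreal ((B + m / 2) * exp (7 * t))"
    if m: "0 \<le> m" "\<And>u. \<tau> \<le> u \<Longrightarrow> qL L u \<le> ennreal (m * exp (7 * u))" and t: "\<tau> \<le> t" for L m t
  proof -
    let ?h = "\<lambda>p. min (ennreal ((snd p)\<^sup>2)) (of_nat L) :: ennreal"
    let ?w = "\<lambda>y. indicator {\<tau><..t} y * ennreal (exp (- (t - y)))"
    have split: "min (ennreal ((a + b)\<^sup>2)) (of_nat L) \<le> 2 * min (ennreal (a\<^sup>2)) (of_nat L) + 2 * min (ennreal (b\<^sup>2)) (of_nat L)"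
      for a b :: real
    proof -
      have *: "(a + b)\<^sup>2 \<le> 2 * a\<^sup>2 + 2 * b\<^sup>2" using sum_squares_bound[of a b] by (simp add: power2_sum)
      have "min ((a + b)\<^sup>2) (real L) \<le> 2 * min (a\<^sup>2) (real L) + 2 * min (b\<^sup>2) (real L)"
        using * by (rule min_le_twice) auto
      then have "ennreal (min ((a + b)\<^sup>2) (real L)) \<le> ennreal (2 * min (a\<^sup>2) (real L) + 2 * min (b\<^sup>2) (real L))"
        by (rule ennreal_leI)
      also have "\<dots> = 2 * ennreal (min (a\<^sup>2) (real L)) + 2 * ennreal (min (b\<^sup>2) (real L))"
        by (simp add: ennreal_plus ennreal_mult)
      finally have "ennreal (min ((a + b)\<^sup>2) (real L)) \<le> 2 * ennreal (min (a\<^sup>2) (real L)) + 2 * ennreal (min (b\<^sup>2) (real L))" .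
      moreover have "ennreal (min p (real L)) = min (ennreal p) (of_nat L)" if "0 \<le> p" for p
        using that by (auto simp: min_def ennreal_of_nat_eq_real_of_nat)
      ultimately show ?thesis by simp
    qed
    have inner: "(\<integral>\<^sup>+c. \<integral>\<^sup>+\<omega>. ?h (Xt \<omega> \<tau>, Xt \<omega> (y * fst c) + Xt \<omega> (y * snd c)) \<partial>M \<partial>uniform_pair)
        \<le> ennreal (4 * K0 + 4 * m * exp (7 * y))" if "\<tau> < y" for y
    proof -
      have "(\<integral>\<^sup>+c. \<integral>\<^sup>+\<omega>. ?h (Xt \<omega> \<tau>, Xt \<omega> (y * fst c) + Xt \<omega> (y * snd c)) \<partial>M \<partial>uniform_pair)
        \<le> (\<integral>\<^sup>+c. \<integral>\<^sup>+\<omega>. 2 * min (ennreal ((Xt \<omega> (y * fst c))\<^sup>2)) (of_nat L) +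
              2 * min (ennreal ((Xt \<omega> (y * snd c))\<^sup>2)) (of_nat L) \<partial>M \<partial>uniform_pair)"
        by (intro nn_integral_mono) (use split in simp)
      also have "\<dots> = (\<integral>\<^sup>+c. 2 * qL L (y * fst c) + 2 * qL L (y * snd c) \<partial>uniform_pair)"
        unfolding qL_def by (intro nn_integral_cong) (simp add: nn_integral_add nn_integral_cmult)
      also have "\<dots> = (\<integral>\<^sup>+c. 2 * qL L (y * fst c) \<partial>uniform_pair) + (\<integral>\<^sup>+c. 2 * qL L (y * snd c) \<partial>uniform_pair)"
        by (rule nn_integral_add) measurable
      also have "\<dots> = 4 * (\<integral>\<^sup>+a. qL L (y * a) \<partial>std_uniform)"
        using uniform_pair_marginals[of "\<lambda>a. 2 * qL L (y * a)"]
        by (simp add: nn_integral_cmult flip: distrib_right)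
      also have "\<dots> \<le> 4 * ennreal (R0 / y + m * exp (7 * y))"
        using that m R0 qL_le_qn by (intro mult_left_mono uniform_mean_bound) auto
      also have "\<dots> = ennreal (4 * (R0 / y + m * exp (7 * y)))"
        using m R0 that \<tau>_nonneg by (subst ennreal_mult) auto
      also have "\<dots> \<le> ennreal (4 * K0 + 4 * m * exp (7 * y))"
        using R0_y[OF that] by (intro ennreal_leI) simp
      finally show ?thesis .
    qed
    have "qL L t = ennreal (exp (- (t - \<tau>))) * qL L \<tau> + (\<integral>\<^sup>+y. ?w y *
      (\<integral>\<^sup>+c. \<integral>\<^sup>+\<omega>. ?h (Xt \<omega> \<tau>, Xt \<omega> (y * fst c) + Xt \<omega> (y * snd c)) \<partial>M \<partial>uniform_pair) \<partial>lborel)"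
      using last_jump_formula[of ?h \<tau> \<tau> t] t \<tau>_nonneg by (simp add: qL_def)
    also have "\<dots> \<le> 1 * ennreal ((x \<tau>)\<^sup>2) + (\<integral>\<^sup>+y. ennreal (4 * K0) * ?w y + ennreal (4 * m) * (?w y * ennreal (exp (7 * y))) \<partial>lborel)"
    proof (intro add_mono mult_mono nn_integral_mono)
      show "qL L \<tau> \<le> ennreal ((x \<tau>)\<^sup>2)"
        using qL_le_qn[of L \<tau>] qn_initial[of \<tau>] \<tau>_nonneg by simp
      show "ennreal (exp (- (t - \<tau>))) \<le> 1" using t by (simp add: ennreal_le_1)
      fix y
      have "ennreal (4 * K0 + 4 * m * exp (7 * y)) = ennreal (4 * K0) + ennreal (4 * m) * ennreal (exp (7 * y))"
        using m K0 by (simp add: ennreal_plus ennreal_mult)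
      then show "?w y * (\<integral>\<^sup>+c. \<integral>\<^sup>+\<omega>. ?h (Xt \<omega> \<tau>, Xt \<omega> (y * fst c) + Xt \<omega> (y * snd c)) \<partial>M \<partial>uniform_pair)
          \<le> ennreal (4 * K0) * ?w y + ennreal (4 * m) * (?w y * ennreal (exp (7 * y)))"
        using mult_left_mono[OF inner[of y], of "?w y"] by (cases "\<tau> < y") (auto simp: distrib_left mult_ac)
    qed auto
    also have "(\<integral>\<^sup>+y. ennreal (4 * K0) * ?w y + ennreal (4 * m) * (?w y * ennreal (exp (7 * y))) \<partial>lborel)
        = ennreal (4 * K0) * (\<integral>\<^sup>+y. ?w y \<partial>lborel) + ennreal (4 * m) * (\<integral>\<^sup>+y. ?w y * ennreal (exp (7 * y)) \<partial>lborel)"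
      by (simp add: nn_integral_add nn_integral_cmult)
    also have "\<dots> \<le> ennreal (4 * K0) * 1 + ennreal (4 * m) * ennreal (exp (7 * t) / 8)"
      by (intro add_mono mult_left_mono exp_growth_integral exp_kernel_integral t) auto
    also have "1 * ennreal ((x \<tau>)\<^sup>2) + (ennreal (4 * K0) * 1 + ennreal (4 * m) * ennreal (exp (7 * t) / 8))
        = ennreal (B + m / 2 * exp (7 * t))"
      using K0 m by (simp add: B_def ennreal_plus ennreal_mult[symmetric] add.assoc)
    also have "\<dots> \<le> ennreal ((B + m / 2) * exp (7 * t))"
      using B t \<tau>_nonneg mult_left_mono[of 1 "exp (7 * t)" B] by (intro ennreal_leI) (simp add: distrib_right)
    finally show ?thesis by (simp add: add_left_mono)
  qed
  have qL_bound: "qL L t \<le> ennreal (2 * B * exp (7 * t))" if t: "\<tau> \<le> t" for L t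
  proof -
    have "qL L u \<le> ennreal ((2 * B + real L / 2 ^ k) * exp (7 * u))" if "\<tau> \<le> u" for k u
      using that
    proof (induction k arbitrary: u)
      case 0
      have "real L * 1 \<le> (2 * B + real L) * exp (7 * u)"
        using B 0 \<tau>_nonneg by (intro mult_mono) auto
      then have "ennreal (real L) \<le> ennreal ((2 * B + real L) * exp (7 * u))" by (intro ennreal_leI) simp
      then show ?case using qL_le_L[of L u] by (simp add: ennreal_of_nat_eq_real_of_nat)
    next
      case (Suc k)
      show ?case using improve[of "2 * B + real L / 2 ^ k" L u] Suc B by (simp add: field_simps)
    qed
    moreover have "(\<lambda>k. ennreal ((2 * B + real L / 2 ^ k) * exp (7 * t))) \<longlonglongrightarrow> ennreal ((2 * B + 0) * exp (7 * t))"
      by (intro tendsto_intros LIMSEQ_divide_realpow_zero) auto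
    ultimately show ?thesis
      using t by (intro LIMSEQ_le_const) auto
  qed
  have "qn t \<le> ennreal (2 * B * exp (7 * t))" if t: "\<tau> \<le> t" for t
  proof -
    have "qn t = (\<integral>\<^sup>+\<omega>. (SUP L. min (ennreal ((Xt \<omega> t)\<^sup>2)) (of_nat L)) \<partial>M)"
      unfolding qn_def
    proof (intro nn_integral_cong antisym)
      fix \<omega>
      obtain L where "(Xt \<omega> t)\<^sup>2 \<le> real L" using real_arch_simple by blast
      then have "ennreal ((Xt \<omega> t)\<^sup>2) \<le> of_nat L"
        by (simp add: ennreal_leI ennreal_of_nat_eq_real_of_nat)
      then show "ennreal ((Xt \<omega> t)\<^sup>2) \<le> (SUP L. min (ennreal ((Xt \<omega> t)\<^sup>2)) (of_nat L))"
        by (intro SUP_upper2[of L]) auto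
      show "(SUP L. min (ennreal ((Xt \<omega> t)\<^sup>2)) (of_nat L)) \<le> ennreal ((Xt \<omega> t)\<^sup>2)"
        by (intro SUP_least) auto
    qed
    also have "\<dots> = (SUP L. qL L t)"
      unfolding qL_def
      by (intro nn_integral_monotone_convergence_SUP)
         (auto simp: incseq_def le_fun_def min.coboundedI2 intro!: min.mono of_nat_mono)
    also have "\<dots> \<le> ennreal (2 * B * exp (7 * t))"
      by (intro SUP_least qL_bound t)
    finally show ?thesis .
  qed
  then show ?thesis using B by (intro exI[of _ "2 * B"]) auto
qed

end

section \<open>Integral equations for the second moments\<close>

lemma integrable_product:
  fixes f g :: "real \<Rightarrow> real"
  assumes f: "integrable lborel f" and g: "integrable lborel g"
  shows "integrable (lborel \<Otimes>\<^sub>M lborel) (\<lambda>(u, v). f u * g v)"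
proof (rule lborel_pair.Fubini_integrable)
  have [measurable]: "f \<in> borel_measurable borel" "g \<in> borel_measurable borel"
    using f g by (auto dest: borel_measurable_integrable)
  show "(\<lambda>(u, v). f u * g v) \<in> borel_measurable (lborel \<Otimes>\<^sub>M lborel)" by measurable
  have "(\<lambda>u. \<integral>v. norm (case (u, v) of (u, v) \<Rightarrow> f u * g v) \<partial>lborel) = (\<lambda>u. norm (f u) * (\<integral>v. norm (g v) \<partial>lborel))"
    by (simp add: abs_mult)
  then show "integrable lborel (\<lambda>u. \<integral>v. norm (case (u, v) of (u, v) \<Rightarrow> f u * g v) \<partial>lborel)"
    using f by simp
  show "AE u in lborel. integrable lborel (\<lambda>v. case (u, v) of (u, v) \<Rightarrow> f u * g v)"
    using g by simp
qed

lemma integrable_indicator_Icc [simp]: "integrable lborel (indicator {a..b::real} :: real \<Rightarrow> real)"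
  by (intro integrable_real_indicator) (auto simp: emeasure_lborel_Icc_eq)

lemma set_integrable_const_Icc: "set_integrable lborel {a..b::real} (\<lambda>_. k::real)"
  by (simp add: set_integrable_def)

context continuized_adding_process
begin

text \<open>
  The covariances of the measurable version; they are the moments \<open>c(u, v)\<close> for \<open>u, v \<ge> 0\<close>.
\<close>

definition c :: "real \<Rightarrow> real \<Rightarrow> real" where
  "c u v = (\<integral>\<omega>. Xt \<omega> u * Xt \<omega> v \<partial>M)"

lemma c_commute: "c u v = c v u"
  by (simp add: c_def mult.commute)

lemma c_measurable [measurable (raw)]:
  assumes [measurable]: "f \<in> borel_measurable N" "g \<in> borel_measurable N"
  shows "(\<lambda>p. c (f p) (g p)) \<in> borel_measurable N"
  unfolding c_def by measurable

lemma qn_finite: "0 \<le> t \<Longrightarrow> qn t < \<infinity>"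
proof (cases "t \<le> \<tau>")
  case False
  obtain C where C: "\<forall>t\<ge>\<tau>. qn t \<le> ennreal (C * exp (7 * t))" using qn_bound by blast
  have "qn t \<le> ennreal (C * exp (7 * t))" using False C by simp
  also have "\<dots> < \<infinity>" by simp
  finally show ?thesis .
qed (simp add: qn_initial)

lemma integrable_Xt_sq: "0 \<le> t \<Longrightarrow> integrable M (\<lambda>\<omega>. (Xt \<omega> t)\<^sup>2)"
  using qn_finite[of t] by (simp add: integrable_iff_bounded qn_def)

lemma integrable_Xt_mult:
  assumes "0 \<le> u" "0 \<le> v"
  shows "integrable M (\<lambda>\<omega>. Xt \<omega> u * Xt \<omega> v)"
proof (rule Bochner_Integration.integrable_bound)
  show "integrable M (\<lambda>\<omega>. (Xt \<omega> u)\<^sup>2 + (Xt \<omega> v)\<^sup>2)"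
    using assms by (intro Bochner_Integration.integrable_add integrable_Xt_sq)
  show "AE \<omega> in M. norm (Xt \<omega> u * Xt \<omega> v) \<le> norm ((Xt \<omega> u)\<^sup>2 + (Xt \<omega> v)\<^sup>2)"
    by (intro AE_I2) (simp only: real_norm_def abs_mult_le_sum)
qed measurable

lemma c_same: "c t t = (\<integral>\<omega>. (Xt \<omega> t)\<^sup>2 \<partial>M)"
  by (simp add: c_def power2_eq_square)

lemma c_same_nonneg: "0 \<le> c t t"
  unfolding c_same by (rule integral_nonneg_AE) simp

lemma qn_eq: "0 \<le> t \<Longrightarrow> qn t = ennreal (c t t)"
  unfolding qn_def c_same by (rule nn_integral_eq_integral[OF integrable_Xt_sq]) auto

lemma abs_c_le:
  assumes "0 \<le> u" "0 \<le> v"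
  shows "\<bar>c u v\<bar> \<le> (c u u + c v v) / 2"
proof -
  have "\<bar>c u v\<bar> \<le> (\<integral>\<omega>. \<bar>Xt \<omega> u * Xt \<omega> v\<bar> \<partial>M)"
    unfolding c_def by (rule integral_abs_bound)
  also have "\<dots> \<le> (\<integral>\<omega>. ((Xt \<omega> u)\<^sup>2 + (Xt \<omega> v)\<^sup>2) / 2 \<partial>M)"
    using assms
    by (intro integral_mono integrable_abs integrable_Xt_mult Bochner_Integration.integrable_divide
        Bochner_Integration.integrable_add integrable_Xt_sq abs_mult_le_sum_squares)
  also have "\<dots> = (c u u + c v v) / 2"
    unfolding c_same using assms
    by (subst integral_divide_zero, subst Bochner_Integration.integral_add) (auto intro: integrable_Xt_sq)
  finally show ?thesis .
qed

lemma nn_integral_qn_finite: "(\<integral>\<^sup>+u. qn u * indicator {0..t} u \<partial>lborel) < \<infinity>"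
proof -
  obtain R0 where R0: "(\<integral>\<^sup>+u. qn u * indicator {0..\<tau>} u \<partial>lborel) = ennreal R0"
    using qn_initial_mass by blast
  obtain C where C: "0 \<le> C" "\<And>t. \<tau> \<le> t \<Longrightarrow> qn t \<le> ennreal (C * exp (7 * t))" using qn_bound by blast
  have "(\<integral>\<^sup>+u. qn u * indicator {0..t} u \<partial>lborel) \<le>
     (\<integral>\<^sup>+u. qn u * indicator {0..\<tau>} u + ennreal (C * exp (7 * t)) * indicator {\<tau>..t} u \<partial>lborel)"
  proof (rule nn_integral_mono)
    fix u
    have "qn u \<le> ennreal (C * exp (7 * t))" if "\<tau> \<le> u" "u \<le> t"
      using C(2)[OF that(1)] that \<open>0 \<le> C\<close> by (rule_tac order_trans) (auto intro!: ennreal_leI mult_left_mono)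
    then show "qn u * indicator {0..t} u \<le>
        qn u * indicator {0..\<tau>} u + ennreal (C * exp (7 * t)) * indicator {\<tau>..t} u"
      by (cases "u \<le> \<tau>") (auto split: split_indicator intro: add_increasing2)
  qed
  also have "\<dots> = ennreal R0 + ennreal (C * exp (7 * t)) * emeasure lborel {\<tau>..t}"
    by (subst nn_integral_add) (auto simp: R0 nn_integral_cmult)
  also have "\<dots> < \<infinity>" by (auto simp: ennreal_mult_less_top emeasure_lborel_Icc_eq)
  finally show ?thesis .
qed

lemma set_integrable_q: "set_integrable lborel {0..t} (\<lambda>u. c u u)"
proof -
  have "(\<integral>\<^sup>+u. ennreal (norm (indicator {0..t} u * c u u)) \<partial>lborel) = (\<integral>\<^sup>+u. qn u * indicator {0..t} u \<partial>lborel)"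
    by (intro nn_integral_cong) (auto simp: qn_eq c_same_nonneg split: split_indicator)
  then show ?thesis
    using nn_integral_qn_finite[of t] by (simp add: set_integrable_def integrable_iff_bounded)
qed

lemma integrable_uniform_q:
  assumes "0 < y"
  shows "integrable std_uniform (\<lambda>a. c (y * a) (y * a))"
proof -
  have "(\<integral>\<^sup>+a. ennreal (norm (c (y * a) (y * a))) \<partial>std_uniform) = (\<integral>\<^sup>+u. ennreal (norm (c u u)) * indicator {0..y} u \<partial>lborel) / ennreal y"
    using assms by (subst std_uniform_scale) (auto simp: nn_integral_uniform_measure)
  also have "(\<integral>\<^sup>+u. ennreal (norm (c u u)) * indicator {0..y} u \<partial>lborel) = (\<integral>\<^sup>+u. qn u * indicator {0..y} u \<partial>lborel)"
    by (intro nn_integral_cong) (auto simp: qn_eq c_same_nonneg split: split_indicator)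
  also have "\<dots> / ennreal y < \<infinity>"
    using nn_integral_qn_finite[of y] assms by (simp add: ennreal_divide_eq_top_iff less_top[symmetric])
  finally show ?thesis by (simp add: integrable_iff_bounded)
qed

text \<open>
  For \<open>h\<close> of quadratic growth the formula for the positive and the negative part has finite left-hand
  sides, which makes the right-hand sides finite too: integrability of \<open>g\<close> comes for free.
\<close>

theorem last_jump_formula_real:
  fixes h :: "real \<times> real \<Rightarrow> real"
  assumes [measurable]: "h \<in> borel_measurable (borel \<Otimes>\<^sub>M borel)"
    and h_le: "\<And>a b. \<bar>h (a, b)\<bar> \<le> a\<^sup>2 + b\<^sup>2"
    and order: "0 \<le> s" "s \<le> \<sigma>" "\<tau> \<le> \<sigma>" "\<sigma> \<le> t"
  defines "g \<equiv> \<lambda>(y, p, \<omega>). (indicator {\<sigma><..t} y * exp (- (t - y))) * h (Xt \<omega> s, Xt \<omega> (y * fst p) + Xt \<omega> (y * snd p))"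
  shows "integrable (lborel \<Otimes>\<^sub>M (uniform_pair \<Otimes>\<^sub>M M)) g"
    and "(\<integral>\<omega>. h (Xt \<omega> s, Xt \<omega> t) \<partial>M) = exp (- (t - \<sigma>)) * (\<integral>\<omega>. h (Xt \<omega> s, Xt \<omega> \<sigma>) \<partial>M)
       + (\<integral>z. g z \<partial>(lborel \<Otimes>\<^sub>M (uniform_pair \<Otimes>\<^sub>M M)))"
proof -
  let ?Q = "lborel \<Otimes>\<^sub>M (uniform_pair \<Otimes>\<^sub>M M)"
  interpret UP: prob_space uniform_pair by (rule prob_space_uniform_pair)
  interpret UM: prob_space "uniform_pair \<Otimes>\<^sub>M M"
    by (intro prob_space_pair prob_space_uniform_pair prob_space_axioms)
  have g_measurable [measurable]: "g \<in> borel_measurable ?Q"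
    unfolding g_def by measurable
  have formula: "(\<integral>\<^sup>+\<omega>. ennreal (e * h (Xt \<omega> s, Xt \<omega> t)) \<partial>M) =
      ennreal (exp (- (t - \<sigma>))) * (\<integral>\<^sup>+\<omega>. ennreal (e * h (Xt \<omega> s, Xt \<omega> \<sigma>)) \<partial>M) + (\<integral>\<^sup>+z. ennreal (e * g z) \<partial>?Q)" for e
  proof -
    have "(\<integral>\<^sup>+z. ennreal (e * g z) \<partial>?Q) = (\<integral>\<^sup>+y. \<integral>\<^sup>+z. ennreal (e * g (y, z)) \<partial>(uniform_pair \<Otimes>\<^sub>M M) \<partial>lborel)"
      by (rule UM.nn_integral_fst[symmetric]) measurable
    also have "\<dots> = (\<integral>\<^sup>+y. \<integral>\<^sup>+p. \<integral>\<^sup>+\<omega>. ennreal (e * g (y, p, \<omega>)) \<partial>M \<partial>uniform_pair \<partial>lborel)"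
      by (intro nn_integral_cong nn_integral_fst[symmetric]) measurable
    also have "\<dots> = (\<integral>\<^sup>+y. \<integral>\<^sup>+p. \<integral>\<^sup>+\<omega>. (indicator {\<sigma><..t} y * ennreal (exp (- (t - y)))) *
        ennreal (e * h (Xt \<omega> s, Xt \<omega> (y * fst p) + Xt \<omega> (y * snd p))) \<partial>M \<partial>uniform_pair \<partial>lborel)"
      unfolding g_def
      by (intro nn_integral_cong) (auto simp: ennreal_mult'[symmetric] mult_ac split: split_indicator)
    also have "\<dots> = (\<integral>\<^sup>+y. (indicator {\<sigma><..t} y * ennreal (exp (- (t - y)))) * (\<integral>\<^sup>+p. \<integral>\<^sup>+\<omega>.
        ennreal (e * h (Xt \<omega> s, Xt \<omega> (y * fst p) + Xt \<omega> (y * snd p))) \<partial>M \<partial>uniform_pair) \<partial>lborel)"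
      by (intro nn_integral_cong) (simp add: nn_integral_cmult)
    finally show ?thesis
      using last_jump_formula[of "\<lambda>p. ennreal (e * h p)" s \<sigma> t] order by simp
  qed
  have int_h: "integrable M (\<lambda>\<omega>. h (Xt \<omega> s, Xt \<omega> r))" if "0 \<le> r" for r
  proof (rule Bochner_Integration.integrable_bound)
    show "integrable M (\<lambda>\<omega>. (Xt \<omega> s)\<^sup>2 + (Xt \<omega> r)\<^sup>2)"
      using order that by (intro Bochner_Integration.integrable_add integrable_Xt_sq)
    show "AE \<omega> in M. norm (h (Xt \<omega> s, Xt \<omega> r)) \<le> norm ((Xt \<omega> s)\<^sup>2 + (Xt \<omega> r)\<^sup>2)"
      using h_le by (intro AE_I2) (auto intro: order_trans[OF _ abs_ge_self])
  qed measurable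
  have t0: "0 \<le> t" "0 \<le> \<sigma>" using order by auto
  have fin_t: "(\<integral>\<^sup>+\<omega>. ennreal (e * h (Xt \<omega> s, Xt \<omega> t)) \<partial>M) < \<infinity>"
    and fin_\<sigma>: "(\<integral>\<^sup>+\<omega>. ennreal (e * h (Xt \<omega> s, Xt \<omega> \<sigma>)) \<partial>M) < \<infinity>" for e
  proof -
    have "integrable M (\<lambda>\<omega>. e * h (Xt \<omega> s, Xt \<omega> t))" "integrable M (\<lambda>\<omega>. e * h (Xt \<omega> s, Xt \<omega> \<sigma>))"
      by (intro integrable_mult_right int_h t0)+
    then show "(\<integral>\<^sup>+\<omega>. ennreal (e * h (Xt \<omega> s, Xt \<omega> t)) \<partial>M) < \<infinity>"
      "(\<integral>\<^sup>+\<omega>. ennreal (e * h (Xt \<omega> s, Xt \<omega> \<sigma>)) \<partial>M) < \<infinity>"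
      unfolding real_integrable_def by (auto simp: less_top)
  qed
  have fin_g: "(\<integral>\<^sup>+z. ennreal (e * g z) \<partial>?Q) < \<infinity>" for e
    using formula[of e] fin_t[of e] by (auto simp: less_top)
  show int_g: "integrable ?Q g"
    using fin_g[of 1] fin_g[of "-1"] by (simp add: real_integrable_def less_top)
  have real: "enn2real (\<integral>\<^sup>+\<omega>. ennreal (e * h (Xt \<omega> s, Xt \<omega> t)) \<partial>M) = exp (- (t - \<sigma>)) *
      enn2real (\<integral>\<^sup>+\<omega>. ennreal (e * h (Xt \<omega> s, Xt \<omega> \<sigma>)) \<partial>M) + enn2real (\<integral>\<^sup>+z. ennreal (e * g z) \<partial>?Q)" for e
    using fin_\<sigma>[of e] fin_g[of e] unfolding formula[of e]
    by (subst enn2real_plus) (auto simp: enn2real_mult ennreal_mult_less_top)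
  show "(\<integral>\<omega>. h (Xt \<omega> s, Xt \<omega> t) \<partial>M) = exp (- (t - \<sigma>)) * (\<integral>\<omega>. h (Xt \<omega> s, Xt \<omega> \<sigma>) \<partial>M)
       + (\<integral>z. g z \<partial>?Q)"
    using real[of 1] real[of "-1"] int_g int_h[OF t0(1)] int_h[OF t0(2)]
    by (simp add: real_lebesgue_integral_def right_diff_distrib)
qed

text \<open>
  \<open>G s y\<close> and \<open>R y\<close> are the integrals of \<open>c(s, \<cdot>)\<close> and \<open>q\<close> over \<open>[0, y]\<close>, and \<open>Qt\<close> is \<open>Q\<close> for the
  measurable version of the process.
\<close>

definition G :: "real \<Rightarrow> real \<Rightarrow> real" where
  "G s y = (LBINT u:{0..y}. c s u)"

definition R :: "real \<Rightarrow> real" where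
  "R y = (LBINT u:{0..y}. c u u)"

definition Qt :: "real \<Rightarrow> real" where
  "Qt y = (LBINT v:{0..y}. (LBINT u:{0..y}. c u v))"

lemma G_measurable [measurable (raw)]:
  assumes [measurable]: "f \<in> borel_measurable N" "g \<in> borel_measurable N"
  shows "(\<lambda>p. G (f p) (g p)) \<in> borel_measurable N"
proof -
  have "G (f p) (g p) = (\<integral>u. (if 0 \<le> u \<and> u \<le> g p then c (f p) u else 0) \<partial>lborel)" for p
    unfolding G_def set_lebesgue_integral_def by (intro Bochner_Integration.integral_cong) auto
  then show ?thesis by simp
qed

lemma R_measurable [measurable]: "R \<in> borel_measurable borel"
proof -
  have "R y = (\<integral>u. (if 0 \<le> u \<and> u \<le> y then c u u else 0) \<partial>lborel)" for y
    unfolding R_def set_lebesgue_integral_def by (intro Bochner_Integration.integral_cong) auto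
  then have "R = (\<lambda>y. \<integral>u. (if 0 \<le> u \<and> u \<le> y then c u u else 0) \<partial>lborel)" by auto
  then show ?thesis by simp
qed

lemma Qt_eq: "Qt y = (LBINT u:{0..y}. G u y)"
  unfolding Qt_def G_def by (subst c_commute) simp

lemma Qt_measurable [measurable]: "Qt \<in> borel_measurable borel"
proof -
  have "Qt y = (\<integral>u. (if 0 \<le> u \<and> u \<le> y then G u y else 0) \<partial>lborel)" for y
    unfolding Qt_eq set_lebesgue_integral_def by (intro Bochner_Integration.integral_cong) auto
  then have "Qt = (\<lambda>y. \<integral>u. (if 0 \<le> u \<and> u \<le> y then G u y else 0) \<partial>lborel)" by auto
  then show ?thesis by simp
qed

text \<open>
  Sampling the path at random times \<open>f\<close>, \<open>g\<close> independent of it: integrability follows from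
  \<open>\<bar>a b\<bar> \<le> a\<^sup>2 + b\<^sup>2\<close>, and Fubini integrates the path out first.
\<close>

lemma sampled_product:
  assumes [measurable]: "f \<in> borel_measurable uniform_pair" "g \<in> borel_measurable uniform_pair"
    and pos: "AE p in uniform_pair. 0 \<le> f p \<and> 0 \<le> g p"
    and int: "integrable uniform_pair (\<lambda>p. c (f p) (f p))" "integrable uniform_pair (\<lambda>p. c (g p) (g p))"
  shows "integrable (uniform_pair \<Otimes>\<^sub>M M) (\<lambda>(p, \<omega>). Xt \<omega> (f p) * Xt \<omega> (g p))"
    and "integrable uniform_pair (\<lambda>p. c (f p) (g p))"
    and "(\<integral>z. (case z of (p, \<omega>) \<Rightarrow> Xt \<omega> (f p) * Xt \<omega> (g p)) \<partial>(uniform_pair \<Otimes>\<^sub>M M)) = (\<integral>p. c (f p) (g p) \<partial>uniform_pair)"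
proof -
  interpret UM: pair_sigma_finite uniform_pair M
    by (intro pair_sigma_finite.intro prob_space_imp_sigma_finite prob_space_uniform_pair prob_space_axioms)
  let ?F = "\<lambda>(p, \<omega>). Xt \<omega> (f p) * Xt \<omega> (g p)"
  have "(\<integral>\<^sup>+z. ennreal (norm (?F z)) \<partial>(uniform_pair \<Otimes>\<^sub>M M)) = (\<integral>\<^sup>+p. \<integral>\<^sup>+\<omega>. ennreal (norm (?F (p, \<omega>))) \<partial>M \<partial>uniform_pair)"
    by (rule nn_integral_fst[symmetric]) measurable
  also have "\<dots> \<le> (\<integral>\<^sup>+p. \<integral>\<^sup>+\<omega>. ennreal ((Xt \<omega> (f p))\<^sup>2) + ennreal ((Xt \<omega> (g p))\<^sup>2) \<partial>M \<partial>uniform_pair)"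
    using abs_mult_le_sum
    by (intro nn_integral_mono) (simp add: ennreal_plus[symmetric] ennreal_leI del: ennreal_plus)
  also have "\<dots> = (\<integral>\<^sup>+p. qn (f p) + qn (g p) \<partial>uniform_pair)"
    unfolding qn_def by (intro nn_integral_cong nn_integral_add) measurable
  also have "\<dots> = (\<integral>\<^sup>+p. ennreal (norm (c (f p) (f p))) + ennreal (norm (c (g p) (g p))) \<partial>uniform_pair)"
    using pos by (intro nn_integral_cong_AE, eventually_elim) (simp add: qn_eq c_same_nonneg)
  also have "\<dots> = (\<integral>\<^sup>+p. ennreal (norm (c (f p) (f p))) \<partial>uniform_pair) + (\<integral>\<^sup>+p. ennreal (norm (c (g p) (g p))) \<partial>uniform_pair)"
    by (rule nn_integral_add) measurable
  also have "\<dots> < \<infinity>"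
    using int by (simp add: integrable_iff_bounded)
  finally show F: "integrable (uniform_pair \<Otimes>\<^sub>M M) ?F"
    by (subst integrable_iff_bounded) auto
  show "integrable uniform_pair (\<lambda>p. c (f p) (g p))"
    using UM.integrable_fst'[OF F] by (simp add: c_def)
  show "(\<integral>z. ?F z \<partial>(uniform_pair \<Otimes>\<^sub>M M)) = (\<integral>p. c (f p) (g p) \<partial>uniform_pair)"
    using UM.integral_fst'[OF F] by (simp add: c_def)
qed

text \<open>
  \<open>\<Phi> y\<close> is the expectation of \<open>h\<close> right after a jump at time \<open>y\<close>. A moment relaxes towards this
  value at unit rate.
\<close>

lemma relaxation_of_moment:
  fixes h :: "real \<times> real \<Rightarrow> real"
  assumes [measurable]: "h \<in> borel_measurable (borel \<Otimes>\<^sub>M borel)"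
    and h_le: "\<And>a b. \<bar>h (a, b)\<bar> \<le> a\<^sup>2 + b\<^sup>2"
    and order: "0 \<le> s" "s \<le> \<sigma>" "\<tau> \<le> \<sigma>" "\<sigma> \<le> t"
    and \<Phi>: "\<And>y. \<sigma> < y \<Longrightarrow> (\<integral>z. (case z of (p, \<omega>) \<Rightarrow> h (Xt \<omega> s, Xt \<omega> (y * fst p) + Xt \<omega> (y * snd p))) \<partial>(uniform_pair \<Otimes>\<^sub>M M)) = \<Phi> y"
  shows "set_integrable lborel {\<sigma><..t} (\<lambda>y. exp (- (t - y)) * \<Phi> y)"
    and "(\<integral>\<omega>. h (Xt \<omega> s, Xt \<omega> t) \<partial>M) = exp (- (t - \<sigma>)) * (\<integral>\<omega>. h (Xt \<omega> s, Xt \<omega> \<sigma>) \<partial>M)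
       + (LBINT y:{\<sigma><..t}. exp (- (t - y)) * \<Phi> y)"
proof -
  interpret UM: pair_sigma_finite lborel "uniform_pair \<Otimes>\<^sub>M M"
    by (intro pair_sigma_finite.intro prob_space_imp_sigma_finite prob_space_pair prob_space_uniform_pair
        prob_space_axioms lborel.sigma_finite_measure_axioms)
  let ?g = "\<lambda>(y, p, \<omega>). (indicator {\<sigma><..t} y * exp (- (t - y))) * h (Xt \<omega> s, Xt \<omega> (y * fst p) + Xt \<omega> (y * snd p))"
  note real = last_jump_formula_real[OF assms(1) h_le order]
  have inner: "(\<integral>z. ?g (y, z) \<partial>(uniform_pair \<Otimes>\<^sub>M M)) = indicator {\<sigma><..t} y *\<^sub>R (exp (- (t - y)) * \<Phi> y)" for y
  proof -
    have "(\<lambda>z. ?g (y, z)) = (\<lambda>z. (indicator {\<sigma><..t} y * exp (- (t - y))) *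
      (case z of (p, \<omega>) \<Rightarrow> h (Xt \<omega> s, Xt \<omega> (y * fst p) + Xt \<omega> (y * snd p))))"
      by auto
    then have "(\<integral>z. ?g (y, z) \<partial>(uniform_pair \<Otimes>\<^sub>M M)) = (indicator {\<sigma><..t} y * exp (- (t - y))) *
      (\<integral>z. (case z of (p, \<omega>) \<Rightarrow> h (Xt \<omega> s, Xt \<omega> (y * fst p) + Xt \<omega> (y * snd p))) \<partial>(uniform_pair \<Otimes>\<^sub>M M))"
      by (simp only: integral_mult_right_zero)
    then show ?thesis using \<Phi>[of y] by (cases "\<sigma> < y") auto
  qed
  show "set_integrable lborel {\<sigma><..t} (\<lambda>y. exp (- (t - y)) * \<Phi> y)"
    using UM.integrable_fst'[OF real(1)] unfolding set_integrable_def inner .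
  show "(\<integral>\<omega>. h (Xt \<omega> s, Xt \<omega> t) \<partial>M) = exp (- (t - \<sigma>)) * (\<integral>\<omega>. h (Xt \<omega> s, Xt \<omega> \<sigma>) \<partial>M)
       + (LBINT y:{\<sigma><..t}. exp (- (t - y)) * \<Phi> y)"
    using UM.integral_fst'[OF real(1)] real(2) unfolding set_lebesgue_integral_def inner by simp
qed

lemma AE_scaled_nonneg: "0 < y \<Longrightarrow> AE p in uniform_pair. 0 \<le> y * fst p \<and> 0 \<le> y * snd p"
  using AE_uniform_pair by eventually_elim simp

text \<open>
  A jump at \<open>y\<close> replaces the later factor by a sum of two samples; each of them contributes the average of
  \<open>c(s, \<cdot>)\<close> over \<open>[0, y]\<close>.
\<close>

lemma c_relax:
  assumes order: "0 \<le> s" "s \<le> \<sigma>" "\<tau> \<le> \<sigma>" "\<sigma> \<le> t"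
  shows "set_integrable lborel {\<sigma><..t} (\<lambda>y. exp (- (t - y)) * (2 / y * G s y))"
    and "c s t = exp (- (t - \<sigma>)) * c s \<sigma> + (LBINT y:{\<sigma><..t}. exp (- (t - y)) * (2 / y * G s y))"
proof -
  interpret UP: prob_space uniform_pair by (rule prob_space_uniform_pair)
  let ?h = "\<lambda>p::real \<times> real. fst p * snd p"
  have \<Phi>: "(\<integral>z. (case z of (p, \<omega>) \<Rightarrow> ?h (Xt \<omega> s, Xt \<omega> (y * fst p) + Xt \<omega> (y * snd p))) \<partial>(uniform_pair \<Otimes>\<^sub>M M)) = 2 / y * G s y"
    if "\<sigma> < y" for y
  proof -
    have y: "0 < y" using that order by simp
    have q: "integrable uniform_pair (\<lambda>p. c (y * fst p) (y * fst p))" "integrable uniform_pair (\<lambda>p. c (y * snd p) (y * snd p))"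
      using integrable_uniform_pair_fst[OF integrable_uniform_q[OF y]]
        integrable_uniform_pair_snd[OF integrable_uniform_q[OF y]] by auto
    have AE1: "AE p in uniform_pair. 0 \<le> s \<and> 0 \<le> y * fst p" and AE2: "AE p in uniform_pair. 0 \<le> s \<and> 0 \<le> y * snd p"
      using AE_scaled_nonneg[OF y] order by auto
    note 1 = sampled_product[of "\<lambda>_. s" "\<lambda>p. y * fst p", OF _ _ AE1 _ q(1)]
    note 2 = sampled_product[of "\<lambda>_. s" "\<lambda>p. y * snd p", OF _ _ AE2 _ q(2)]
    have dist: "(\<lambda>z. case z of (p, \<omega>) \<Rightarrow> ?h (Xt \<omega> s, Xt \<omega> (y * fst p) + Xt \<omega> (y * snd p))) =
       (\<lambda>z. (case z of (p, \<omega>) \<Rightarrow> Xt \<omega> s * Xt \<omega> (y * fst p)) + (case z of (p, \<omega>) \<Rightarrow> Xt \<omega> s * Xt \<omega> (y * snd p)))"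
      by (auto simp: fun_eq_iff distrib_left)
    have int: "integrable std_uniform (\<lambda>a. c s (y * a))"
    proof (rule Bochner_Integration.integrable_bound)
      interpret B: prob_space std_uniform by (rule prob_space_std_uniform)
      show "integrable std_uniform (\<lambda>a. c s s + c (y * a) (y * a))"
        using integrable_uniform_q[OF y] by simp
      have "AE a in std_uniform. 0 \<le> a" by (rule AE_uniform_measureI) auto
      then show "AE a in std_uniform. norm (c s (y * a)) \<le> norm (c s s + c (y * a) (y * a))"
      proof eventually_elim
        case (elim a)
        then have "\<bar>c s (y * a)\<bar> \<le> (c s s + c (y * a) (y * a)) / 2" using y order by (intro abs_c_le) auto
        moreover have "0 \<le> c s s" "0 \<le> c (y * a) (y * a)" by (rule c_same_nonneg)+
        ultimately show ?case by (simp add: abs_of_nonneg)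
      qed
    qed measurable
    have "(\<integral>z. (case z of (p, \<omega>) \<Rightarrow> ?h (Xt \<omega> s, Xt \<omega> (y * fst p) + Xt \<omega> (y * snd p))) \<partial>(uniform_pair \<Otimes>\<^sub>M M)) =
       (\<integral>p. c s (y * fst p) \<partial>uniform_pair) + (\<integral>p. c s (y * snd p) \<partial>uniform_pair)"
      unfolding dist using 1 2 by (subst Bochner_Integration.integral_add) simp_all
    also have "\<dots> = 2 * (\<integral>a. c s (y * a) \<partial>std_uniform)"
      using integral_uniform_pair_fst[OF int] integral_uniform_pair_snd[OF int] by simp
    also have "\<dots> = 2 / y * G s y"
      using y by (subst integral_std_uniform_scale[of y "\<lambda>u. c s u"]) (auto simp: G_def)
    finally show ?thesis .
  qed
  have le: "\<bar>?h (a, b)\<bar> \<le> a\<^sup>2 + b\<^sup>2" for a b :: real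
    using abs_mult_le_sum[of a b] by simp
  have h: "?h \<in> borel_measurable (borel \<Otimes>\<^sub>M borel)" by measurable
  note r = relaxation_of_moment[OF h le order \<Phi>]
  show "set_integrable lborel {\<sigma><..t} (\<lambda>y. exp (- (t - y)) * (2 / y * G s y))"
    using r(1) .
  show "c s t = exp (- (t - \<sigma>)) * c s \<sigma> + (LBINT y:{\<sigma><..t}. exp (- (t - y)) * (2 / y * G s y))"
    using r(2) by (simp add: c_def)
qed

text \<open>
  The two marks are independent, so averaging over both of them averages \<open>c\<close> over the square \<open>[0, y]\<^sup>2\<close>.
\<close>

lemma pair_average:
  assumes y: "0 < y" and int: "integrable uniform_pair (\<lambda>p. c (y * fst p) (y * snd p))"
  shows "(\<integral>p. c (y * fst p) (y * snd p) \<partial>uniform_pair) = Qt y / y / y"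
proof -
  have "(\<integral>p. c (y * fst p) (y * snd p) \<partial>uniform_pair) = (\<integral>a. \<integral>b. c (y * a) (y * b) \<partial>std_uniform \<partial>std_uniform)"
    using pair_sigma_finite.integral_fst'[OF pair_sigma_finite_std_uniform int] by simp
  also have "\<dots> = (\<integral>a. G (y * a) y / y \<partial>std_uniform)"
    using y by (subst integral_std_uniform_scale[of y "\<lambda>u. c (y * _) u"]) (auto simp: G_def)
  also have "\<dots> = (LBINT u:{0..y}. G u y / y) / y"
    using y by (subst integral_std_uniform_scale[of y "\<lambda>u. G u y / y"]) auto
  also have "\<dots> = Qt y / y / y"
    by (simp add: Qt_eq)
  finally show ?thesis .
qed

text \<open>
  Expanding the square of the sum of the two samples gives two averages of \<open>q\<close> over \<open>[0, y]\<close> and twice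
  the average of \<open>c\<close> over the square.
\<close>

lemma q_relax:
  assumes order: "\<tau> \<le> t"
  shows "set_integrable lborel {\<tau><..t} (\<lambda>y. exp (- (t - y)) * (2 / y * R y + 2 / y\<^sup>2 * Qt y))"
    and "c t t = exp (- (t - \<tau>)) * c \<tau> \<tau> + (LBINT y:{\<tau><..t}. exp (- (t - y)) * (2 / y * R y + 2 / y\<^sup>2 * Qt y))"
proof -
  let ?h = "\<lambda>p::real \<times> real. (snd p)\<^sup>2"
  have \<Phi>: "(\<integral>z. (case z of (p, \<omega>) \<Rightarrow> ?h (Xt \<omega> \<tau>, Xt \<omega> (y * fst p) + Xt \<omega> (y * snd p))) \<partial>(uniform_pair \<Otimes>\<^sub>M M))
      = 2 / y * R y + 2 / y\<^sup>2 * Qt y"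
    if "\<tau> < y" for y
  proof -
    have y: "0 < y" using that \<tau>_nonneg by simp
    have iq: "integrable std_uniform (\<lambda>a. c (y * a) (y * a))" by (rule integrable_uniform_q[OF y])
    have q: "integrable uniform_pair (\<lambda>p. c (y * fst p) (y * fst p))" "integrable uniform_pair (\<lambda>p. c (y * snd p) (y * snd p))"
      using integrable_uniform_pair_fst[OF iq] integrable_uniform_pair_snd[OF iq] by auto
    have AE1: "AE p in uniform_pair. 0 \<le> y * fst p \<and> 0 \<le> y * fst p"
      and AE2: "AE p in uniform_pair. 0 \<le> y * snd p \<and> 0 \<le> y * snd p"
      using AE_scaled_nonneg[OF y] by auto
    note 1 = sampled_product[of "\<lambda>p. y * fst p" "\<lambda>p. y * fst p", OF _ _ AE1 q(1) q(1)]
    note 2 = sampled_product[of "\<lambda>p. y * snd p" "\<lambda>p. y * snd p", OF _ _ AE2 q(2) q(2)]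
    note 3 = sampled_product[of "\<lambda>p. y * fst p" "\<lambda>p. y * snd p", OF _ _ AE_scaled_nonneg[OF y] q]
    have dist: "(\<lambda>z. case z of (p, \<omega>) \<Rightarrow> ?h (Xt \<omega> \<tau>, Xt \<omega> (y * fst p) + Xt \<omega> (y * snd p))) =
       (\<lambda>z. (case z of (p, \<omega>) \<Rightarrow> Xt \<omega> (y * fst p) * Xt \<omega> (y * fst p)) + (case z of (p, \<omega>) \<Rightarrow> Xt \<omega> (y * snd p) * Xt \<omega> (y * snd p))
         + 2 * (case z of (p, \<omega>) \<Rightarrow> Xt \<omega> (y * fst p) * Xt \<omega> (y * snd p)))"
      by (auto simp: fun_eq_iff power2_eq_square algebra_simps)
    have "(\<integral>z. (case z of (p, \<omega>) \<Rightarrow> ?h (Xt \<omega> \<tau>, Xt \<omega> (y * fst p) + Xt \<omega> (y * snd p))) \<partial>(uniform_pair \<Otimes>\<^sub>M M)) =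
       (\<integral>p. c (y * fst p) (y * fst p) \<partial>uniform_pair) + (\<integral>p. c (y * snd p) (y * snd p) \<partial>uniform_pair)
       + 2 * (\<integral>p. c (y * fst p) (y * snd p) \<partial>uniform_pair)"
      unfolding dist using 1 2 3 by (subst Bochner_Integration.integral_add; simp?)+
    also have "\<dots> = 2 * (\<integral>a. c (y * a) (y * a) \<partial>std_uniform) + 2 * (\<integral>p. c (y * fst p) (y * snd p) \<partial>uniform_pair)"
      using integral_uniform_pair_fst[OF iq] integral_uniform_pair_snd[OF iq] by simp
    also have "(\<integral>a. c (y * a) (y * a) \<partial>std_uniform) = R y / y"
      using y by (subst integral_std_uniform_scale[of y "\<lambda>u. c u u"]) (auto simp: R_def)
    also have "(\<integral>p. c (y * fst p) (y * snd p) \<partial>uniform_pair) = Qt y / y / y"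
      by (rule pair_average[OF y 3(2)]) auto
    finally show ?thesis using y by (simp add: power2_eq_square)
  qed
  have le: "\<bar>?h (a, b)\<bar> \<le> a\<^sup>2 + b\<^sup>2" for a b :: real by simp
  have h: "?h \<in> borel_measurable (borel \<Otimes>\<^sub>M borel)" by measurable
  note r = relaxation_of_moment[OF h le \<tau>_nonneg order_refl order_refl order \<Phi>]
  show "set_integrable lborel {\<tau><..t} (\<lambda>y. exp (- (t - y)) * (2 / y * R y + 2 / y\<^sup>2 * Qt y))"
    using r(1) .
  show "c t t = exp (- (t - \<tau>)) * c \<tau> \<tau> + (LBINT y:{\<tau><..t}. exp (- (t - y)) * (2 / y * R y + 2 / y\<^sup>2 * Qt y))"
    using r(2) by (simp add: c_same)
qed

text \<open>
  A bound down to \<open>y = \<tau>\<close>, which is not immediate when \<open>\<tau> = 0\<close>. It dominates the kernel \<open>2 G u y / y\<close>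
  in the Fubini argument for \<open>H\<close>.
\<close>

lemma R_mean_bounded: "\<exists>K\<ge>0. \<forall>y. \<tau> < y \<and> y \<le> t \<longrightarrow> R y / y \<le> K"
proof -
  obtain R0 where R0: "(\<integral>\<^sup>+u. qn u * indicator {0..\<tau>} u \<partial>lborel) = ennreal R0" "0 \<le> R0" "\<tau> = 0 \<longrightarrow> R0 = 0"
    using qn_initial_mass by blast
  obtain C where C: "0 \<le> C" "\<And>t. \<tau> \<le> t \<Longrightarrow> qn t \<le> ennreal (C * exp (7 * t))" using qn_bound by blast
  have "R y / y \<le> R0 / \<tau> + C * exp (7 * t)" if y: "\<tau> < y" "y \<le> t" for y
  proof -
    have pos: "0 < y" using y \<tau>_nonneg by simp
    have nonneg: "0 \<le> R0 / y + C * exp (7 * y)" using pos R0 C by simp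
    have "ennreal (R y / y) = ennreal (\<integral>a. c (y * a) (y * a) \<partial>std_uniform)"
      using pos by (subst integral_std_uniform_scale[of y "\<lambda>u. c u u"]) (auto simp: R_def)
    also have "\<dots> = (\<integral>\<^sup>+a. ennreal (c (y * a) (y * a)) \<partial>std_uniform)"
      by (rule nn_integral_eq_integral[symmetric]) (auto intro: integrable_uniform_q pos simp: c_same_nonneg)
    also have "\<dots> = (\<integral>\<^sup>+a. qn (y * a) \<partial>std_uniform)"
    proof (rule nn_integral_cong_AE)
      have "AE a in std_uniform. 0 \<le> a" by (rule AE_uniform_measureI) auto
      then show "AE a in std_uniform. ennreal (c (y * a) (y * a)) = qn (y * a)"
        by eventually_elim (use pos in \<open>simp add: qn_eq\<close>)
    qed
    also have "\<dots> \<le> ennreal (R0 / y + C * exp (7 * y))"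
      using C y R0 by (intro uniform_mean_bound) auto
    finally have "R y / y \<le> R0 / y + C * exp (7 * y)"
      using nonneg by simp
    also have "R0 / y \<le> R0 / \<tau>"
      using y R0 \<tau>_nonneg by (cases "\<tau> = 0") (auto intro!: divide_left_mono)
    also have "C * exp (7 * y) \<le> C * exp (7 * t)"
      using C y by (intro mult_left_mono) auto
    finally show ?thesis by simp
  qed
  then show ?thesis using R0 C \<tau>_nonneg by (intro exI[of _ "R0 / \<tau> + C * exp (7 * t)"]) auto
qed

lemma set_integrable_c:
  assumes "0 \<le> s"
  shows "set_integrable lborel {0..t} (\<lambda>u. c s u)"
  unfolding set_integrable_def
proof (rule Bochner_Integration.integrable_bound)
  show "integrable lborel (\<lambda>u. indicator {0..t} u * c s s + indicator {0..t} u * c u u)"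
    using set_integrable_q[of t] by (simp add: set_integrable_def)
  have "norm (indicator {0..t} u *\<^sub>R c s u) \<le> norm (indicator {0..t} u * c s s + indicator {0..t} u * c u u)" for u
    using abs_c_le[OF assms, of u] c_same_nonneg[of s] c_same_nonneg[of u]
    by (auto simp: abs_of_nonneg split: split_indicator)
  then show "AE u in lborel. norm (indicator {0..t} u *\<^sub>R c s u) \<le> norm (indicator {0..t} u * c s s + indicator {0..t} u * c u u)"
    by simp
qed measurable

lemma abs_G_le:
  assumes "0 \<le> s" "0 \<le> y"
  shows "\<bar>G s y\<bar> \<le> y * c s s + R y"
proof -
  have "\<bar>G s y\<bar> \<le> (LBINT u:{0..y}. \<bar>c s u\<bar>)"
    unfolding G_def set_lebesgue_integral_def
    by (rule order_trans[OF integral_abs_bound]) (simp add: abs_mult)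
  also have "\<dots> \<le> (LBINT u:{0..y}. c s s + c u u)"
  proof (rule set_integral_mono)
    show "set_integrable lborel {0..y} (\<lambda>u. \<bar>c s u\<bar>)"
      using set_integrable_c[OF \<open>0 \<le> s\<close>] by (rule set_integrable_abs)
    show "set_integrable lborel {0..y} (\<lambda>u. c s s + c u u)"
      by (intro set_integral_add set_integrable_const_Icc set_integrable_q)
    fix u assume "u \<in> {0..y}"
    then show "\<bar>c s u\<bar> \<le> c s s + c u u"
      using abs_c_le[OF \<open>0 \<le> s\<close>, of u] c_same_nonneg[of s] c_same_nonneg[of u] by simp
  qed
  also have "\<dots> = y * c s s + R y"
    using set_integrable_q \<open>0 \<le> y\<close> unfolding R_def
    by (subst set_integral_add) (auto simp: set_lebesgue_integral_def set_integrable_const_Icc)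
  finally show ?thesis .
qed

text \<open>
  Half of the derivative of \<open>Q\<close>: the two boundary integrals that form \<open>Q'\<close> agree by symmetry.
\<close>

definition H :: "real \<Rightarrow> real" where
  "H t = G t t"

lemma H_eq: "H t = (LBINT u:{0..t}. c u t)"
  unfolding H_def G_def by (subst c_commute) simp

lemma H_measurable [measurable]: "H \<in> borel_measurable borel"
  unfolding H_def by measurable

text \<open>
  The equation for \<open>c(u, t)\<close> is integrated over \<open>u\<close>. It starts at \<open>max u \<tau>\<close>: the part \<open>u \<le> \<tau>\<close> yields the
  initial value, the part \<open>u > \<tau>\<close> the source \<open>q\<close>, and interchanging the integrals turns \<open>G u y\<close> into
  \<open>Q y\<close>.
\<close>

lemma H_relax:
  assumes order: "\<tau> \<le> t"
  shows "set_integrable lborel {\<tau><..t} (\<lambda>y. exp (- (t - y)) * (c y y + 2 / y * Qt y))"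
    and "H t = exp (- (t - \<tau>)) * H \<tau> + (LBINT y:{\<tau><..t}. exp (- (t - y)) * (c y y + 2 / y * Qt y))"
proof -
  obtain K where K: "0 \<le> K" "\<And>y. \<tau> < y \<Longrightarrow> y \<le> t \<Longrightarrow> R y / y \<le> K" using R_mean_bounded by blast
  define k where "k = (\<lambda>(u, y). if 0 \<le> u \<and> u < y \<and> \<tau> < y \<and> y \<le> t then exp (- (t - y)) * (2 / y * G u y) else 0)"
  have k_measurable [measurable]: "k \<in> borel_measurable (lborel \<Otimes>\<^sub>M lborel)"
    unfolding k_def by measurable
  have k_int: "integrable (lborel \<Otimes>\<^sub>M lborel) k"
  proof (rule Bochner_Integration.integrable_bound)
    show "integrable (lborel \<Otimes>\<^sub>M lborel) (\<lambda>(u, y). (indicator {0..t} u * (2 * c u u + 2 * K)) * indicator {\<tau>..t} y)"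
      using set_integrable_q[of t]
      by (intro integrable_product) (auto simp: set_integrable_def distrib_left mult.left_commute[of _ 2] mult.assoc intro!: Bochner_Integration.integrable_add)
    have "\<bar>k (u, y)\<bar> \<le> (indicator {0..t} u * (2 * c u u + 2 * K)) * indicator {\<tau>..t} y" for u y
    proof (cases "0 \<le> u \<and> u < y \<and> \<tau> < y \<and> y \<le> t")
      case True
      then have y: "0 < y" by simp
      have "\<bar>2 / y * G u y\<bar> = 2 * \<bar>G u y\<bar> / y" using y by (simp add: abs_mult)
      also have "\<dots> \<le> 2 * (y * c u u + R y) / y"
        using y True abs_G_le[of u y] by (intro divide_right_mono mult_left_mono) auto
      also have "\<dots> = 2 * c u u + 2 * (R y / y)" using y by (simp add: field_simps)
      also have "\<dots> \<le> 2 * c u u + 2 * K" using K(2)[of y] True by simp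
      finally have le: "\<bar>2 / y * G u y\<bar> \<le> 2 * c u u + 2 * K" .
      have "\<bar>exp (- (t - y)) * (2 / y * G u y)\<bar> = exp (- (t - y)) * \<bar>2 / y * G u y\<bar>"
        by (simp add: abs_mult)
      also have "\<dots> \<le> 1 * (2 * c u u + 2 * K)"
        using le True by (intro mult_mono) auto
      finally show ?thesis using True by (simp add: k_def)
    next
      case False
      then show ?thesis using K c_same_nonneg[of u] by (auto simp: k_def split: split_indicator)
    qed
    then show "AE z in lborel \<Otimes>\<^sub>M lborel. norm (k z) \<le>
        norm (case z of (u, y) \<Rightarrow> (indicator {0..t} u * (2 * c u u + 2 * K)) * indicator {\<tau>..t} y)"
      by (intro AE_I2) (auto intro: order_trans[OF _ abs_ge_self])
  qed measurable
  have k_u: "(\<integral>y. k (u, y) \<partial>lborel) = (LBINT y:{max u \<tau><..t}. exp (- (t - y)) * (2 / y * G u y))" if "0 \<le> u" for u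
    unfolding set_lebesgue_integral_def k_def using that
    by (intro Bochner_Integration.integral_cong) (auto split: split_indicator)
  have k_y: "(\<integral>u. k (u, y) \<partial>lborel) = indicator {\<tau><..t} y *\<^sub>R (exp (- (t - y)) * (2 / y * Qt y))" for y
  proof (cases "\<tau> < y \<and> y \<le> t")
    case True
    have "(\<integral>u. k (u, y) \<partial>lborel) = (\<integral>u. exp (- (t - y)) * (2 / y) * (indicator {0..y} u *\<^sub>R G u y) \<partial>lborel)"
      by (rule integral_cong_AE) (use True in \<open>auto simp: k_def split: split_indicator intro!: AE_I[where N = "{y}"]\<close>)
    also have "\<dots> = exp (- (t - y)) * (2 / y) * Qt y"
      unfolding Qt_eq set_lebesgue_integral_def by (rule integral_mult_right_zero)
    finally show ?thesis using True by simp
  qed (auto simp: k_def)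
  have int_k_u: "integrable lborel (\<lambda>u. \<integral>y. k (u, y) \<partial>lborel)"
    by (rule lborel_pair.integrable_fst'[OF k_int])
  have swap: "(\<integral>u. (\<integral>y. k (u, y) \<partial>lborel) \<partial>lborel) = (\<integral>y. (\<integral>u. k (u, y) \<partial>lborel) \<partial>lborel)"
    using lborel_pair.Fubini_integral[of "\<lambda>u y. k (u, y)"] k_int by simp
  have int_k_y: "integrable lborel (\<lambda>y. \<integral>u. k (u, y) \<partial>lborel)"
    using lborel_pair.integrable_snd[of "\<lambda>u y. k (u, y)"] k_int by simp
  let ?e1 = "\<lambda>u. indicator {0..\<tau>} u *\<^sub>R (exp (- (t - \<tau>)) * c u \<tau>)"
  let ?e2 = "\<lambda>u. indicator {\<tau><..t} u *\<^sub>R (exp (- (t - u)) * c u u)"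
  have int_e1: "integrable lborel ?e1"
  proof -
    have "set_integrable lborel {0..\<tau>} (\<lambda>u. exp (- (t - \<tau>)) * c \<tau> u)"
      using set_integrable_c[OF \<tau>_nonneg] by (intro set_integrable_mult_right) auto
    then show ?thesis unfolding set_integrable_def by (subst c_commute)
  qed
  have int_e2: "integrable lborel ?e2"
  proof (rule Bochner_Integration.integrable_bound)
    show "integrable lborel (\<lambda>u. indicator {0..t} u *\<^sub>R c u u)"
      using set_integrable_q[of t] by (simp add: set_integrable_def)
    have "norm (?e2 u) \<le> norm (indicator {0..t} u *\<^sub>R c u u)" for u
      using \<tau>_nonneg by (auto simp: abs_mult c_same_nonneg mult_left_le_one_le split: split_indicator)
    then show "AE u in lborel. norm (?e2 u) \<le> norm (indicator {0..t} u *\<^sub>R c u u)" by simp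
  qed measurable
  have decomp: "indicator {0..t} u *\<^sub>R c u t = ?e1 u + ?e2 u + (\<integral>y. k (u, y) \<partial>lborel)" for u
  proof (cases "0 \<le> u \<and> u \<le> t")
    case True
    show ?thesis
    proof (cases "u \<le> \<tau>")
      case True': True
      then show ?thesis using True order c_relax(2)[of u \<tau> t] by (simp add: k_u max_absorb2)
    next
      case False
      then show ?thesis using True order c_relax(2)[of u u t] by (simp add: k_u max_absorb1)
    qed
  next
    case False
    then have "k (u, y) = 0" for y by (auto simp: k_def)
    then show ?thesis using False order \<tau>_nonneg by (auto split: split_indicator)
  qed
  have int_y2: "set_integrable lborel {\<tau><..t} (\<lambda>y. exp (- (t - y)) * (2 / y * Qt y))"
    using int_k_y unfolding k_y set_integrable_def .
  have int_y1: "set_integrable lborel {\<tau><..t} (\<lambda>y. exp (- (t - y)) * c y y)"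
    using int_e2 unfolding set_integrable_def .
  show "set_integrable lborel {\<tau><..t} (\<lambda>y. exp (- (t - y)) * (c y y + 2 / y * Qt y))"
    using set_integral_add(1)[OF int_y1 int_y2] by (simp add: distrib_left)
  have "H t = (\<integral>u. ?e1 u + ?e2 u + (\<integral>y. k (u, y) \<partial>lborel) \<partial>lborel)"
    unfolding H_eq set_lebesgue_integral_def decomp ..
  also have "\<dots> = (\<integral>u. ?e1 u \<partial>lborel) + (\<integral>u. ?e2 u \<partial>lborel) + (\<integral>u. (\<integral>y. k (u, y) \<partial>lborel) \<partial>lborel)"
    by (subst Bochner_Integration.integral_add; (subst Bochner_Integration.integral_add)?)
       (intro Bochner_Integration.integrable_add int_e1 int_e2 int_k_u refl)+
  also have "(\<integral>u. ?e1 u \<partial>lborel) = exp (- (t - \<tau>)) * H \<tau>"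
  proof -
    have "(\<integral>u. ?e1 u \<partial>lborel) = (\<integral>u. exp (- (t - \<tau>)) * (indicator {0..\<tau>} u *\<^sub>R c u \<tau>) \<partial>lborel)"
      by (intro Bochner_Integration.integral_cong) auto
    then show ?thesis unfolding H_eq set_lebesgue_integral_def by (simp only: integral_mult_right_zero)
  qed
  also have "(\<integral>u. (\<integral>y. k (u, y) \<partial>lborel) \<partial>lborel) = (LBINT y:{\<tau><..t}. exp (- (t - y)) * (2 / y * Qt y))"
    unfolding swap k_y set_lebesgue_integral_def ..
  finally show "H t = exp (- (t - \<tau>)) * H \<tau> + (LBINT y:{\<tau><..t}. exp (- (t - y)) * (c y y + 2 / y * Qt y))"
    using set_integral_add(2)[OF int_y1 int_y2] by (simp add: distrib_left set_lebesgue_integral_def)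
qed

text \<open>
  The square \<open>[0, t]\<^sup>2\<close> exceeds \<open>[0, \<tau>]\<^sup>2\<close> by two regions that are mirror images of each other,
  according to which coordinate is larger; each is swept out by segments of mass \<open>H y\<close>.
\<close>

lemma Qt_increment:
  assumes "\<tau> \<le> t"
  shows "set_integrable lborel {\<tau><..t} H" and "Qt t = Qt \<tau> + 2 * (LBINT y:{\<tau><..t}. H y)"
proof -
  let ?P = "lborel \<Otimes>\<^sub>M lborel :: (real \<times> real) measure"
  have box: "integrable ?P (\<lambda>(u, v). if u \<in> {0..t} \<and> v \<in> {0..t} then c u v else 0)"
  proof (rule Bochner_Integration.integrable_bound)
    let ?d = "\<lambda>(u, v). indicator {0..t} u * c u u * indicator {0..t} v + indicator {0..t} u * (indicator {0..t} v * c v v)"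
    have "integrable ?P (\<lambda>z. (\<lambda>(u, v). indicator {0..t} u * c u u * indicator {0..t} v) z +
        (\<lambda>(u, v). indicator {0..t} u * (indicator {0..t} v * c v v)) z)"
      using set_integrable_q[of t]
      by (intro Bochner_Integration.integrable_add integrable_product) (auto simp: set_integrable_def)
    then show "integrable ?P ?d" by (simp add: split_beta')
    have "\<bar>if u \<in> {0..t} \<and> v \<in> {0..t} then c u v else 0\<bar> \<le> ?d (u, v)" for u v
      using abs_c_le[of u v] c_same_nonneg[of u] c_same_nonneg[of v] by (auto split: split_indicator)
    then show "AE z in ?P. norm (case z of (u, v) \<Rightarrow> if u \<in> {0..t} \<and> v \<in> {0..t} then c u v else 0) \<le> norm (?d z)"
      by (intro AE_I2) (auto intro: order_trans[OF _ abs_ge_self])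
  qed measurable
  define f1 where "f1 = (\<lambda>(u, v). if u \<in> {0..\<tau>} \<and> v \<in> {0..\<tau>} then c u v else 0)"
  define f2 where "f2 = (\<lambda>(u, v). if u \<in> {0..v} \<and> v \<in> {\<tau><..t} then c u v else 0)"
  define f3 where "f3 = (\<lambda>(u, v). if v \<in> {0..<u} \<and> u \<in> {\<tau><..t} then c u v else 0)"
  have [measurable]: "f1 \<in> borel_measurable ?P" "f2 \<in> borel_measurable ?P" "f3 \<in> borel_measurable ?P"
    unfolding f1_def f2_def f3_def atLeastAtMost_iff greaterThanAtMost_iff atLeastLessThan_iff by measurable
  have dom: "integrable ?P f" if [measurable]: "f \<in> borel_measurable ?P"
    and le: "\<And>u v. f (u, v) \<noteq> 0 \<Longrightarrow> f (u, v) = c u v \<and> u \<in> {0..t} \<and> v \<in> {0..t}" for f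
  proof (rule Bochner_Integration.integrable_bound[OF box])
    show "AE z in ?P. norm (f z) \<le> norm (case z of (u, v) \<Rightarrow> if u \<in> {0..t} \<and> v \<in> {0..t} then c u v else 0)"
    proof (rule AE_I2)
      fix z :: "real \<times> real"
      obtain u v where z: "z = (u, v)" by (cases z)
      show "norm (f z) \<le> norm (case z of (u, v) \<Rightarrow> if u \<in> {0..t} \<and> v \<in> {0..t} then c u v else 0)"
        unfolding z using le[of u v] by (cases "f (u, v) = 0") auto
    qed
  qed measurable
  have int: "integrable ?P f1" "integrable ?P f2" "integrable ?P f3"
    using assms \<tau>_nonneg by (intro dom; auto simp: f1_def f2_def f3_def split: if_splits)+
  have f2_v: "(\<integral>u. f2 (u, v) \<partial>lborel) = indicator {\<tau><..t} v *\<^sub>R H v" for v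
    unfolding H_eq set_lebesgue_integral_def
    by (cases "v \<in> {\<tau><..t}") (auto simp: f2_def intro!: Bochner_Integration.integral_cong)
  have f3_u: "(\<integral>v. f3 (u, v) \<partial>lborel) = indicator {\<tau><..t} u *\<^sub>R H u" for u
  proof (cases "u \<in> {\<tau><..t}")
    case True
    have "(\<integral>v. f3 (u, v) \<partial>lborel) = (\<integral>v. indicator {0..u} v *\<^sub>R c u v \<partial>lborel)"
      by (rule integral_cong_AE) (use True in \<open>auto simp: f3_def split: split_indicator intro!: AE_I[where N = "{u}"]\<close>)
    then show ?thesis using True by (simp add: H_def G_def set_lebesgue_integral_def)
  qed (auto simp: f3_def)
  show H_int: "set_integrable lborel {\<tau><..t} H"
    using lborel_pair.integrable_fst'[OF int(3)] unfolding f3_u set_integrable_def .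
  have iter: "(\<integral>v. (\<integral>u. f (u, v) \<partial>lborel) \<partial>lborel) = (\<integral>z. f z \<partial>?P)" if "integrable ?P f" for f :: "real \<times> real \<Rightarrow> real"
    using lborel_pair.integral_snd[of "\<lambda>u v. f (u, v)"] that by simp
  have "Qt t = (\<integral>v. (\<integral>u. (if u \<in> {0..t} \<and> v \<in> {0..t} then c u v else 0) \<partial>lborel) \<partial>lborel)"
    unfolding Qt_def set_lebesgue_integral_def
    by (intro Bochner_Integration.integral_cong refl) (auto intro!: Bochner_Integration.integral_cong split: split_indicator)
  also have "\<dots> = (\<integral>z. (case z of (u, v) \<Rightarrow> if u \<in> {0..t} \<and> v \<in> {0..t} then c u v else 0) \<partial>?P)"
    using iter[OF box] by simp
  also have "\<dots> = (\<integral>z. f1 z + f2 z + f3 z \<partial>?P)"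
    using assms \<tau>_nonneg by (intro Bochner_Integration.integral_cong) (auto simp: f1_def f2_def f3_def)
  also have "\<dots> = (\<integral>z. f1 z \<partial>?P) + (\<integral>z. f2 z \<partial>?P) + (\<integral>z. f3 z \<partial>?P)"
    using int by simp
  also have "(\<integral>z. f1 z \<partial>?P) = Qt \<tau>"
    unfolding iter[OF int(1), symmetric] unfolding Qt_def set_lebesgue_integral_def f1_def
    by (intro Bochner_Integration.integral_cong refl) (auto intro!: Bochner_Integration.integral_cong split: split_indicator)
  also have "(\<integral>z. f2 z \<partial>?P) = (LBINT y:{\<tau><..t}. H y)"
    unfolding iter[OF int(2), symmetric] f2_v set_lebesgue_integral_def ..
  also have "(\<integral>z. f3 z \<partial>?P) = (LBINT y:{\<tau><..t}. H y)"
    unfolding lborel_pair.integral_fst'[OF int(3), symmetric] f3_u set_lebesgue_integral_def ..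
  finally show "Qt t = Qt \<tau> + 2 * (LBINT y:{\<tau><..t}. H y)" by simp
qed

end

section \<open>Relaxation equations and the Wronskian\<close>

lemma LBINT_Ioc_eq_integral:
  fixes g :: "real \<Rightarrow> real"
  assumes "set_integrable lborel {a<..b} g"
  shows "g integrable_on {a..b}" and "(LBINT y:{a<..b}. g y) = integral {a..b} g"
proof -
  have neg: "negligible ({a..b} - {a<..b})"
    by (rule negligible_subset[of "{a}"]) auto
  have neg': "negligible ({a<..b} - {a..b})"
    by (rule negligible_subset[of "{}"]) auto
  show "g integrable_on {a..b}"
    using set_borel_integral_eq_integral(1)[OF assms]
    by (rule integrable_spike_set) (auto intro: negligible_subset[OF neg])
  show "(LBINT y:{a<..b}. g y) = integral {a..b} g"
    unfolding set_borel_integral_eq_integral(2)[OF assms]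
    by (rule integral_spike_set) (auto intro: negligible_subset[OF neg])
qed

lemma LBINT_Icc_eq_integral:
  fixes g :: "real \<Rightarrow> real"
  assumes "set_integrable lborel {a..b} g"
  shows "g integrable_on {a..b}" and "(LBINT y:{a..b}. g y) = integral {a..b} g"
  using set_borel_integral_eq_integral[OF assms] by auto

lemma continuous_on_indefinite_integral:
  fixes g :: "real \<Rightarrow> real"
  assumes "\<And>t. a \<le> t \<Longrightarrow> g integrable_on {a..t}"
  shows "continuous_on {a..} (\<lambda>t. integral {a..t} g)"
  unfolding continuous_on_eq_continuous_within
proof
  fix t assume "t \<in> {a..}"
  then have t: "a \<le> t" by simp
  have "continuous_on {a..t + 1} (\<lambda>t. integral {a..t} g)"
    using t by (intro indefinite_integral_continuous_1) (simp add: assms)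
  then have "continuous (at t within {a..t + 1}) (\<lambda>t. integral {a..t} g)"
    using t by (simp add: continuous_on_eq_continuous_within)
  moreover have "at t within {a..t + 1} = at t within {a..}"
    by (rule at_within_nhd[of t "{..<t + 1}"]) auto
  ultimately show "continuous (at t within {a..}) (\<lambda>t. integral {a..t} g)" by simp
qed

lemma indefinite_integral_deriv:
  fixes g :: "real \<Rightarrow> real"
  assumes "\<And>t. a \<le> t \<Longrightarrow> g integrable_on {a..t}" and "a < t" and "isCont g t"
  shows "((\<lambda>t. integral {a..t} g) has_real_derivative g t) (at t)"
proof -
  have "continuous (at t within {a..t + 1}) g"
    using assms(3) by (rule continuous_at_imp_continuous_at_within)
  then have c: "continuous (at t within ({a..t + 1} - {})) g"
    by (simp only: Diff_empty)
  have i: "g integrable_on {a..t + 1}" and m: "t \<in> {a..t + 1} - {}"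
    using assms(1)[of "t + 1"] assms(2) by auto
  have d: "((\<lambda>u. integral {a..u} g) has_vector_derivative g t) (at t within {a..t + 1})"
    using integral_has_vector_derivative_continuous_at[OF i m finite.emptyI c] by (simp only: Diff_empty)
  have "t \<in> interior {a..t + 1}"
    using assms(2) by (simp add: interior_atLeastAtMost_real)
  then have "at t within {a..t + 1} = at t"
    by (rule at_within_interior)
  with d show ?thesis by (simp only: has_real_derivative_iff_has_vector_derivative)
qed

text \<open>
  The integral equation is \<open>\<phi>' = f - \<phi>\<close> in integrated form: multiplied by \<open>e\<^sup>t\<close> it says that \<open>e\<^sup>t \<phi> t\<close> is an
  indefinite integral of \<open>e\<^sup>y f y\<close>. For \<open>\<sigma> = 0\<close> the function \<open>f\<close> may contain a factor \<open>1 / y\<close>,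
  hence the half-open interval and the restriction of the differential equation to \<open>t > \<sigma>\<close>.
\<close>

lemma variation_of_constants:
  fixes \<phi> f :: "real \<Rightarrow> real"
  assumes int: "\<And>t. \<sigma> \<le> t \<Longrightarrow> set_integrable lborel {\<sigma><..t} (\<lambda>y. exp (- (t - y)) * f y)"
    and eq: "\<And>t. \<sigma> \<le> t \<Longrightarrow> \<phi> t = exp (- (t - \<sigma>)) * \<phi> \<sigma> + (LBINT y:{\<sigma><..t}. exp (- (t - y)) * f y)"
  shows relaxation_continuous: "continuous_on {\<sigma>..} \<phi>"
    and relaxation_deriv: "\<And>t. \<sigma> < t \<Longrightarrow> isCont f t \<Longrightarrow> (\<phi> has_real_derivative f t - \<phi> t) (at t)"
proof -
  have shift: "exp t * (exp (- (t - y)) * f y) = exp y * f y" for t y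
    by (simp add: mult.assoc[symmetric] mult_exp_exp)
  have shift': "exp (- (t - y)) * f y = exp (- t) * (exp y * f y)" for t y
    by (simp add: mult.assoc[symmetric] mult_exp_exp)
  let ?g = "\<lambda>y. exp y * f y"
  have int': "set_integrable lborel {\<sigma><..t} ?g" if "\<sigma> \<le> t" for t
  proof -
    have "set_integrable lborel {\<sigma><..t} (\<lambda>y. exp t * (exp (- (t - y)) * f y))"
      using int[OF that] by (rule set_integrable_mult_right)
    then show ?thesis unfolding shift .
  qed
  note HK = LBINT_Ioc_eq_integral[OF int']
  have eq': "\<phi> t = exp (- t) * (exp \<sigma> * \<phi> \<sigma> + integral {\<sigma>..t} ?g)" if "\<sigma> \<le> t" for t
  proof -
    have "(LBINT y:{\<sigma><..t}. exp (- (t - y)) * f y) = exp (- t) * (LBINT y:{\<sigma><..t}. ?g y)"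
      unfolding shift' by (rule set_integral_mult_right)
    moreover have "exp (- (t - \<sigma>)) = exp (- t) * exp \<sigma>" by (simp add: mult_exp_exp)
    ultimately show ?thesis
      using eq[OF that] HK(2)[OF that] by (simp only: distrib_left mult.assoc)
  qed
  have "continuous_on {\<sigma>..} (\<lambda>t. exp (- t) * (exp \<sigma> * \<phi> \<sigma> + integral {\<sigma>..t} ?g))"
    by (intro continuous_intros continuous_on_indefinite_integral HK(1))
  then show "continuous_on {\<sigma>..} \<phi>"
    by (rule continuous_on_eq) (simp only: eq'[symmetric] atLeast_iff)
  fix t assume t: "\<sigma> < t" "isCont f t"
  have "isCont ?g t" using t(2) by (intro continuous_intros)
  have I: "((\<lambda>t. integral {\<sigma>..t} ?g) has_real_derivative exp t * f t) (at t)"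
    by (rule indefinite_integral_deriv[OF HK(1) t(1) \<open>isCont ?g t\<close>])
  have E: "((\<lambda>t. exp (- t)) has_real_derivative - exp (- t)) (at t)"
    by (auto intro!: derivative_eq_intros)
  have d: "((\<lambda>t. exp (- t) * (exp \<sigma> * \<phi> \<sigma> + integral {\<sigma>..t} ?g)) has_real_derivative
      - exp (- t) * (exp \<sigma> * \<phi> \<sigma> + integral {\<sigma>..t} ?g) + (0 + exp t * f t) * exp (- t)) (at t)"
    by (rule DERIV_mult[OF E DERIV_add[OF DERIV_const I]])
  have "- exp (- t) * (exp \<sigma> * \<phi> \<sigma> + integral {\<sigma>..t} ?g) = - \<phi> t"
    using t(1) eq'[of t] by simp
  moreover have "(0 + exp t * f t) * exp (- t) = f t"
    by (simp add: exp_minus)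
  ultimately have "- exp (- t) * (exp \<sigma> * \<phi> \<sigma> + integral {\<sigma>..t} ?g) + (0 + exp t * f t) * exp (- t) = f t - \<phi> t"
    by linarith
  with d have "((\<lambda>t. exp (- t) * (exp \<sigma> * \<phi> \<sigma> + integral {\<sigma>..t} ?g)) has_real_derivative f t - \<phi> t) (at t)"
    by (simp only:)
  then show "(\<phi> has_real_derivative f t - \<phi> t) (at t)"
  proof (rule has_field_derivative_transform_within_open[where S = "{\<sigma><..}"])
    show "exp (- r) * (exp \<sigma> * \<phi> \<sigma> + integral {\<sigma>..r} ?g) = \<phi> r" if "r \<in> {\<sigma><..}" for r
      using that by (intro eq'[symmetric]) simp
  qed (use t in auto)
qed

text \<open>
  \<open>W\<close> is the Wronskian of \<open>\<Gamma>\<close> and the polynomial solution \<open>t (2 + t)\<close> of \<open>\<Gamma>'' + \<Gamma>' = 2 \<Gamma> / t\<close>. The equation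
  has unit friction, so \<open>W\<close> decays like \<open>e\<^sup>-\<^sup>t\<close>, and by the quotient rule it drives \<open>\<gamma> t / (1 + t)\<close>.
\<close>

lemma solution_formula:
  fixes \<gamma> \<Gamma> :: "real \<Rightarrow> real"
  assumes "0 \<le> s" "s < t"
    and \<gamma>_cont: "continuous_on {s..} \<gamma>" and \<Gamma>_cont: "continuous_on {s..} \<Gamma>"
    and \<gamma>_deriv: "\<And>t. s < t \<Longrightarrow> (\<gamma> has_real_derivative 2 / t * \<Gamma> t - \<gamma> t) (at t)"
    and \<Gamma>_deriv: "\<And>t. s < t \<Longrightarrow> (\<Gamma> has_real_derivative \<gamma> t) (at t)"
    and zero: "s = 0 \<Longrightarrow> \<Gamma> 0 = 0"
  shows "\<gamma> t = (1 + t) * (\<gamma> s / (1 + s) + exp s * ((1 + s) * (2 * \<Gamma> s) - (2 + s) * s * \<gamma> s) *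
      (LBINT y:{s..t}. exp (- y) / (y * (1 + y)\<^sup>2)))"
proof -
  define W where "W t = t * (2 + t) * \<gamma> t - 2 * (1 + t) * \<Gamma> t" for t
  have W_eq: "exp r * W r = exp s * W s" if "s < r" for r
  proof (rule DERIV_isconst_end[where f = "\<lambda>r. exp r * W r"])
    show "s < r" by fact
    have "continuous_on {s..r} \<gamma>" "continuous_on {s..r} \<Gamma>"
      using \<gamma>_cont \<Gamma>_cont by (auto intro: continuous_on_subset)
    then show "continuous_on {s..r} (\<lambda>r. exp r * W r)"
      unfolding W_def by (intro continuous_intros)
    fix y assume y: "s < y" "y < r"
    then have "y \<noteq> 0" using \<open>0 \<le> s\<close> by simp
    have "((\<lambda>r. exp r * W r) has_real_derivative exp y * W y + exp y * ((2 + 2 * y) * \<gamma> y +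
        y * (2 + y) * (2 / y * \<Gamma> y - \<gamma> y) - (2 * \<Gamma> y + 2 * (1 + y) * \<gamma> y))) (at y)"
      unfolding W_def
      using \<open>y \<noteq> 0\<close> by (auto intro!: derivative_eq_intros \<gamma>_deriv \<Gamma>_deriv y simp: algebra_simps)
    moreover have "exp y * W y + exp y * ((2 + 2 * y) * \<gamma> y +
        y * (2 + y) * (2 / y * \<Gamma> y - \<gamma> y) - (2 * \<Gamma> y + 2 * (1 + y) * \<gamma> y)) = 0"
      using \<open>y \<noteq> 0\<close> by (simp add: W_def field_simps)
    ultimately show "((\<lambda>r. exp r * W r) has_real_derivative 0) (at y)" by simp
  qed
  have W_val: "W r = exp s * W s * exp (- r)" if "s < r" for r
    using W_eq[OF that] by (simp add: exp_minus field_simps)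
  let ?\<rho> = "\<lambda>t. \<gamma> t / (1 + t)"
  have \<rho>_cont: "continuous_on {s..t} ?\<rho>"
    using \<open>0 \<le> s\<close> by (intro continuous_intros continuous_on_subset[OF \<gamma>_cont]) auto
  have \<rho>_deriv: "(?\<rho> has_real_derivative - (exp s * W s) * (exp (- y) / (y * (1 + y)\<^sup>2))) (at y)" if "s < y" for y
  proof -
    have y: "0 < y" using that \<open>0 \<le> s\<close> by simp
    have "(?\<rho> has_real_derivative ((2 / y * \<Gamma> y - \<gamma> y) * (1 + y) - \<gamma> y) / ((1 + y) * (1 + y))) (at y)"
      using y by (auto intro!: derivative_eq_intros \<gamma>_deriv that)
    moreover have "((2 / y * \<Gamma> y - \<gamma> y) * (1 + y) - \<gamma> y) / ((1 + y) * (1 + y)) = - W y / (y * (1 + y)\<^sup>2)"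
      using y by (simp add: W_def divide_simps power2_eq_square) (simp add: algebra_simps)
    ultimately show ?thesis using W_val[OF that] by simp
  qed
  have Ws: "(1 + s) * (2 * \<Gamma> s) - (2 + s) * s * \<gamma> s = - W s"
    by (simp add: W_def algebra_simps)
  have "?\<rho> t = ?\<rho> s + exp s * (- W s) * (LBINT y:{s..t}. exp (- y) / (y * (1 + y)\<^sup>2))"
  proof (cases "s = 0")
    case True
    \<comment> \<open>At \<open>s = 0\<close> the integral diverges, but the Wronskian that multiplies it vanishes.\<close>
    then have "W s = 0" using zero by (simp add: W_def)
    then have "?\<rho> t = ?\<rho> s"
      using \<rho>_deriv \<open>s < t\<close> by (intro DERIV_isconst_end[where f = ?\<rho>, OF _ \<rho>_cont]) auto
    then show ?thesis using \<open>W s = 0\<close> by simp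
  next
    case False
    then have "0 < s" using \<open>0 \<le> s\<close> by simp
    have cont: "continuous_on {s..t} (\<lambda>y. exp (- y) / (y * (1 + y)\<^sup>2))"
      using \<open>0 < s\<close> by (intro continuous_intros) auto
    have "((\<lambda>y. - (exp s * W s) * (exp (- y) / (y * (1 + y)\<^sup>2))) has_integral ?\<rho> t - ?\<rho> s) {s..t}"
      using \<open>s < t\<close> \<rho>_deriv
      by (intro fundamental_theorem_of_calculus_interior[OF _ \<rho>_cont])
         (auto simp: has_real_derivative_iff_has_vector_derivative[symmetric])
    then have "?\<rho> t - ?\<rho> s = integral {s..t} (\<lambda>y. - (exp s * W s) * (exp (- y) / (y * (1 + y)\<^sup>2)))"
      by (rule integral_unique[symmetric])
    also have "\<dots> = - (exp s * W s) * integral {s..t} (\<lambda>y. exp (- y) / (y * (1 + y)\<^sup>2))"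
      by (rule integral_mult_right)
    also have "integral {s..t} (\<lambda>y. exp (- y) / (y * (1 + y)\<^sup>2)) = (LBINT y:{s..t}. exp (- y) / (y * (1 + y)\<^sup>2))"
      by (rule LBINT_Icc_eq_integral(2)[symmetric], rule borel_integrable_atLeastAtMost', rule cont)
    finally show ?thesis by simp
  qed
  then show ?thesis
    unfolding Ws using \<open>0 \<le> s\<close> \<open>s < t\<close> by (simp add: divide_eq_eq mult.commute)
qed

section \<open>Asymptotics of the moment equations\<close>

lemma antimono_tendsto_at_top:
  fixes f :: "real \<Rightarrow> real"
  assumes dec: "\<And>x y. a \<le> x \<Longrightarrow> x \<le> y \<Longrightarrow> f y \<le> f x" and nonneg: "\<And>x. a \<le> x \<Longrightarrow> 0 \<le> f x"
  obtains L where "(f \<longlongrightarrow> L) at_top"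
proof (rule that)
  let ?L = "INF x\<in>{a..}. f x"
  have bdd: "bdd_below (f ` {a..})" using nonneg by (intro bdd_belowI[of _ 0]) auto
  show "(f \<longlongrightarrow> ?L) at_top"
  proof (rule order_tendstoI)
    fix l assume l: "l < ?L"
    show "eventually (\<lambda>x. l < f x) at_top"
      using eventually_ge_at_top[of a]
      by eventually_elim (use l in \<open>auto intro: less_le_trans cINF_lower[OF bdd]\<close>)
  next
    fix l assume "?L < l"
    then obtain x where x: "a \<le> x" "f x < l" using bdd by (auto simp: cINF_less_iff)
    show "eventually (\<lambda>x. f x < l) at_top"
      using eventually_ge_at_top[of x] by eventually_elim (use dec x in \<open>auto intro: le_less_trans\<close>)
  qed
qed

text \<open>
  The linear part of the Lyapunov estimate: the mixed terms, already bounded by squares, are absorbed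
  by the damping terms. The variables stand for products, \<open>pb\<close> for \<open>r * (P * B)\<close>, \<open>p2\<close> for \<open>P\<^sup>2\<close>, \<open>rrb\<close>
  for \<open>r\<^sup>2 * B\<^sup>2\<close> and so on.
\<close>

lemma lyapunov_absorb:
  fixes p2 s2 pb pe es ps rp rs re rrb rre :: real
  assumes "- 12 * pb \<le> p2 / 4 + 144 * rrb" "- pe \<le> p2 / 4 + rre" "- 2 * es \<le> s2 / 4 + 4 * rre"
    "- 3 * ps \<le> 3 / 2 * rp + 3 / 2 * rs" "10 * rre \<le> re" "0 \<le> rp" "0 \<le> rs" "0 \<le> p2" "0 \<le> s2"
  shows "2 * (- p2 - s2 - re - pe - 2 * es - 12 * pb - 3 * ps - 4 * rp - 7 * rs) \<le> - re - rp - rs + 288 * rrb"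
  using assms by argo

lemma lyapunov_absorb_slow:
  fixes p2 s2 pb pe es ps rp rs re rrb rre rrp rrs bs :: real
  assumes "- 12 * pb \<le> p2 / 4 + 144 * rrb" "- pe \<le> p2 / 4 + rre" "- 2 * es \<le> s2 / 4 + 4 * rre"
    "- 3 * ps \<le> 3 / 2 * rp + 3 / 2 * rs" "10 * rre \<le> re" "0 \<le> rp" "0 \<le> rs" "0 \<le> p2" "0 \<le> s2"
    and "2 * bs \<le> s2 / 4 + 4 * rrb" "0 \<le> rre" "0 \<le> rrp" "0 \<le> rrs"
  shows "2 * (2 * bs + (- p2 - s2 - re - pe - 2 * es - 12 * pb - 3 * ps - 4 * rp - 7 * rs))
      \<le> 296 * rrb + 296 * rre + 296 * rrp + 296 * rrs"
  using assms by argo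

text \<open>
  \<open>dB\<close>, \<open>dE\<close>, \<open>dP\<close>, \<open>dS\<close> are the velocities of the normalised moments. Every mixed term carries a factor
  \<open>1 / t\<close> and contains \<open>P\<close> or \<open>S\<close>. By the inequality of the means it is at most a small multiple of \<open>P\<^sup>2\<close>
  or \<open>S\<^sup>2\<close>, absorbed by their damping, plus a remainder of order \<open>1 / t\<^sup>2\<close> in \<open>B\<close> or \<open>E\<close>. The remainder
  in \<open>E\<close> is absorbed as well, by the damping \<open>E\<^sup>2 / t\<close>; \<open>B\<close> is not damped, and its remainder stays.
\<close>

lemma lyapunov_bounds:
  fixes t B E P S :: real
  assumes t: "10 \<le> t"
  defines "dB \<equiv> 2 * S / t" and "dE \<equiv> (P - E - 4 * S) / t"
    and "dP \<equiv> - P - (4 * P + 2 * E + 12 * B + 4 * S) / t" and "dS \<equiv> - S + (P + 2 * E - 7 * S) / t"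
  shows "2 * (E * dE + P * dP + S * dS) \<le> - (E\<^sup>2 + P\<^sup>2 + S\<^sup>2) / t + 288 * B\<^sup>2 / t\<^sup>2"
    and "2 * (B * dB + E * dE + P * dP + S * dS) \<le> 296 * (B\<^sup>2 + E\<^sup>2 + P\<^sup>2 + S\<^sup>2) / t\<^sup>2"
proof -
  define r where "r = 1 / t"
  have r: "0 < r" "10 * r \<le> 1" using t by (auto simp: r_def field_simps)
  have rr: "10 * r\<^sup>2 \<le> r" using r by (simp add: power2_eq_square)
  have PB: "- 12 * (r * (P * B)) \<le> P\<^sup>2 / 4 + 144 * (r\<^sup>2 * B\<^sup>2)"
    using zero_le_power2[of "P / 2 + 12 * r * B"] by (simp add: power2_eq_square algebra_simps)
  have BS: "2 * (r * (B * S)) \<le> S\<^sup>2 / 4 + 4 * (r\<^sup>2 * B\<^sup>2)"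
    using zero_le_power2[of "S / 2 - 2 * r * B"] by (simp add: power2_eq_square algebra_simps)
  have PE: "- (r * (P * E)) \<le> P\<^sup>2 / 4 + r\<^sup>2 * E\<^sup>2"
    using zero_le_power2[of "P / 2 + r * E"] by (simp add: power2_eq_square algebra_simps)
  have ES: "- 2 * (r * (E * S)) \<le> S\<^sup>2 / 4 + 4 * (r\<^sup>2 * E\<^sup>2)"
    using zero_le_power2[of "S / 2 + 2 * r * E"] by (simp add: power2_eq_square algebra_simps)
  have PS: "- 3 * (r * (P * S)) \<le> 3 / 2 * (r * P\<^sup>2) + 3 / 2 * (r * S\<^sup>2)"
    using mult_left_mono[OF zero_le_power2[of "P + S"], of "3 / 2 * r"] r by (simp add: power2_eq_square algebra_simps)
  have rE: "10 * (r\<^sup>2 * E\<^sup>2) \<le> r * E\<^sup>2"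
    using mult_right_mono[OF rr, of "E\<^sup>2"] by (simp add: mult.assoc)
  have nn: "0 \<le> r * P\<^sup>2" "0 \<le> r * S\<^sup>2" "0 \<le> r * E\<^sup>2" "0 \<le> r\<^sup>2 * B\<^sup>2" "0 \<le> r\<^sup>2 * E\<^sup>2" "0 \<le> P\<^sup>2" "0 \<le> S\<^sup>2"
      "0 \<le> r\<^sup>2 * P\<^sup>2" "0 \<le> r\<^sup>2 * S\<^sup>2"
    using r by auto
  have expand: "E * dE + P * dP + S * dS = - P\<^sup>2 - S\<^sup>2 - r * E\<^sup>2 - r * (P * E) - 2 * (r * (E * S)) - 12 * (r * (P * B))
      - 3 * (r * (P * S)) - 4 * (r * P\<^sup>2) - 7 * (r * S\<^sup>2)"
    using t unfolding dE_def dP_def dS_def r_def by (simp add: field_simps power2_eq_square)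
  have rhs1: "- (E\<^sup>2 + P\<^sup>2 + S\<^sup>2) / t + 288 * B\<^sup>2 / t\<^sup>2 = - (r * E\<^sup>2) - r * P\<^sup>2 - r * S\<^sup>2 + 288 * (r\<^sup>2 * B\<^sup>2)"
    using t unfolding r_def by (simp add: field_simps power2_eq_square)
  show "2 * (E * dE + P * dP + S * dS) \<le> - (E\<^sup>2 + P\<^sup>2 + S\<^sup>2) / t + 288 * B\<^sup>2 / t\<^sup>2"
    unfolding expand rhs1 by (rule lyapunov_absorb[OF PB PE ES PS rE nn(1,2,6,7)])
  have dB: "B * dB = 2 * (r * (B * S))" by (simp add: dB_def r_def)
  have rhs2: "296 * (B\<^sup>2 + E\<^sup>2 + P\<^sup>2 + S\<^sup>2) / t\<^sup>2 = 296 * (r\<^sup>2 * B\<^sup>2) + 296 * (r\<^sup>2 * E\<^sup>2) + 296 * (r\<^sup>2 * P\<^sup>2) + 296 * (r\<^sup>2 * S\<^sup>2)"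
    using t unfolding r_def by (simp add: field_simps power2_eq_square)
  have "2 * (B * dB + (E * dE + P * dP + S * dS)) \<le> 296 * (B\<^sup>2 + E\<^sup>2 + P\<^sup>2 + S\<^sup>2) / t\<^sup>2"
    unfolding expand rhs2 dB by (rule lyapunov_absorb_slow[OF PB PE ES PS rE nn(1,2,6,7) BS nn(5,8,9)])
  then show "2 * (B * dB + E * dE + P * dP + S * dS) \<le> 296 * (B\<^sup>2 + E\<^sup>2 + P\<^sup>2 + S\<^sup>2) / t\<^sup>2"
    by (simp add: add.assoc)
qed

text \<open>
  \<open>V exp (296 / t)\<close> decreases, so \<open>V\<close> converges. \<open>W = V - B\<^sup>2\<close> tends to zero: once \<open>B\<close> is known to be
  bounded, \<open>t W t - 288 b ln t\<close> decreases as well. Thus \<open>B\<^sup>2\<close> converges, and so does \<open>B \<ge> 0\<close>.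
\<close>

lemma moment_system_limits:
  fixes q h R Q :: "real \<Rightarrow> real"
  assumes t0: "10 \<le> t0"
    and dQ: "\<And>t. t0 \<le> t \<Longrightarrow> (Q has_real_derivative 2 * h t) (at t)"
    and dh: "\<And>t. t0 \<le> t \<Longrightarrow> (h has_real_derivative (q t + 2 / t * Q t) - h t) (at t)"
    and dR: "\<And>t. t0 \<le> t \<Longrightarrow> (R has_real_derivative q t) (at t)"
    and dq: "\<And>t. t0 \<le> t \<Longrightarrow> (q has_real_derivative (2 / t * R t + 2 / t\<^sup>2 * Q t) - q t) (at t)"
    and Q_nonneg: "\<And>t. t0 \<le> t \<Longrightarrow> 0 \<le> Q t"
  obtains K where "((\<lambda>t. q t / t\<^sup>2) \<longlongrightarrow> K) at_top" and "((\<lambda>t. h t / t ^ 3) \<longlongrightarrow> K / 3) at_top"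
proof -
  define A B C D where "A t = R t / t ^ 3" and "B t = Q t / t ^ 4" and "C t = q t / t\<^sup>2" and "D t = h t / t ^ 3" for t
  define P S E where "P t = C t - 2 * A t - 2 * B t" and "S t = D t - 2 * B t" and "E t = A t - 2 * B t" for t
  have dA: "(A has_real_derivative (P t - E t) / t) (at t)" if "t0 \<le> t" for t
  proof -
    have t: "0 < t" using that t0 by simp
    have "(A has_real_derivative (q t * t ^ 3 - R t * (3 * t\<^sup>2)) / (t ^ 3 * t ^ 3)) (at t)"
      unfolding A_def using t by (auto intro!: derivative_eq_intros dR[OF that])
    moreover have "(q t * t ^ 3 - R t * (3 * t\<^sup>2)) / (t ^ 3 * t ^ 3) = (P t - E t) / t"
      using t by (simp add: P_def E_def A_def B_def C_def field_simps power2_eq_square power3_eq_cube)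
    ultimately show ?thesis by simp
  qed
  have dB: "(B has_real_derivative 2 * S t / t) (at t)" if "t0 \<le> t" for t
  proof -
    have t: "0 < t" using that t0 by simp
    have "(B has_real_derivative (2 * h t * t ^ 4 - Q t * (4 * t ^ 3)) / (t ^ 4 * t ^ 4)) (at t)"
      unfolding B_def using t by (auto intro!: derivative_eq_intros dQ[OF that])
    moreover have "(2 * h t * t ^ 4 - Q t * (4 * t ^ 3)) / (t ^ 4 * t ^ 4) = 2 * S t / t"
      using t by (simp add: S_def B_def D_def field_simps) (simp add: power_numeral_reduce algebra_simps)
    ultimately show ?thesis by simp
  qed
  have dC: "(C has_real_derivative - P t - 2 * C t / t) (at t)" if "t0 \<le> t" for t
  proof -
    have t: "0 < t" using that t0 by simp
    have "(C has_real_derivative (((2 / t * R t + 2 / t\<^sup>2 * Q t) - q t) * t\<^sup>2 - q t * (2 * t)) / (t\<^sup>2 * t\<^sup>2)) (at t)"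
      unfolding C_def using t by (auto intro!: derivative_eq_intros dq[OF that])
    moreover have "(((2 / t * R t + 2 / t\<^sup>2 * Q t) - q t) * t\<^sup>2 - q t * (2 * t)) / (t\<^sup>2 * t\<^sup>2) = - P t - 2 * C t / t"
      using t by (simp add: P_def A_def B_def C_def field_simps) (simp add: power_numeral_reduce algebra_simps)
    ultimately show ?thesis by simp
  qed
  have dD: "(D has_real_derivative - S t + (C t - 3 * D t) / t) (at t)" if "t0 \<le> t" for t
  proof -
    have t: "0 < t" using that t0 by simp
    have "(D has_real_derivative (((q t + 2 / t * Q t) - h t) * t ^ 3 - h t * (3 * t\<^sup>2)) / (t ^ 3 * t ^ 3)) (at t)"
      unfolding D_def using t by (auto intro!: derivative_eq_intros dh[OF that])
    moreover have "(((q t + 2 / t * Q t) - h t) * t ^ 3 - h t * (3 * t\<^sup>2)) / (t ^ 3 * t ^ 3) = - S t + (C t - 3 * D t) / t"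
      using t by (simp add: S_def B_def C_def D_def field_simps) (simp add: power_numeral_reduce algebra_simps)
    ultimately show ?thesis by simp
  qed
  let ?dE = "\<lambda>t. (P t - E t - 4 * S t) / t"
  let ?dP = "\<lambda>t. - P t - (4 * P t + 2 * E t + 12 * B t + 4 * S t) / t"
  let ?dS = "\<lambda>t. - S t + (P t + 2 * E t - 7 * S t) / t"
  have dE: "(E has_real_derivative ?dE t) (at t)" if "t0 \<le> t" for t
  proof -
    have "(E has_real_derivative (P t - E t) / t - 2 * (2 * S t / t)) (at t)"
      unfolding E_def[abs_def] by (rule DERIV_diff[OF dA[OF that, unfolded E_def[abs_def]] DERIV_cmult[OF dB[OF that]]])
    moreover have "(P t - E t) / t - 2 * (2 * S t / t) = ?dE t" using that t0 by (simp add: field_simps)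
    ultimately show ?thesis by simp
  qed
  have dP: "(P has_real_derivative ?dP t) (at t)" if "t0 \<le> t" for t
  proof -
    have "((\<lambda>t. C t - 2 * A t - 2 * B t) has_real_derivative (- P t - 2 * C t / t) - 2 * ((P t - E t) / t) - 2 * (2 * S t / t)) (at t)"
      by (intro DERIV_diff DERIV_cmult dA dB dC that)
    moreover have "(- P t - 2 * C t / t) - 2 * ((P t - E t) / t) - 2 * (2 * S t / t) = ?dP t"
      using that t0 by (simp add: P_def E_def field_simps)
    moreover have "P = (\<lambda>t. C t - 2 * A t - 2 * B t)" by (simp add: P_def fun_eq_iff)
    ultimately show ?thesis by metis
  qed
  have dS: "(S has_real_derivative ?dS t) (at t)" if "t0 \<le> t" for t
  proof -
    have "((\<lambda>t. D t - 2 * B t) has_real_derivative (- S t + (C t - 3 * D t) / t) - 2 * (2 * S t / t)) (at t)"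
      by (intro DERIV_diff DERIV_cmult dB dD that)
    moreover have "(- S t + (C t - 3 * D t) / t) - 2 * (2 * S t / t) = ?dS t"
      using that t0 by (simp add: P_def E_def S_def field_simps)
    moreover have "S = (\<lambda>t. D t - 2 * B t)" by (simp add: S_def fun_eq_iff)
    ultimately show ?thesis by metis
  qed
  define W where "W t = (E t)\<^sup>2 + (P t)\<^sup>2 + (S t)\<^sup>2" for t
  define V where "V t = (B t)\<^sup>2 + W t" for t
  have W_nonneg: "0 \<le> W t" and V_nonneg: "0 \<le> V t" and B_le_V: "(B t)\<^sup>2 \<le> V t" for t
    by (simp_all add: W_def V_def)
  have dW: "(W has_real_derivative 2 * (E t * ?dE t + P t * ?dP t + S t * ?dS t)) (at t)" if "t0 \<le> t" for t
  proof -
    have "((\<lambda>t. (E t)\<^sup>2 + (P t)\<^sup>2 + (S t)\<^sup>2) has_real_derivative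
       of_nat 2 * (?dE t * E t ^ (2 - Suc 0)) + of_nat 2 * (?dP t * P t ^ (2 - Suc 0)) + of_nat 2 * (?dS t * S t ^ (2 - Suc 0))) (at t)"
      by (intro DERIV_add DERIV_power dE dP dS that)
    moreover have "of_nat 2 * (?dE t * E t ^ (2 - Suc 0)) + of_nat 2 * (?dP t * P t ^ (2 - Suc 0)) + of_nat 2 * (?dS t * S t ^ (2 - Suc 0))
       = 2 * (E t * ?dE t + P t * ?dP t + S t * ?dS t)"
      by (simp add: distrib_left mult_ac)
    moreover have "W = (\<lambda>t. (E t)\<^sup>2 + (P t)\<^sup>2 + (S t)\<^sup>2)" by (simp add: W_def fun_eq_iff)
    ultimately show ?thesis by metis
  qed
  have dV: "(V has_real_derivative 2 * (B t * (2 * S t / t) + E t * ?dE t + P t * ?dP t + S t * ?dS t)) (at t)" if "t0 \<le> t" for t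
  proof -
    have "((\<lambda>t. (B t)\<^sup>2 + W t) has_real_derivative
       of_nat 2 * ((2 * S t / t) * B t ^ (2 - Suc 0)) + 2 * (E t * ?dE t + P t * ?dP t + S t * ?dS t)) (at t)"
      by (intro DERIV_add DERIV_power dB dW that)
    moreover have "of_nat 2 * ((2 * S t / t) * B t ^ (2 - Suc 0)) + 2 * (E t * ?dE t + P t * ?dP t + S t * ?dS t)
       = 2 * (B t * (2 * S t / t) + E t * ?dE t + P t * ?dP t + S t * ?dS t)"
      by (simp add: distrib_left mult_ac)
    moreover have "V = (\<lambda>t. (B t)\<^sup>2 + W t)" by (simp add: V_def fun_eq_iff)
    ultimately show ?thesis by metis
  qed
  have V_le: "2 * (B t * (2 * S t / t) + E t * ?dE t + P t * ?dP t + S t * ?dS t) \<le> 296 * V t / t\<^sup>2" if "t0 \<le> t" for t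
    using lyapunov_bounds(2)[of t "B t" "S t" "E t" "P t"] that t0 by (simp add: V_def W_def add.assoc)
  have W_le: "2 * (E t * ?dE t + P t * ?dP t + S t * ?dS t) \<le> - W t / t + 288 * (B t)\<^sup>2 / t\<^sup>2" if "t0 \<le> t" for t
    using lyapunov_bounds(1)[of t "E t" "P t" "S t" "B t"] that t0 by (simp add: W_def)
  \<comment> \<open>The exponential factor has logarithmic derivative \<open>- 296 / t\<^sup>2\<close>, which cancels the growth that \<open>V_le\<close> permits.\<close>
  define F where "F t = V t * exp (296 / t)" for t
  have F_dec: "F y \<le> F x" if "t0 \<le> x" "x \<le> y" for x y
  proof (rule DERIV_nonpos_imp_nonincreasing[OF that(2)])
    fix t assume "x \<le> t" "t \<le> y"
    then have t: "t0 \<le> t" "0 < t" using that t0 by auto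
    let ?v = "2 * (B t * (2 * S t / t) + E t * ?dE t + P t * ?dP t + S t * ?dS t)"
    have "((\<lambda>t. exp (296 / t)) has_real_derivative exp (296 / t) * (- 296 / t\<^sup>2)) (at t)"
      using t by (auto intro!: derivative_eq_intros simp: power2_eq_square)
    from DERIV_mult[OF dV[OF t(1)] this]
    have "(F has_real_derivative ?v * exp (296 / t) + exp (296 / t) * (- 296 / t\<^sup>2) * V t) (at t)"
      by (simp only: F_def[abs_def])
    moreover have "?v * exp (296 / t) + exp (296 / t) * (- 296 / t\<^sup>2) * V t = (?v - 296 * V t / t\<^sup>2) * exp (296 / t)"
      by (simp add: left_diff_distrib)
    moreover have "(?v - 296 * V t / t\<^sup>2) * exp (296 / t) \<le> 0"
      using V_le[OF t(1)] by (intro mult_nonpos_nonneg) auto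
    ultimately show "\<exists>d. (F has_real_derivative d) (at t) \<and> d \<le> 0" by metis
  qed
  obtain L where L: "(F \<longlongrightarrow> L) at_top"
    using antimono_tendsto_at_top[of t0 F] F_dec V_nonneg by (auto simp: F_def)
  have V_lim: "(V \<longlongrightarrow> L) at_top"
  proof -
    have "((\<lambda>t::real. exp (- (296 / t))) \<longlongrightarrow> 1) at_top" by real_asymp
    from tendsto_mult[OF L this] have "((\<lambda>t. F t * exp (- (296 / t))) \<longlongrightarrow> L) at_top" by simp
    moreover have "F t * exp (- (296 / t)) = V t" for t by (simp add: F_def mult.assoc mult_exp_exp)
    ultimately show ?thesis by simp
  qed
  define b where "b = F t0"
  have V_bound: "V t \<le> b" if "t0 \<le> t" for t
  proof -
    have "V t * 1 \<le> V t * exp (296 / t)" using that t0 V_nonneg by (intro mult_left_mono) auto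
    then show ?thesis using F_dec[of t0 t] that by (simp add: F_def b_def)
  qed
  have b: "0 \<le> b" using V_bound[of t0] V_nonneg[of t0] by simp
  define H where "H t = t * W t - 288 * b * ln t" for t
  have H_dec: "H y \<le> H x" if "t0 \<le> x" "x \<le> y" for x y
  proof (rule DERIV_nonpos_imp_nonincreasing[OF that(2)])
    fix t assume "x \<le> t" "t \<le> y"
    then have t: "t0 \<le> t" "0 < t" using that t0 by auto
    let ?w = "2 * (E t * ?dE t + P t * ?dP t + S t * ?dS t)"
    have "(H has_real_derivative (1 * W t + ?w * t) - 288 * b * (1 / t)) (at t)"
      unfolding H_def[abs_def] using t
      by (intro DERIV_diff DERIV_mult DERIV_ident dW DERIV_cmult DERIV_ln_divide)
    moreover have "(1 * W t + ?w * t) - 288 * b * (1 / t) \<le> 0"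
    proof -
      have "?w * t \<le> (- W t / t + 288 * (B t)\<^sup>2 / t\<^sup>2) * t"
        using W_le[OF t(1)] t by (intro mult_right_mono) auto
      also have "\<dots> = - W t + 288 * (B t)\<^sup>2 / t"
        using t by (simp add: field_simps power2_eq_square)
      also have "288 * (B t)\<^sup>2 / t \<le> 288 * b / t"
        using t B_le_V[of t] V_bound[OF t(1)] by (intro divide_right_mono mult_left_mono) auto
      finally show ?thesis by simp
    qed
    ultimately show "\<exists>d. (H has_real_derivative d) (at t) \<and> d \<le> 0" by blast
  qed
  have W_lim: "(W \<longlongrightarrow> 0) at_top"
  proof (rule tendsto_sandwich)
    show "\<forall>\<^sub>F t in at_top. 0 \<le> W t" using W_nonneg by simp
    show "\<forall>\<^sub>F t in at_top. W t \<le> (H t0 + 288 * b * ln t) / t"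
      using eventually_ge_at_top[of t0]
    proof eventually_elim
      case (elim t)
      then have "0 < t" using t0 by simp
      have "t * W t \<le> H t0 + 288 * b * ln t" using H_dec[of t0 t] elim by (simp add: H_def)
      then show ?case using \<open>0 < t\<close> by (simp add: field_simps)
    qed
    show "((\<lambda>t. (H t0 + 288 * b * ln t) / t) \<longlongrightarrow> 0) at_top" by real_asymp
  qed simp
  have sq_to_zero: "(f \<longlongrightarrow> 0) at_top" if "\<And>t. (f t)\<^sup>2 \<le> W t" for f :: "real \<Rightarrow> real"
  proof -
    have "((\<lambda>t. (f t)\<^sup>2) \<longlongrightarrow> 0) at_top"
      by (rule tendsto_sandwich[OF _ _ tendsto_const W_lim]) (use that in auto)
    then have "((\<lambda>t. sqrt ((f t)\<^sup>2)) \<longlongrightarrow> sqrt 0) at_top" by (rule tendsto_real_sqrt)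
    then show ?thesis by (simp add: tendsto_rabs_zero_iff)
  qed
  have lims: "(E \<longlongrightarrow> 0) at_top" "(P \<longlongrightarrow> 0) at_top" "(S \<longlongrightarrow> 0) at_top"
    by (intro sq_to_zero; simp add: W_def)+
  have "((\<lambda>t. V t - W t) \<longlongrightarrow> L - 0) at_top" by (intro tendsto_diff V_lim W_lim)
  then have "((\<lambda>t. (B t)\<^sup>2) \<longlongrightarrow> L) at_top" by (simp add: V_def)
  then have "((\<lambda>t. sqrt ((B t)\<^sup>2)) \<longlongrightarrow> sqrt L) at_top" by (rule tendsto_real_sqrt)
  moreover have "\<forall>\<^sub>F t in at_top. sqrt ((B t)\<^sup>2) = B t"
    using eventually_ge_at_top[of t0] by eventually_elim (use Q_nonneg t0 in \<open>auto simp: B_def\<close>)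
  ultimately have B_lim: "(B \<longlongrightarrow> sqrt L) at_top" by (rule Lim_transform_eventually)
  \<comment> \<open>The definitions of \<open>P\<close>, \<open>E\<close>, \<open>S\<close> solved for the moments: \<open>C = P + 2 E + 6 B\<close> and \<open>D = S + 2 B\<close>.\<close>
  have "((\<lambda>t. P t + 2 * E t + 6 * B t) \<longlongrightarrow> 0 + 2 * 0 + 6 * sqrt L) at_top"
    by (intro tendsto_intros lims B_lim)
  then have "((\<lambda>t. q t / t\<^sup>2) \<longlongrightarrow> 6 * sqrt L) at_top"
    by (simp add: P_def E_def C_def)
  moreover have "((\<lambda>t. S t + 2 * B t) \<longlongrightarrow> 0 + 2 * sqrt L) at_top"
    by (intro tendsto_intros lims B_lim)
  then have "((\<lambda>t. h t / t ^ 3) \<longlongrightarrow> 6 * sqrt L / 3) at_top"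
    by (simp add: S_def D_def)
  ultimately show thesis by (rule that)
qed

text \<open>
  The integral of the covariance formula with its factor \<open>exp s\<close>, which compensates the size of the
  integrand at the lower end.
\<close>

definition tail_kernel :: "real \<Rightarrow> real \<Rightarrow> real" where
  "tail_kernel s t = exp s * (LBINT y:{s..t}. exp (- y) / (y * (1 + y)\<^sup>2))"

lemma kernel_derivative:
  fixes e y z :: real
  assumes "y \<noteq> 0" "z \<noteq> 0"
  shows "- ((- e * (y * z\<^sup>2) - e * (z\<^sup>2 + y * (2 * z))) / ((y * z\<^sup>2) * (y * z\<^sup>2)))
      = e / (y * z\<^sup>2) * (1 + 1 / y + 2 / z)"
  using assms by (simp add: divide_simps power2_eq_square) algebra

text \<open>
  Compared with the integrand \<open>f\<close>, the derivative of \<open>- f\<close> has the extra factor \<open>1 + 1 / y + 2 / (1 + y)\<close>,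
  which lies between \<open>1\<close> and \<open>1 + 3 / s\<close>.
\<close>

lemma tail_kernel_bounds:
  fixes s t :: real
  assumes "0 < s" "s \<le> t"
  shows "tail_kernel s t \<le> 1 / (s * (1 + s)\<^sup>2)"
    and "(1 - exp (- (t - s))) / ((1 + 3 / s) * (s * (1 + s)\<^sup>2)) \<le> tail_kernel s t"
proof -
  let ?f = "\<lambda>y. exp (- y) / (y * (1 + y)\<^sup>2)"
  let ?k = "\<lambda>y. 1 + 1 / y + 2 / (1 + y)"
  define \<phi> where "\<phi> y = 1 / (y * (1 + y)\<^sup>2)" for y :: real
  have cont: "continuous_on {s..t} ?f" using assms by (intro continuous_intros) auto
  have contk: "continuous_on {s..t} (\<lambda>y. ?f y * ?k y)" using assms by (intro continuous_intros) auto
  have LB: "(LBINT y:{s..t}. ?f y) = integral {s..t} ?f"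
    by (rule LBINT_Icc_eq_integral(2), rule borel_integrable_atLeastAtMost', rule cont)
  have "((\<lambda>y. ?f y * ?k y) has_integral (- ?f t) - (- ?f s)) {s..t}"
  proof (rule fundamental_theorem_of_calculus[OF assms(2)])
    fix y assume "y \<in> {s..t}"
    then have y: "0 < y" using assms by simp
    define d d' where "d = y * (1 + y)\<^sup>2" and "d' = (1 + y)\<^sup>2 + y * (2 * (1 + y))"
    have d: "d \<noteq> 0" using y by (simp add: d_def)
    have "((\<lambda>y. y * (1 + y)\<^sup>2) has_real_derivative d') (at y)"
      unfolding d'_def by (auto intro!: derivative_eq_intros)
    moreover have "((\<lambda>y. exp (- y)) has_real_derivative - exp (- y)) (at y)"
      by (auto intro!: derivative_eq_intros)
    ultimately have "(?f has_real_derivative (- exp (- y) * d - exp (- y) * d') / (d * d)) (at y)"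
      unfolding d_def using y by (intro DERIV_divide) auto
    from DERIV_minus[OF this]
    have deriv: "((\<lambda>y. - ?f y) has_real_derivative - ((- exp (- y) * d - exp (- y) * d') / (d * d))) (at y)" .
    have "- ((- exp (- y) * d - exp (- y) * d') / (d * d)) = exp (- y) / d * ?k y"
      unfolding d_def d'_def using y by (intro kernel_derivative) auto
    from DERIV_cong[OF deriv this]
    have "((\<lambda>y. - ?f y) has_real_derivative ?f y * ?k y) (at y)"
      unfolding d_def .
    then show "((\<lambda>y. - ?f y) has_vector_derivative ?f y * ?k y) (at y within {s..t})"
      unfolding has_real_derivative_iff_has_vector_derivative by (rule has_vector_derivative_at_within)
  qed
  then have J: "integral {s..t} (\<lambda>y. ?f y * ?k y) = ?f s - ?f t"
    by (simp add: integral_unique)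
  have f_nonneg: "0 \<le> ?f y" if "y \<in> {s..t}" for y using that assms by auto
  have f_eq: "?f y = exp (- y) * \<phi> y" for y by (simp add: \<phi>_def)
  have le1: "integral {s..t} ?f \<le> ?f s - ?f t"
    unfolding J[symmetric]
  proof (rule integral_le)
    show "?f integrable_on {s..t}" "(\<lambda>y. ?f y * ?k y) integrable_on {s..t}"
      by (intro integrable_continuous_real cont contk)+
    fix y assume y: "y \<in> {s..t}"
    then have "1 \<le> ?k y" using assms by simp
    then show "?f y \<le> ?f y * ?k y" using mult_left_mono[OF _ f_nonneg[OF y], of 1] by simp
  qed
  have le2: "?f s - ?f t \<le> (1 + 3 / s) * integral {s..t} ?f"
    unfolding J[symmetric] integral_mult_right[symmetric]
  proof (rule integral_le)
    show "(\<lambda>y. ?f y * ?k y) integrable_on {s..t}" "(\<lambda>y. (1 + 3 / s) * ?f y) integrable_on {s..t}"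
      by (intro integrable_continuous_real continuous_on_mult_left cont contk)+
    fix y assume y: "y \<in> {s..t}"
    have "1 / y \<le> 1 / s" "2 / (1 + y) \<le> 2 / s"
      using y assms by (auto intro!: divide_left_mono)
    then have "?k y \<le> 1 + 3 / s" by simp
    from mult_left_mono[OF this f_nonneg[OF y]] show "?f y * ?k y \<le> (1 + 3 / s) * ?f y"
      by (simp add: mult.commute)
  qed
  have fs: "exp s * ?f s = 1 / (s * (1 + s)\<^sup>2)" by (simp add: mult_exp_exp)
  have ft: "0 \<le> exp s * ?f t" using assms by simp
  have split: "exp s * (?f s - ?f t) = 1 / (s * (1 + s)\<^sup>2) - exp s * ?f t"
    by (simp only: right_diff_distrib fs)
  have "tail_kernel s t \<le> exp s * (?f s - ?f t)"
    unfolding tail_kernel_def LB using le1 by (intro mult_left_mono) auto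
  then show "tail_kernel s t \<le> 1 / (s * (1 + s)\<^sup>2)"
    unfolding split using ft by linarith
  have ft_le: "exp s * ?f t \<le> exp (- (t - s)) * (1 / (s * (1 + s)\<^sup>2))"
  proof -
    have "exp s * ?f t = exp (- (t - s)) * (1 / (t * (1 + t)\<^sup>2))" by (simp add: mult_exp_exp)
    also have "\<dots> \<le> exp (- (t - s)) * (1 / (s * (1 + s)\<^sup>2))"
      using assms by (intro mult_left_mono divide_left_mono mult_mono power_mono) auto
    finally show ?thesis .
  qed
  have "(1 - exp (- (t - s))) / (s * (1 + s)\<^sup>2) = 1 / (s * (1 + s)\<^sup>2) - exp (- (t - s)) * (1 / (s * (1 + s)\<^sup>2))"
    by (simp add: diff_divide_distrib)
  also have "\<dots> \<le> exp s * (?f s - ?f t)"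
    unfolding split using ft_le by linarith
  also have "\<dots> \<le> exp s * ((1 + 3 / s) * integral {s..t} ?f)"
    using le2 by (intro mult_left_mono) auto
  also have "\<dots> = (1 + 3 / s) * tail_kernel s t"
    unfolding tail_kernel_def LB by (simp add: mult_ac)
  finally have main: "(1 - exp (- (t - s))) / (s * (1 + s)\<^sup>2) \<le> (1 + 3 / s) * tail_kernel s t" .
  have "0 < 1 + 3 / s" using assms by (simp add: add_pos_pos)
  then have "(1 - exp (- (t - s))) / (s * (1 + s)\<^sup>2) / (1 + 3 / s) \<le> tail_kernel s t"
    using main by (simp only: pos_divide_le_eq[OF \<open>0 < 1 + 3 / s\<close>] mult.commute[of "tail_kernel s t"])
  then show "(1 - exp (- (t - s))) / ((1 + 3 / s) * (s * (1 + s)\<^sup>2)) \<le> tail_kernel s t"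
    by (simp only: divide_divide_eq_left mult.commute)
qed

lemma tail_kernel_limit:
  fixes s t :: "nat \<Rightarrow> real"
  assumes s: "filterlim s at_top sequentially" and ts: "filterlim (\<lambda>n. t n - s n) at_top sequentially"
  shows "(\<lambda>n. s n ^ 3 * tail_kernel (s n) (t n)) \<longlonglongrightarrow> 1"
proof (rule tendsto_sandwich)
  have ev: "\<forall>\<^sub>F n in sequentially. 0 < s n \<and> s n \<le> t n"
    using eventually_compose_filterlim[OF eventually_gt_at_top[of 0] s]
      eventually_compose_filterlim[OF eventually_ge_at_top[of 0] ts] by eventually_elim simp
  show "\<forall>\<^sub>F n in sequentially. s n ^ 3 * ((1 - exp (- (t n - s n))) / ((1 + 3 / s n) * (s n * (1 + s n)\<^sup>2)))
      \<le> s n ^ 3 * tail_kernel (s n) (t n)"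
    using ev by eventually_elim (rule mult_left_mono[OF tail_kernel_bounds(2)], auto)
  show "\<forall>\<^sub>F n in sequentially. s n ^ 3 * tail_kernel (s n) (t n) \<le> s n ^ 3 * (1 / (s n * (1 + s n)\<^sup>2))"
    using ev by eventually_elim (rule mult_left_mono[OF tail_kernel_bounds(1)], auto)
  have "((\<lambda>x::real. x ^ 3 * (1 / (x * (1 + x)\<^sup>2))) \<longlongrightarrow> 1) at_top" by real_asymp
  from filterlim_compose[OF this s] show "(\<lambda>n. s n ^ 3 * (1 / (s n * (1 + s n)\<^sup>2))) \<longlonglongrightarrow> 1" .
  have "((\<lambda>x::real. x ^ 3 / ((1 + 3 / x) * (x * (1 + x)\<^sup>2))) \<longlongrightarrow> 1) at_top" by real_asymp
  from filterlim_compose[OF this s] have a: "(\<lambda>n. s n ^ 3 / ((1 + 3 / s n) * (s n * (1 + s n)\<^sup>2))) \<longlonglongrightarrow> 1" .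
  have "((\<lambda>x::real. 1 - exp (- x)) \<longlongrightarrow> 1) at_top" by real_asymp
  from filterlim_compose[OF this ts] have "(\<lambda>n. 1 - exp (- (t n - s n))) \<longlonglongrightarrow> 1" .
  from tendsto_mult[OF a this]
  show "(\<lambda>n. s n ^ 3 * ((1 - exp (- (t n - s n))) / ((1 + 3 / s n) * (s n * (1 + s n)\<^sup>2)))) \<longlonglongrightarrow> 1"
    by simp
qed

text \<open>
  Dividing by \<open>t\<^sup>2\<close> and distributing powers of \<open>s\<close> leaves factors with limits: \<open>s / t\<close> tends to \<open>\<theta>\<close>, the
  first term to \<open>K\<close>, the bracket over \<open>s\<^sup>4\<close> to \<open>2 K / 3 - K\<close> and \<open>s\<^sup>3\<close> times the kernel to \<open>1\<close>, since
  \<open>\<theta> < 1\<close> forces \<open>t - s\<close> to infinity.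
\<close>

lemma covariance_limit:
  fixes q h :: "real \<Rightarrow> real" and s t :: "nat \<Rightarrow> real" and cst :: "nat \<Rightarrow> real"
  assumes q: "((\<lambda>t. q t / t\<^sup>2) \<longlongrightarrow> K) at_top" and h: "((\<lambda>t. h t / t ^ 3) \<longlongrightarrow> K / 3) at_top"
    and \<theta>: "0 < \<theta>" "\<theta> < 1"
    and s: "filterlim s at_top sequentially" and t: "filterlim t at_top sequentially"
    and ratio: "(\<lambda>n. s n / t n) \<longlonglongrightarrow> \<theta>"
    and formula: "\<forall>\<^sub>F n in sequentially. cst n = (1 + t n) * (q (s n) / (1 + s n) +
        ((1 + s n) * (2 * h (s n)) - (2 + s n) * s n * q (s n)) * tail_kernel (s n) (t n))"
  shows "(\<lambda>n. cst n / (t n)\<^sup>2) \<longlonglongrightarrow> 2 / 3 * \<theta> * K"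
proof -
  have ts: "filterlim (\<lambda>n. t n - s n) at_top sequentially"
  proof -
    have "(\<lambda>n. 1 - s n / t n) \<longlonglongrightarrow> 1 - \<theta>" by (intro tendsto_intros ratio)
    then have "filterlim (\<lambda>n. (1 - s n / t n) * t n) at_top sequentially"
      by (rule filterlim_tendsto_pos_mult_at_top[OF _ _ t]) (use \<theta> in simp)
    moreover have "\<forall>\<^sub>F n in sequentially. (1 - s n / t n) * t n = t n - s n"
      using eventually_compose_filterlim[OF eventually_gt_at_top[of 0] t]
      by eventually_elim (simp add: left_diff_distrib)
    ultimately show ?thesis by (rule filterlim_cong[THEN iffD1, OF refl refl, rotated])
  qed
  note J = tail_kernel_limit[OF s ts]
  note qs = filterlim_compose[OF q s] and hs = filterlim_compose[OF h s]
  have "((\<lambda>x::real. (1 + x) / x) \<longlongrightarrow> 1) at_top" by real_asymp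
  from filterlim_compose[OF this t] have a1: "(\<lambda>n. (1 + t n) / t n) \<longlonglongrightarrow> 1" .
  have "((\<lambda>x::real. x / (1 + x)) \<longlongrightarrow> 1) at_top" by real_asymp
  from filterlim_compose[OF this s] have a2: "(\<lambda>n. s n / (1 + s n)) \<longlonglongrightarrow> 1" .
  have "((\<lambda>x::real. (1 + x) / x) \<longlongrightarrow> 1) at_top" by real_asymp
  from filterlim_compose[OF this s] have a3: "(\<lambda>n. (1 + s n) / s n) \<longlonglongrightarrow> 1" .
  have "((\<lambda>x::real. (2 + x) / x) \<longlongrightarrow> 1) at_top" by real_asymp
  from filterlim_compose[OF this s] have a4: "(\<lambda>n. (2 + s n) / s n) \<longlonglongrightarrow> 1" .
  have lim: "(\<lambda>n. (1 + t n) / t n * (s n / t n) * (q (s n) / (s n)\<^sup>2 * (s n / (1 + s n)) +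
      (2 * ((1 + s n) / s n) * (h (s n) / s n ^ 3) - (2 + s n) / s n * (q (s n) / (s n)\<^sup>2)) *
      (s n ^ 3 * tail_kernel (s n) (t n)))) \<longlonglongrightarrow> 1 * \<theta> * (K * 1 + (2 * 1 * (K / 3) - 1 * K) * 1)"
    by (intro tendsto_intros a1 a2 a3 a4 ratio qs hs J)
  have "\<forall>\<^sub>F n in sequentially. (1 + t n) / t n * (s n / t n) * (q (s n) / (s n)\<^sup>2 * (s n / (1 + s n)) +
      (2 * ((1 + s n) / s n) * (h (s n) / s n ^ 3) - (2 + s n) / s n * (q (s n) / (s n)\<^sup>2)) *
      (s n ^ 3 * tail_kernel (s n) (t n))) = cst n / (t n)\<^sup>2"
    using formula eventually_compose_filterlim[OF eventually_gt_at_top[of 0] s]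
      eventually_compose_filterlim[OF eventually_gt_at_top[of 0] t]
  proof eventually_elim
    case (elim n)
    define a b e z where "a = s n" and "b = t n" and "e = q (s n)" and "z = h (s n)"
    define j where "j = tail_kernel (s n) (t n)"
    have pos: "0 < a" "0 < b" using elim by (auto simp: a_def b_def)
    have 1: "e / a\<^sup>2 * (a / (1 + a)) = e / (1 + a) / a"
      using pos by (simp add: power2_eq_square)
    have 2: "(2 * ((1 + a) / a) * (z / a ^ 3) - (2 + a) / a * (e / a\<^sup>2)) * (a ^ 3 * j)
        = ((1 + a) * (2 * z) - (2 + a) * a * e) * j / a"
      using pos by (simp add: field_simps power2_eq_square power3_eq_cube)
    have "(1 + b) / b * (a / b) * (e / a\<^sup>2 * (a / (1 + a)) +
      (2 * ((1 + a) / a) * (z / a ^ 3) - (2 + a) / a * (e / a\<^sup>2)) * (a ^ 3 * j))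
      = (1 + b) / b * (a / b) * ((e / (1 + a) + ((1 + a) * (2 * z) - (2 + a) * a * e) * j) / a)"
      unfolding 1 2 by (simp only: add_divide_distrib)
    also have "\<dots> = (1 + b) * (e / (1 + a) + ((1 + a) * (2 * z) - (2 + a) * a * e) * j) / b\<^sup>2"
      using pos by (simp add: power2_eq_square)
    finally show ?case using elim(1) unfolding a_def b_def e_def z_def j_def by simp
  qed
  from Lim_transform_eventually[OF lim this] show ?thesis
    by (simp add: algebra_simps)
qed

section \<open>Covariances of the adding process\<close>

lemma isCont_of_continuous_on:
  fixes f :: "real \<Rightarrow> real"
  assumes "continuous_on {a..} f" "a < t"
  shows "isCont f t"
  using assms by (intro continuous_on_interior[OF assms(1)]) (simp add: interior_real_atLeast)

context continuized_adding_process
begin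

lemma cmom_eq: "0 \<le> u \<Longrightarrow> 0 \<le> v \<Longrightarrow> cmom M X u v = c u v"
  unfolding cmom_def c_def
proof (rule integral_cong_AE)
  assume "0 \<le> u" "0 \<le> v"
  then show "AE \<omega> in M. X u \<omega> * X v \<omega> = Xt \<omega> u * Xt \<omega> v"
    using AE_regular by (auto elim!: eventually_mono simp: Xt_eq_X)
  show "(\<lambda>\<omega>. X u \<omega> * X v \<omega>) \<in> borel_measurable M"
    using X_measurable[OF \<open>0 \<le> u\<close>] X_measurable[OF \<open>0 \<le> v\<close>] by simp
qed measurable

lemma qmom_eq: "0 \<le> t \<Longrightarrow> qmom M X t = c t t"
  using cmom_eq[of t t] by (simp add: qmom_def cmom_def power2_eq_square)

text \<open>
  All times that occur in \<open>Q\<close> are nonnegative, where the measurable version agrees with the process.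
\<close>

lemma Qint_eq: "Qint M X t = Qt t"
  unfolding Qint_def Qt_def
  by (intro set_lebesgue_integral_cong) (auto intro!: set_lebesgue_integral_cong simp: cmom_eq)

lemma G_integral:
  assumes "0 \<le> s"
  shows "c s integrable_on {0..t}" and "G s t = integral {0..t} (c s)"
  using LBINT_Icc_eq_integral[OF set_integrable_c[OF assms, of t]] by (auto simp: G_def)

lemma R_integral: "(\<lambda>u. c u u) integrable_on {0..t}" "R t = integral {0..t} (\<lambda>u. c u u)"
  using LBINT_Icc_eq_integral[OF set_integrable_q[of t]] by (auto simp: R_def)

lemma G_continuous: "0 \<le> s \<Longrightarrow> continuous_on {0..} (G s)"
  using continuous_on_indefinite_integral[of 0 "c s"] G_integral[of s] by (simp add: fun_eq_iff cong: continuous_on_cong)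

lemma R_continuous: "continuous_on {0..} R"
  using continuous_on_indefinite_integral[of 0 "\<lambda>u. c u u"] R_integral by (simp cong: continuous_on_cong)

lemma c_continuous: "\<tau> \<le> s \<Longrightarrow> continuous_on {s..} (c s)"
  using \<tau>_nonneg by (intro relaxation_continuous[of s "\<lambda>y. 2 / y * G s y"] c_relax) auto

lemma c_deriv:
  assumes "\<tau> \<le> s" "s < t"
  shows "(c s has_real_derivative 2 / t * G s t - c s t) (at t)"
proof -
  have s: "0 \<le> s" "0 < t" using assms \<tau>_nonneg by auto
  have "isCont (\<lambda>y. 2 / y * G s y) t"
    using s isCont_of_continuous_on[OF G_continuous[OF s(1)] s(2)] by (intro continuous_intros) auto
  then show ?thesis
    using assms s by (intro relaxation_deriv[of s "\<lambda>y. 2 / y * G s y" "c s"] c_relax) auto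
qed

lemma G_deriv:
  assumes "\<tau> \<le> s" "s < t"
  shows "(G s has_real_derivative c s t) (at t)"
proof -
  have s: "0 \<le> s" "0 < t" using assms \<tau>_nonneg by auto
  have "((\<lambda>t. integral {0..t} (c s)) has_real_derivative c s t) (at t)"
    using s isCont_of_continuous_on[OF c_continuous[OF assms(1)] assms(2)]
    by (intro indefinite_integral_deriv G_integral(1)) auto
  moreover have "G s = (\<lambda>t. integral {0..t} (c s))" using G_integral(2)[OF s(1)] by auto
  ultimately show ?thesis by simp
qed

lemma Qt_integral:
  assumes "\<tau> \<le> t"
  shows "H integrable_on {\<tau>..t}" and "Qt t = Qt \<tau> + 2 * integral {\<tau>..t} H"
  using LBINT_Ioc_eq_integral[OF Qt_increment(1)[OF assms]] Qt_increment(2)[OF assms] by auto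

lemma Qt_continuous: "continuous_on {\<tau>..} Qt"
proof -
  have "continuous_on {\<tau>..} (\<lambda>t. Qt \<tau> + 2 * integral {\<tau>..t} H)"
    by (intro continuous_intros continuous_on_indefinite_integral Qt_integral(1))
  then show ?thesis by (rule continuous_on_eq) (simp add: Qt_integral(2)[symmetric])
qed

lemma H_continuous: "continuous_on {\<tau>..} H"
  by (rule relaxation_continuous[of \<tau> "\<lambda>y. c y y + 2 / y * Qt y"]) (rule H_relax, assumption)+

lemma q_continuous: "continuous_on {\<tau>..} (\<lambda>t. c t t)"
  by (rule relaxation_continuous[of \<tau> "\<lambda>y. 2 / y * R y + 2 / y\<^sup>2 * Qt y"]) (rule q_relax, assumption)+

lemma isCont_moments:
  assumes "\<tau> < t"
  shows "isCont R t" "isCont Qt t" "isCont H t" "isCont (\<lambda>t. c t t) t"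
  using assms \<tau>_nonneg isCont_of_continuous_on[OF R_continuous, of t] isCont_of_continuous_on[OF Qt_continuous]
    isCont_of_continuous_on[OF H_continuous] isCont_of_continuous_on[OF q_continuous] by auto

lemma moment_derivs:
  assumes "\<tau> < t"
  shows "(Qt has_real_derivative 2 * H t) (at t)"
    and "(H has_real_derivative (c t t + 2 / t * Qt t) - H t) (at t)"
    and "(R has_real_derivative c t t) (at t)"
    and "((\<lambda>t. c t t) has_real_derivative (2 / t * R t + 2 / t\<^sup>2 * Qt t) - c t t) (at t)"
proof -
  have t: "0 < t" using assms \<tau>_nonneg by simp
  note cont = isCont_moments[OF assms]
  have "((\<lambda>t. Qt \<tau> + 2 * integral {\<tau>..t} H) has_real_derivative 0 + 2 * H t) (at t)"
    by (intro DERIV_add DERIV_const DERIV_cmult indefinite_integral_deriv Qt_integral(1) assms cont)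
  then have "(Qt has_real_derivative 0 + 2 * H t) (at t)"
  proof (rule has_field_derivative_transform_within_open[where S = "{\<tau><..}"])
    show "Qt \<tau> + 2 * integral {\<tau>..r} H = Qt r" if "r \<in> {\<tau><..}" for r
      using that by (intro Qt_integral(2)[symmetric]) simp
  qed (use assms in auto)
  then show "(Qt has_real_derivative 2 * H t) (at t)" by simp
  have "isCont (\<lambda>y. c y y + 2 / y * Qt y) t"
    using t cont by (intro continuous_intros) auto
  with assms show "(H has_real_derivative (c t t + 2 / t * Qt t) - H t) (at t)"
    by (intro relaxation_deriv[of \<tau> "\<lambda>y. c y y + 2 / y * Qt y" H] H_relax) auto
  have "isCont (\<lambda>y. 2 / y * R y + 2 / y\<^sup>2 * Qt y) t"
    using t cont by (intro continuous_intros) auto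
  with assms show "((\<lambda>t. c t t) has_real_derivative (2 / t * R t + 2 / t\<^sup>2 * Qt t) - c t t) (at t)"
    by (intro relaxation_deriv[of \<tau> "\<lambda>y. 2 / y * R y + 2 / y\<^sup>2 * Qt y" "\<lambda>t. c t t"] q_relax) auto
  have "((\<lambda>t. integral {0..t} (\<lambda>u. c u u)) has_real_derivative c t t) (at t)"
    using t cont(4) by (intro indefinite_integral_deriv R_integral(1)) auto
  moreover have "R = (\<lambda>t. integral {0..t} (\<lambda>u. c u u))" using R_integral(2) by auto
  ultimately show "(R has_real_derivative c t t) (at t)" by simp
qed

text \<open>
  \<open>H\<close> is continuous from the right at \<open>\<tau>\<close>, so the derivative within \<open>[\<tau>, \<infinity>)\<close> equals \<open>2 H\<close> also there.
\<close>

lemma Qderiv_eq: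
  assumes "\<tau> \<le> s"
  shows "Qderiv M \<tau> X s = 2 * G s s"
proof -
  have "((\<lambda>t. integral {\<tau>..t} H) has_vector_derivative H s) (at s within {\<tau>..s + 1})"
    using assms by (intro integral_has_vector_derivative continuous_on_subset[OF H_continuous]) auto
  moreover have "at s within {\<tau>..s + 1} = at s within {\<tau>..}"
    by (rule at_within_nhd[of s "{..<s + 1}"]) auto
  ultimately have "((\<lambda>t. integral {\<tau>..t} H) has_vector_derivative H s) (at s within {\<tau>..})" by simp
  then have "((\<lambda>t. Qt \<tau> + 2 * integral {\<tau>..t} H) has_vector_derivative 0 + 2 * H s) (at s within {\<tau>..})"
    by (intro has_vector_derivative_add has_vector_derivative_const has_vector_derivative_mult_right)
  then have *: "((\<lambda>t. Qt \<tau> + 2 * integral {\<tau>..t} H) has_vector_derivative 2 * H s) (at s within {\<tau>..})"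
    by simp
  have "(Qt has_vector_derivative 2 * H s) (at s within {\<tau>..})"
    by (rule has_vector_derivative_transform[OF _ _ *]) (use assms in \<open>auto intro: Qt_integral(2)\<close>)
  moreover have "Qint M X = Qt" by (rule ext) (rule Qint_eq)
  moreover have "at s within {\<tau>..} \<noteq> bot"
  proof
    assume "at s within {\<tau>..} = bot"
    moreover have "at_right s \<le> at s within {\<tau>..}" using assms by (intro at_le) auto
    ultimately have "at_right s = bot" by (simp add: bot_unique)
    then show False using trivial_limit_at_right_real[of s] by simp
  qed
  ultimately show ?thesis
    unfolding Qderiv_def by (auto intro!: vector_derivative_within simp: H_def)
qed

text \<open>
  Up to the factor \<open>y\<^sup>2\<close>, \<open>Q y\<close> is the expectation of the square of the average of the path over \<open>[0, y]\<close>.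
  Where the product is not integrable over the marks, its integral is zero by convention, which is
  nonnegative as well.
\<close>

lemma Qt_nonneg:
  assumes "0 < y"
  shows "0 \<le> Qt y"
proof -
  interpret UM: pair_sigma_finite uniform_pair M
    by (intro pair_sigma_finite.intro prob_space_imp_sigma_finite prob_space_uniform_pair prob_space_axioms)
  have iq: "integrable std_uniform (\<lambda>a. c (y * a) (y * a))" by (rule integrable_uniform_q[OF assms])
  have q: "integrable uniform_pair (\<lambda>p. c (y * fst p) (y * fst p))" "integrable uniform_pair (\<lambda>p. c (y * snd p) (y * snd p))"
    using integrable_uniform_pair_fst[OF iq] integrable_uniform_pair_snd[OF iq] by auto
  note sp = sampled_product[of "\<lambda>p. y * fst p" "\<lambda>p. y * snd p", OF _ _ AE_scaled_nonneg[OF assms] q]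
  have "0 \<le> (\<integral>p. Xt \<omega> (y * fst p) * Xt \<omega> (y * snd p) \<partial>uniform_pair)" for \<omega>
  proof (cases "integrable uniform_pair (\<lambda>p. Xt \<omega> (y * fst p) * Xt \<omega> (y * snd p))")
    case True
    have "(\<integral>p. Xt \<omega> (y * fst p) * Xt \<omega> (y * snd p) \<partial>uniform_pair) =
        (\<integral>a. \<integral>b. Xt \<omega> (y * a) * Xt \<omega> (y * b) \<partial>std_uniform \<partial>std_uniform)"
      using pair_sigma_finite.integral_fst'[OF pair_sigma_finite_std_uniform True] by simp
    then show ?thesis by simp
  qed (simp add: not_integrable_integral_eq)
  then have "0 \<le> (\<integral>\<omega>. (\<integral>p. Xt \<omega> (y * fst p) * Xt \<omega> (y * snd p) \<partial>uniform_pair) \<partial>M)"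
    by (intro integral_nonneg_AE) simp
  also have "\<dots> = (\<integral>z. (case z of (p, \<omega>) \<Rightarrow> Xt \<omega> (y * fst p) * Xt \<omega> (y * snd p)) \<partial>(uniform_pair \<Otimes>\<^sub>M M))"
    using UM.integral_snd[of "\<lambda>p \<omega>. Xt \<omega> (y * fst p) * Xt \<omega> (y * snd p)"] sp(1) by simp
  also have "\<dots> = (\<integral>p. c (y * fst p) (y * snd p) \<partial>uniform_pair)" using sp(3) by simp
  also have "\<dots> = Qt y / y / y" using sp(2) by (simp add: pair_average assms)
  finally show ?thesis using assms mult_pos_pos[OF assms assms] by (auto simp: zero_le_divide_iff)
qed

lemma covariance_formula:
  assumes "\<tau> \<le> s" "s < t"
  shows "cmom M X s t = (1 + t) * (qmom M X s / (1 + s) +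
      exp s * ((1 + s) * Qderiv M \<tau> X s - (2 + s) * s * qmom M X s) *
      (LBINT y:{s..t}. exp (- y) / (y * (1 + y)\<^sup>2)))"
proof -
  have s: "0 \<le> s" using assms \<tau>_nonneg by simp
  have "c s t = (1 + t) * (c s s / (1 + s) + exp s * ((1 + s) * (2 * G s s) - (2 + s) * s * c s s) *
      (LBINT y:{s..t}. exp (- y) / (y * (1 + y)\<^sup>2)))"
  proof (rule solution_formula[where \<gamma> = "c s" and \<Gamma> = "G s", OF s assms(2)])
    show "continuous_on {s..} (c s)" by (rule c_continuous[OF assms(1)])
    show "continuous_on {s..} (G s)" using G_continuous[OF s] by (rule continuous_on_subset) (use s in auto)
    show "G s 0 = 0" if "s = 0"
      unfolding G_def set_lebesgue_integral_def
      by (intro integral_eq_zero_AE AE_I[where N = "{0}"]) (auto split: split_indicator_asm)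
  qed (rule c_deriv[OF assms(1)] G_deriv[OF assms(1)], assumption)+
  then show ?thesis using s assms by (simp add: cmom_eq qmom_eq Qderiv_eq)
qed

lemma second_moment_limits:
  obtains K where "((\<lambda>t. c t t / t\<^sup>2) \<longlongrightarrow> K) at_top" "((\<lambda>t. H t / t ^ 3) \<longlongrightarrow> K / 3) at_top"
proof (rule moment_system_limits[of "max 10 (\<tau> + 1)" Qt H "\<lambda>t. c t t" R])
  fix t assume "max 10 (\<tau> + 1) \<le> t"
  then have t: "\<tau> < t" "0 < t" by auto
  show "(Qt has_real_derivative 2 * H t) (at t)"
    "(H has_real_derivative (c t t + 2 / t * Qt t) - H t) (at t)"
    "(R has_real_derivative c t t) (at t)"
    "((\<lambda>t. c t t) has_real_derivative (2 / t * R t + 2 / t\<^sup>2 * Qt t) - c t t) (at t)"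
    using moment_derivs[OF t(1)] by auto
  show "0 \<le> Qt t" by (rule Qt_nonneg[OF t(2)])
qed (auto intro: that)

lemma covariance_limits:
  "\<exists>K. ((\<lambda>t. qmom M X t / t\<^sup>2) \<longlongrightarrow> K) at_top \<and>
      (\<forall>\<theta> (s :: nat \<Rightarrow> real) (t :: nat \<Rightarrow> real).
         0 < \<theta> \<and> \<theta> < 1 \<and>
         filterlim s at_top sequentially \<and> filterlim t at_top sequentially \<and>
         (\<forall>n. s n \<le> t n) \<and> (\<lambda>n. s n / t n) \<longlonglongrightarrow> \<theta> \<longrightarrow>
         (\<lambda>n. cmom M X (s n) (t n) / (t n)\<^sup>2) \<longlonglongrightarrow> 2 / 3 * \<theta> * K) \<and>
      ((\<lambda>t. cmom M X t t / t\<^sup>2) \<longlongrightarrow> K) at_top"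
proof -
  obtain K where q: "((\<lambda>t. c t t / t\<^sup>2) \<longlongrightarrow> K) at_top" and h: "((\<lambda>t. H t / t ^ 3) \<longlongrightarrow> K / 3) at_top"
    by (rule second_moment_limits)
  have ev: "\<forall>\<^sub>F t in at_top. c t t / t\<^sup>2 = qmom M X t / t\<^sup>2" "\<forall>\<^sub>F t in at_top. c t t / t\<^sup>2 = cmom M X t t / t\<^sup>2"
    using eventually_ge_at_top[of 0] by (eventually_elim, simp add: qmom_eq cmom_eq)+
  have "(\<lambda>n. cmom M X (s n) (t n) / (t n)\<^sup>2) \<longlonglongrightarrow> 2 / 3 * \<theta> * K"
    if \<theta>: "0 < \<theta>" "\<theta> < 1" and s: "filterlim s at_top sequentially" and t: "filterlim t at_top sequentially"
      and ratio: "(\<lambda>n. s n / t n) \<longlonglongrightarrow> \<theta>" for \<theta> and s t :: "nat \<Rightarrow> real"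
  proof (rule covariance_limit[OF q h \<theta> s t ratio])
    show "\<forall>\<^sub>F n in sequentially. cmom M X (s n) (t n) = (1 + t n) * (c (s n) (s n) / (1 + s n) +
        ((1 + s n) * (2 * H (s n)) - (2 + s n) * s n * c (s n) (s n)) * tail_kernel (s n) (t n))"
      using eventually_compose_filterlim[OF eventually_ge_at_top[of \<tau>] s]
        eventually_compose_filterlim[OF eventually_gt_at_top[of 0] t] order_tendstoD(2)[OF ratio \<theta>(2)]
    proof eventually_elim
      case (elim n)
      then have "s n < t n" by (simp add: pos_divide_less_eq)
      then show ?case
        using elim(1) \<tau>_nonneg covariance_formula[of "s n" "t n"]
        by (simp add: qmom_eq Qderiv_eq H_def tail_kernel_def mult_ac)
    qed
  qed
  then show ?thesis
    using Lim_transform_eventually[OF q ev(1)] Lim_transform_eventually[OF q ev(2)] by blast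
qed

end

theorem theorem9:
  fixes M :: "'a measure" and \<tau> :: real and x :: "real \<Rightarrow> real"
    and T U V :: "nat \<Rightarrow> 'a \<Rightarrow> real" and X :: "real \<Rightarrow> 'a \<Rightarrow> real"
  assumes "continuized_adding_process M \<tau> x T U V X"
  shows "(\<forall>s t. \<tau> \<le> s \<and> s < t \<longrightarrow>
            cmom M X s t =
              (1 + t) * (qmom M X s / (1 + s) +
                exp s * ((1 + s) * Qderiv M \<tau> X s - (2 + s) * s * qmom M X s) *
                (LBINT y:{s..t}. exp (- y) / (y * (1 + y)\<^sup>2)))) \<and>
         (\<exists>K. ((\<lambda>t. qmom M X t / t\<^sup>2) \<longlongrightarrow> K) at_top \<and>
            (\<forall>\<theta> (s :: nat \<Rightarrow> real) (t :: nat \<Rightarrow> real).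
               0 < \<theta> \<and> \<theta> < 1 \<and>
               filterlim s at_top sequentially \<and> filterlim t at_top sequentially \<and>
               (\<forall>n. s n \<le> t n) \<and> (\<lambda>n. s n / t n) \<longlonglongrightarrow> \<theta> \<longrightarrow>
               (\<lambda>n. cmom M X (s n) (t n) / (t n)\<^sup>2) \<longlonglongrightarrow> 2 / 3 * \<theta> * K) \<and>
            ((\<lambda>t. cmom M X t t / t\<^sup>2) \<longlongrightarrow> K) at_top)"
proof -
  interpret continuized_adding_process M \<tau> x T U V X by fact
  show ?thesis
    using covariance_formula covariance_limits by blast
qed

end
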